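(* Let $G$ be a finitely generated group given by the presentation \[\langle x_1, \ldots, x_d\ :\ u_1^{m_1}, \ldots,u_r^{m_r}\rangle\] with finitely many generators $x_1,\dots,x_d$ and finitely many relators, where each $u_i$ is an element of the free group on $\{x_1,\dots,x_d\}$ and each $m_i$ is a positive integer, such that the image of $u_i$ in $G$ has order exactly $m_i$ for every $i=1,\dots,r$. If \[d>1+\sum_{i=1}^r \frac{1}{m_i},\] then $G$ is infinite, $G$ does not satisfy Kazhdan's property (T), and $G$ has no infinite amenable normal subgroup.
   Context: $G$ is regarded as a discrete group; Kazhdan's property (T) and amenability have their usual meaning for discrete groups. The case $m_i=1$ is allowed. *)

theory Defs
  imports "HOL-Algebra.Module" "HOL-Algebra.Multiplicative_Group" Complex_Main
begin

section \<open>Free groups and presentations\<close>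

text \<open>A letter \<open>(a, True)\<close> stands for the generator \<open>a\<close>, a letter \<open>(a, False)\<close> for its inverse.\<close>

definition inv_letter :: "'g \<times> bool \<Rightarrow> 'g \<times> bool" where
  "inv_letter a = (fst a, \<not> snd a)"

definition reduced :: "('g \<times> bool) list \<Rightarrow> bool" where
  "reduced w \<longleftrightarrow> successively (\<lambda>a b. b \<noteq> inv_letter a) w"

fun push_letter :: "'g \<times> bool \<Rightarrow> ('g \<times> bool) list \<Rightarrow> ('g \<times> bool) list" where
  "push_letter a [] = [a]"
| "push_letter a (b # w) = (if b = inv_letter a then w else a # b # w)"

definition free_group :: "'g set \<Rightarrow> ('g \<times> bool) list monoid" where
  "free_group S = \<lparr>carrier = {w. fst ` set w \<subseteq> S \<and> reduced w},
                   monoid.mult = (\<lambda>v w. foldr push_letter v w),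
                   one = []\<rparr>"

definition free_lift :: "('a, 'b) monoid_scheme \<Rightarrow> ('g \<Rightarrow> 'a) \<Rightarrow> ('g \<times> bool) list \<Rightarrow> 'a" where
  "free_lift G x w =
     foldr (\<lambda>(a, b) g. (if b then x a else inv\<^bsub>G\<^esub> x a) \<otimes>\<^bsub>G\<^esub> g) w \<one>\<^bsub>G\<^esub>"

definition normal_closure :: "('a, 'b) monoid_scheme \<Rightarrow> 'a set \<Rightarrow> 'a set" where
  "normal_closure G R = \<Inter>{N. N \<lhd> G \<and> R \<subseteq> N}"

text \<open>The family \<open>x\<close>, indexed by \<open>S\<close>, generates \<open>G\<close>, and the kernel of the canonical
  epimorphism from the free group on \<open>S\<close> is the normal closure of the relators \<open>R\<close>.\<close>

definition presented_by ::
  "('a, 'b) monoid_scheme \<Rightarrow> ('g \<Rightarrow> 'a) \<Rightarrow> 'g set \<Rightarrow> ('g \<times> bool) list set \<Rightarrow> bool" where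
  "presented_by G x S R \<longleftrightarrow>
     x ` S \<subseteq> carrier G \<and>
     free_lift G x ` carrier (free_group S) = carrier G \<and>
     kernel (free_group S) G (free_lift G x) = normal_closure (free_group S) R"

lemma inv_letter_inv_letter [simp]: "inv_letter (inv_letter a) = a"
  by (simp add: inv_letter_def)

lemma fst_inv_letter [simp]: "fst (inv_letter a) = fst a"
  by (simp add: inv_letter_def)

lemma inv_letter_neq [simp]: "inv_letter a \<noteq> a" "a \<noteq> inv_letter a"
  by (auto simp: inv_letter_def prod_eq_iff)

lemma reduced_Nil [simp]: "reduced []"
  by (simp add: reduced_def)

lemma reduced_ConsD: "reduced (a # w) \<Longrightarrow> reduced w"
  by (cases w) (auto simp: reduced_def)

lemma reduced_push: "reduced w \<Longrightarrow> reduced (push_letter a w)"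
  by (cases w) (auto simp: reduced_def dest: reduced_ConsD[unfolded reduced_def])

lemma push_push_inv: "reduced w \<Longrightarrow> push_letter a (push_letter (inv_letter a) w) = w"
  by (cases w rule: remdups_adj.cases) (auto simp: reduced_def)

lemma push_Cons: "reduced (a # w) \<Longrightarrow> push_letter a w = a # w"
  by (cases w) (auto simp: reduced_def)

lemma fst_set_push: "fst ` set (push_letter a w) \<subseteq> insert (fst a) (fst ` set w)"
  by (cases w) auto

lemma reduced_foldr_push: "reduced w \<Longrightarrow> reduced (foldr push_letter v w)"
  by (induction v) (auto intro: reduced_push)

lemma fst_set_foldr_push: "fst ` set (foldr push_letter v w) \<subseteq> fst ` set v \<union> fst ` set w"
proof (induction v)
  case (Cons a v)
  have "fst ` set (foldr push_letter (a # v) w) \<subseteq> insert (fst a) (fst ` set (foldr push_letter v w))"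
    using fst_set_push by simp
  also have "\<dots> \<subseteq> insert (fst a) (fst ` set v \<union> fst ` set w)"
    using Cons by (rule insert_mono)
  finally show ?case by simp
qed simp

lemma foldr_push_push:
  assumes "reduced w"
  shows "foldr push_letter (push_letter a v) w = push_letter a (foldr push_letter v w)"
proof (cases v)
  case (Cons b v')
  show ?thesis
  proof (cases "b = inv_letter a")
    case True
    then show ?thesis using Cons push_push_inv[OF reduced_foldr_push[OF assms]] by simp
  qed (simp add: Cons)
qed simp

lemma foldr_push_assoc:
  assumes "reduced w"
  shows "foldr push_letter (foldr push_letter u v) w = foldr push_letter u (foldr push_letter v w)"
  by (induction u) (simp_all add: foldr_push_push[OF assms])

lemma foldr_push_Nil: "reduced v \<Longrightarrow> foldr push_letter v [] = v"
proof (induction v)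
  case (Cons a v)
  then show ?case using reduced_ConsD[OF Cons.prems] push_Cons[OF Cons.prems] by simp
qed simp

lemma foldr_push_inverse: "foldr push_letter (rev (map inv_letter v)) (foldr push_letter v w) = w"
  if "reduced w"
  using that
proof (induction v arbitrary: w)
  case (Cons a v)
  have "push_letter (inv_letter a) (push_letter a (foldr push_letter v w)) = foldr push_letter v w"
    using push_push_inv[OF reduced_foldr_push[OF Cons.prems], of "inv_letter a"] by simp
  then show ?case using Cons by simp
qed simp

theorem group_free_group: "group (free_group S)"
proof (rule groupI)
  fix v w assume "v \<in> carrier (free_group S)" "w \<in> carrier (free_group S)"
  then show "v \<otimes>\<^bsub>free_group S\<^esub> w \<in> carrier (free_group S)"
    using subset_trans[OF fst_set_foldr_push[of v w], of S]
    by (simp add: free_group_def reduced_foldr_push)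
next
  fix v assume v: "v \<in> carrier (free_group S)"
  let ?w = "foldr push_letter (rev (map inv_letter v)) []"
  have "?w \<in> carrier (free_group S)"
    using v fst_set_foldr_push[of "rev (map inv_letter v)" "[]"]
    by (force simp: free_group_def reduced_foldr_push)
  moreover have "foldr push_letter ?w v = []"
  proof -
    have r: "reduced v" using v by (simp add: free_group_def)
    show ?thesis
      using foldr_push_assoc[OF r, of "rev (map inv_letter v)" "[]"]
        foldr_push_inverse[of "[]" v] foldr_push_Nil[OF r] by simp
  qed
  ultimately show "\<exists>w\<in>carrier (free_group S). w \<otimes>\<^bsub>free_group S\<^esub> v = \<one>\<^bsub>free_group S\<^esub>"
    by (auto simp: free_group_def)
qed (auto simp: free_group_def foldr_push_assoc)

theorem (in group) free_lift_hom:
  assumes x: "x ` S \<subseteq> carrier G"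
  shows "free_lift G x \<in> hom (free_group S) G"
proof -
  have cl: "free_lift G x w \<in> carrier G" if "fst ` set w \<subseteq> S" for w
    using that x by (induction w) (auto simp: free_lift_def)
  have push: "free_lift G x (push_letter a w) = free_lift G x [a] \<otimes> free_lift G x w"
    if "fst a \<in> S" "fst ` set w \<subseteq> S" for a w
  proof (cases w)
    case Nil
    then show ?thesis using cl[of "[a]"] that by (auto simp: free_lift_def)
  next
    case (Cons b v)
    have xa: "x (fst a) \<in> carrier G" using that x by auto
    have v: "free_lift G x v \<in> carrier G" using cl[of v] that Cons by auto
    have w: "free_lift G x w \<in> carrier G" using cl[of w] that by auto
    show ?thesis
    proof (cases "b = inv_letter a")
      case True
      then show ?thesis using Cons xa v
        by (cases a) (auto simp: free_lift_def inv_letter_def m_assoc[symmetric])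
    next
      case False
      then show ?thesis using Cons xa w
        by (auto simp: free_lift_def split: prod.splits)
    qed
  qed
  have mult: "free_lift G x (foldr push_letter v w) = free_lift G x v \<otimes> free_lift G x w"
    if "fst ` set v \<subseteq> S" "fst ` set w \<subseteq> S" for v w
    using that(1)
  proof (induction v)
    case Nil
    then show ?case using cl[OF that(2)] by (simp add: free_lift_def)
  next
    case (Cons a v)
    have 1: "free_lift G x (a # v) = free_lift G x [a] \<otimes> free_lift G x v"
      using Cons.prems x cl[of v] by (auto simp: free_lift_def split: prod.splits)
    have "fst ` set (foldr push_letter v w) \<subseteq> S"
      using subset_trans[OF fst_set_foldr_push[of v w], of S] Cons.prems that(2) by simp
    then show ?case
      using Cons push[of a "foldr push_letter v w"] cl[of "[a]"] cl[of v] cl[OF that(2)]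
      by (simp add: 1 m_assoc)
  qed
  show ?thesis
    by (auto simp: hom_def free_group_def intro: cl mult)
qed

lemma free_lift_generator:
  assumes "group G" "x a \<in> carrier G"
  shows "free_lift G x [(a, True)] = x a"
proof -
  interpret group G by fact
  show ?thesis using assms by (simp add: free_lift_def)
qed


section \<open>Amenability\<close>

definition amenable_group :: "('a, 'b) monoid_scheme \<Rightarrow> bool" where
  "amenable_group G \<longleftrightarrow>
     (\<exists>\<mu> :: 'a set \<Rightarrow> real.
        (\<forall>A. A \<subseteq> carrier G \<longrightarrow> 0 \<le> \<mu> A) \<and>
        \<mu> (carrier G) = 1 \<and>
        (\<forall>A B. A \<subseteq> carrier G \<longrightarrow> B \<subseteq> carrier G \<longrightarrow> A \<inter> B = {} \<longrightarrow> \<mu> (A \<union> B) = \<mu> A + \<mu> B) \<and>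
        (\<forall>g\<in>carrier G. \<forall>A. A \<subseteq> carrier G \<longrightarrow> \<mu> (g <#\<^bsub>G\<^esub> A) = \<mu> A))"


section \<open>Complex Hilbert spaces and unitary representations\<close>

definition complex_ring :: "complex ring" where
  "complex_ring = \<lparr>carrier = UNIV, monoid.mult = (*), one = 1, zero = 0, add = (+)\<rparr>"

text \<open>The fields \<open>mult\<close> and \<open>one\<close> inherited from rings are irrelevant, as for modules in the
  library.\<close>

record 'h hermitian_space = "(complex, 'h) module" +
  cip :: "'h \<Rightarrow> 'h \<Rightarrow> complex"

definition cnorm :: "('h, 'c) hermitian_space_scheme \<Rightarrow> 'h \<Rightarrow> real" where
  "cnorm V v = sqrt (Re (cip V v v))"

locale complex_hilbert_space = module complex_ring V
  for V :: "('h, 'c) hermitian_space_scheme" (structure) +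
  assumes cip_add_left: "\<lbrakk>u \<in> carrier V; v \<in> carrier V; w \<in> carrier V\<rbrakk>
            \<Longrightarrow> cip V (u \<oplus> v) w = cip V u w + cip V v w"
    and cip_smult_left: "\<lbrakk>v \<in> carrier V; w \<in> carrier V\<rbrakk> \<Longrightarrow> cip V (c \<odot> v) w = c * cip V v w"
    and cip_commute: "\<lbrakk>v \<in> carrier V; w \<in> carrier V\<rbrakk> \<Longrightarrow> cip V w v = cnj (cip V v w)"
    and cip_nonneg: "v \<in> carrier V \<Longrightarrow> 0 \<le> Re (cip V v v)"
    and cip_definite: "\<lbrakk>v \<in> carrier V; cip V v v = 0\<rbrakk> \<Longrightarrow> v = \<zero>"
    and complete: "\<lbrakk>\<And>n. s n \<in> carrier V;
              \<And>e. e > 0 \<Longrightarrow> \<exists>N. \<forall>m\<ge>N. \<forall>n\<ge>N. cnorm V (s m \<ominus> s n) < e\<rbrakk>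
            \<Longrightarrow> \<exists>l\<in>carrier V. (\<lambda>n. cnorm V (s n \<ominus> l)) \<longlonglongrightarrow> 0"

text \<open>Bijectivity of the operators follows from the two homomorphism axioms.\<close>

locale unitary_representation = group G + complex_hilbert_space V
  for G :: "('a, 'b) monoid_scheme" (structure)
    and V :: "('h, 'c) hermitian_space_scheme" (structure) +
  fixes \<pi> :: "'a \<Rightarrow> 'h \<Rightarrow> 'h"
  assumes rep_closed: "\<lbrakk>g \<in> carrier G; v \<in> carrier V\<rbrakk> \<Longrightarrow> \<pi> g v \<in> carrier V"
    and rep_add: "\<lbrakk>g \<in> carrier G; v \<in> carrier V; w \<in> carrier V\<rbrakk>
          \<Longrightarrow> \<pi> g (v \<oplus>\<^bsub>V\<^esub> w) = \<pi> g v \<oplus>\<^bsub>V\<^esub> \<pi> g w"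
    and rep_smult: "\<lbrakk>g \<in> carrier G; v \<in> carrier V\<rbrakk> \<Longrightarrow> \<pi> g (c \<odot>\<^bsub>V\<^esub> v) = c \<odot>\<^bsub>V\<^esub> \<pi> g v"
    and rep_cip: "\<lbrakk>g \<in> carrier G; v \<in> carrier V; w \<in> carrier V\<rbrakk>
          \<Longrightarrow> cip V (\<pi> g v) (\<pi> g w) = cip V v w"
    and rep_mult: "\<lbrakk>g \<in> carrier G; h \<in> carrier G; v \<in> carrier V\<rbrakk>
          \<Longrightarrow> \<pi> (g \<otimes>\<^bsub>G\<^esub> h) v = \<pi> g (\<pi> h v)"
    and rep_one: "v \<in> carrier V \<Longrightarrow> \<pi> \<one>\<^bsub>G\<^esub> v = v"


section \<open>Property (T)\<close>

text \<open>The type argument bounds the Hilbert spaces that are considered: their carriers are subsets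
  of \<open>'h\<close>.\<close>

definition kazhdan_pair ::
  "'h itself \<Rightarrow> ('a, 'b) monoid_scheme \<Rightarrow> 'a set \<Rightarrow> real \<Rightarrow> bool" where
  "kazhdan_pair (_ :: 'h itself) G Q \<epsilon> \<longleftrightarrow>
     (\<forall>(V :: 'h hermitian_space) \<pi>.
        unitary_representation G V \<pi> \<longrightarrow>
        (\<exists>v\<in>carrier V. v \<noteq> \<zero>\<^bsub>V\<^esub> \<and> (\<forall>g\<in>Q. cnorm V (\<pi> g v \<ominus>\<^bsub>V\<^esub> v) < \<epsilon> * cnorm V v)) \<longrightarrow>
        (\<exists>w\<in>carrier V. w \<noteq> \<zero>\<^bsub>V\<^esub> \<and> (\<forall>g\<in>carrier G. \<pi> g w = w)))"

text \<open>The type \<open>'a \<Rightarrow> complex\<close> is large enough to carry every cyclic representation of a group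
  on \<open>'a\<close>, so this definition speaks about all unitary representations on Hilbert spaces of
  arbitrary type; see \<open>kazhdan_pair_any_type\<close> below.\<close>

definition property_T :: "('a, 'b) monoid_scheme \<Rightarrow> bool" where
  "property_T G \<longleftrightarrow>
     (\<exists>Q \<epsilon>. finite Q \<and> Q \<subseteq> carrier G \<and> \<epsilon> > 0 \<and> kazhdan_pair TYPE('a \<Rightarrow> complex) G Q \<epsilon>)"


subsection \<open>Independence of the carrier type\<close>

lemma complex_ring_simps [simp]:
  "carrier complex_ring = UNIV" "\<one>\<^bsub>complex_ring\<^esub> = 1" "\<zero>\<^bsub>complex_ring\<^esub> = 0"
  "a \<otimes>\<^bsub>complex_ring\<^esub> b = a * b" "a \<oplus>\<^bsub>complex_ring\<^esub> b = a + b"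
  by (simp_all add: complex_ring_def)

lemma cring_complex_ring: "cring complex_ring"
proof (rule cringI)
  show "abelian_group complex_ring"
  proof (rule abelian_groupI)
    fix x show "\<exists>y\<in>carrier complex_ring. y \<oplus>\<^bsub>complex_ring\<^esub> x = \<zero>\<^bsub>complex_ring\<^esub>"
      by (rule bexI[of _ "- x"]) auto
  qed auto
  show "Group.comm_monoid complex_ring"
    by (rule comm_monoidI) auto
qed (auto simp: algebra_simps)

definition closed_subspace :: "('h, 'c) hermitian_space_scheme \<Rightarrow> 'h set \<Rightarrow> bool" where
  "closed_subspace V L \<longleftrightarrow>
     L \<subseteq> carrier V \<and> \<zero>\<^bsub>V\<^esub> \<in> L \<and>
     (\<forall>v\<in>L. \<forall>w\<in>L. v \<oplus>\<^bsub>V\<^esub> w \<in> L) \<and> (\<forall>c. \<forall>v\<in>L. c \<odot>\<^bsub>V\<^esub> v \<in> L) \<and>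
     (\<forall>s. \<forall>l\<in>carrier V. (\<forall>n. s n \<in> L) \<longrightarrow> (\<lambda>n. cnorm V (s n \<ominus>\<^bsub>V\<^esub> l)) \<longlonglongrightarrow> 0 \<longrightarrow> l \<in> L)"

context complex_hilbert_space
begin

lemma minus_eq_smult: "v \<in> carrier V \<Longrightarrow> \<ominus> v = (-1) \<odot> v"
proof -
  assume v: "v \<in> carrier V"
  have "(-1) \<odot> v \<oplus> v = (-1) \<odot> v \<oplus> 1 \<odot> v" using v smult_one[of v] by simp
  also have "\<dots> = ((-1) + 1) \<odot> v" using v smult_l_distr[of "-1" 1 v] by simp
  also have "\<dots> = \<zero>" using v smult_l_null[of v] by simp
  finally show ?thesis using v M.minus_equality smult_closed[of "-1" v] by simp
qed

lemma diff_eq: "v \<in> carrier V \<Longrightarrow> w \<in> carrier V \<Longrightarrow> v \<ominus> w = v \<oplus> (-1) \<odot> w"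
  by (simp add: a_minus_def minus_eq_smult)

lemma smult_in [simp, intro]: "v \<in> carrier V \<Longrightarrow> c \<odot> v \<in> carrier V"
  by (simp add: smult_closed)

lemma diff_in: "v \<in> carrier V \<Longrightarrow> w \<in> carrier V \<Longrightarrow> v \<ominus> w \<in> carrier V"
  by (simp add: diff_eq)

lemma cip_diff_left:
  "u \<in> carrier V \<Longrightarrow> v \<in> carrier V \<Longrightarrow> w \<in> carrier V \<Longrightarrow> cip V (u \<ominus> v) w = cip V u w - cip V v w"
  by (simp add: diff_eq cip_add_left cip_smult_left)

lemma cip_diff_right:
  "u \<in> carrier V \<Longrightarrow> v \<in> carrier V \<Longrightarrow> w \<in> carrier V \<Longrightarrow> cip V w (u \<ominus> v) = cip V w u - cip V w v"
  using cip_diff_left[of u v w] cip_commute[of w u] cip_commute[of w v] cip_commute[of w "u \<ominus> v"]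
  by (metis complex_cnj_cnj complex_cnj_diff diff_in)

lemma cip_zero_left: "w \<in> carrier V \<Longrightarrow> cip V \<zero> w = 0"
  using cip_smult_left[of w w 0] smult_l_null[of w] by simp

lemma cip_self: "v \<in> carrier V \<Longrightarrow> cip V v v = complex_of_real ((cnorm V v)\<^sup>2)"
  using cip_commute[of v v] cip_nonneg[of v] by (auto simp: cnorm_def complex_eq_iff)

lemma cauchy_schwarz:
  assumes "v \<in> carrier V" "w \<in> carrier V"
  shows "cmod (cip V v w) \<le> cnorm V v * cnorm V w"
proof (cases "w = \<zero>")
  case True
  then show ?thesis using assms cip_zero_left[of v] cip_commute[of "\<zero>" v] cip_zero_left[of "\<zero>"]
    by (simp add: cnorm_def)
next
  case False
  define a where "a = (cnorm V w)\<^sup>2"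
  have ww: "cip V w w = of_real a" using cip_self[OF assms(2)] by (simp add: a_def)
  have a: "a > 0"
  proof -
    have "a \<noteq> 0" using ww False cip_definite assms by auto
    then show ?thesis by (simp add: a_def)
  qed
  define z where "z = cip V v w"
  define t where "t = z / of_real a"
  define y where "y = v \<ominus> (t \<odot> w)"
  have tw: "t \<odot> w \<in> carrier V" using assms by simp
  have y: "y \<in> carrier V" using assms tw by (simp add: y_def diff_in)
  have wv: "cip V w v = cnj z" using cip_commute[OF assms] by (simp add: z_def)
  have yw: "cip V y w = 0"
    using assms tw a by (simp add: y_def cip_diff_left cip_smult_left ww z_def[symmetric] t_def)
  have wy: "cip V w y = 0" using yw cip_commute[OF y assms(2)] by simp
  have "cip V y y = cip V v y"
    using cip_diff_left[OF assms(1) tw y] cip_smult_left[OF assms(2) y] wy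
    by (simp add: y_def[symmetric])
  also have "\<dots> = cip V v v - cip V v (t \<odot> w)"
    using assms tw by (simp add: y_def cip_diff_right)
  also have "cip V v (t \<odot> w) = cnj t * z"
    using assms tw cip_commute[OF tw assms(1)] by (simp add: cip_smult_left wv)
  finally have "Re (cip V v v) - Re (cnj t * z) \<ge> 0"
    using cip_nonneg[OF y] by simp
  moreover have "cnj t * z = of_real ((cmod z)\<^sup>2 / a)"
    using complex_norm_square[of z] by (simp add: t_def mult.commute)
  ultimately have "(cmod z)\<^sup>2 / a \<le> (cnorm V v)\<^sup>2"
    using cip_self[OF assms(1)] by simp
  then have "(cmod z)\<^sup>2 \<le> (cnorm V v * cnorm V w)\<^sup>2"
    using a by (simp add: a_def field_simps power_mult_distrib)
  moreover have "0 \<le> cnorm V v * cnorm V w"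
    using cip_nonneg assms by (simp add: cnorm_def)
  ultimately show ?thesis unfolding z_def by (rule power2_le_imp_le)
qed

lemma orthogonal_closed_subspace:
  assumes w: "w \<in> carrier V"
  shows "closed_subspace V {v \<in> carrier V. cip V v w = 0}"
  unfolding closed_subspace_def
proof (intro conjI allI ballI impI)
  fix s l
  assume l: "l \<in> carrier V" and s: "\<forall>n. s n \<in> {v \<in> carrier V. cip V v w = 0}"
    and lim: "(\<lambda>n. cnorm V (s n \<ominus> l)) \<longlonglongrightarrow> 0"
  have "cmod (cip V l w) \<le> cnorm V (s n \<ominus> l) * cnorm V w" for n
    using cauchy_schwarz[of "s n \<ominus> l" w] s l w by (simp add: diff_in cip_diff_left)
  moreover have "(\<lambda>n. cnorm V (s n \<ominus> l) * cnorm V w) \<longlonglongrightarrow> 0"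
    using tendsto_mult_left_zero[OF lim] by simp
  ultimately have "cmod (cip V l w) \<le> 0"
    using LIMSEQ_le_const by blast
  then show "l \<in> {v \<in> carrier V. cip V v w = 0}" using l by simp
qed (auto simp: w cip_zero_left cip_add_left cip_smult_left)

definition transport :: "'h set \<Rightarrow> ('h \<Rightarrow> 'k) \<Rightarrow> 'k hermitian_space" where
  "transport K \<Phi> =
     (let \<Psi> = the_inv_into K \<Phi> in
      \<lparr>carrier = \<Phi> ` K, monoid.mult = undefined, one = undefined,
       zero = \<Phi> \<zero>, add = (\<lambda>f g. \<Phi> (\<Psi> f \<oplus> \<Psi> g)),
       smult = (\<lambda>c f. \<Phi> (c \<odot> \<Psi> f)), cip = (\<lambda>f g. cip V (\<Psi> f) (\<Psi> g))\<rparr>)"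

context
  fixes K :: "'h set" and \<Phi> :: "'h \<Rightarrow> 'k"
  assumes K: "closed_subspace V K" and inj: "inj_on \<Phi> K"
begin

lemma K_in: "v \<in> K \<Longrightarrow> v \<in> carrier V"
  using K by (auto simp: closed_subspace_def)

lemma K_ops: "\<zero> \<in> K" "v \<in> K \<Longrightarrow> w \<in> K \<Longrightarrow> v \<oplus> w \<in> K" "v \<in> K \<Longrightarrow> c \<odot> v \<in> K"
  using K by (auto simp: closed_subspace_def)

lemma transport_carrier: "carrier (transport K \<Phi>) = \<Phi> ` K"
  by (simp add: transport_def Let_def)

lemma transport_ops:
  "\<zero>\<^bsub>transport K \<Phi>\<^esub> = \<Phi> \<zero>"
  "v \<in> K \<Longrightarrow> w \<in> K \<Longrightarrow> \<Phi> v \<oplus>\<^bsub>transport K \<Phi>\<^esub> \<Phi> w = \<Phi> (v \<oplus> w)"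
  "v \<in> K \<Longrightarrow> c \<odot>\<^bsub>transport K \<Phi>\<^esub> \<Phi> v = \<Phi> (c \<odot> v)"
  "v \<in> K \<Longrightarrow> w \<in> K \<Longrightarrow> cip (transport K \<Phi>) (\<Phi> v) (\<Phi> w) = cip V v w"
  by (simp_all add: transport_def Let_def the_inv_into_f_f[OF inj])

lemma transport_module: "module complex_ring (transport K \<Phi>)"
proof (rule moduleI)
  show "cring complex_ring" by (rule cring_complex_ring)
  show "abelian_group (transport K \<Phi>)"
  proof (rule abelian_groupI)
    fix x assume "x \<in> carrier (transport K \<Phi>)"
    then obtain v where v: "v \<in> K" "x = \<Phi> v" by (auto simp: transport_carrier)
    have "(-1) \<odot> v \<oplus> v = \<zero>"
      using K_in[OF v(1)] minus_eq_smult[of v] M.l_neg[of v] by simp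
    then show "\<exists>y\<in>carrier (transport K \<Phi>). y \<oplus>\<^bsub>transport K \<Phi>\<^esub> x = \<zero>\<^bsub>transport K \<Phi>\<^esub>"
      using v by (intro bexI[of _ "\<Phi> ((-1) \<odot> v)"])
        (auto simp: transport_ops transport_carrier K_ops)
  qed (auto simp: transport_carrier transport_ops K_ops K_in M.a_ac)
qed (use smult_l_distr smult_r_distr smult_assoc1 smult_one in
      \<open>auto simp: transport_carrier transport_ops K_ops K_in\<close>)

lemma transport_diff:
  assumes "v \<in> K" "w \<in> K"
  shows "v \<ominus> w \<in> K" "\<Phi> v \<ominus>\<^bsub>transport K \<Phi>\<^esub> \<Phi> w = \<Phi> (v \<ominus> w)"
proof -
  show "v \<ominus> w \<in> K" using assms by (simp add: diff_eq K_in K_ops)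
  interpret T: module complex_ring "transport K \<Phi>" by (rule transport_module)
  have e: "(-1) \<odot> w \<oplus> w = \<zero>"
    using K_in[OF assms(2)] minus_eq_smult[of w] M.l_neg[of w] by simp
  have "\<ominus>\<^bsub>transport K \<Phi>\<^esub> \<Phi> w = \<Phi> ((-1) \<odot> w)"
    by (rule T.M.minus_equality) (use assms e in \<open>auto simp: transport_ops transport_carrier K_ops\<close>)
  then show "\<Phi> v \<ominus>\<^bsub>transport K \<Phi>\<^esub> \<Phi> w = \<Phi> (v \<ominus> w)"
    using assms by (simp add: a_minus_def[of "transport K \<Phi>"] diff_eq K_in transport_ops K_ops)
qed

lemma transport_cnorm: "v \<in> K \<Longrightarrow> cnorm (transport K \<Phi>) (\<Phi> v) = cnorm V v"
  by (simp add: cnorm_def transport_ops)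

lemma transport_hilbert: "complex_hilbert_space (transport K \<Phi>)"
proof (rule complex_hilbert_space.intro[OF transport_module], unfold_locales)
  fix s :: "nat \<Rightarrow> 'k"
  assume s: "\<And>n. s n \<in> carrier (transport K \<Phi>)"
    and cauchy: "\<And>e. e > 0 \<Longrightarrow> \<exists>N. \<forall>m\<ge>N. \<forall>n\<ge>N.
      cnorm (transport K \<Phi>) (s m \<ominus>\<^bsub>transport K \<Phi>\<^esub> s n) < e"
  have "\<forall>n. \<exists>v. v \<in> K \<and> s n = \<Phi> v" using s by (auto simp: transport_carrier)
  then obtain t where t: "\<And>n. t n \<in> K" "\<And>n. s n = \<Phi> (t n)" by metis
  have "\<exists>l\<in>carrier V. (\<lambda>n. cnorm V (t n \<ominus> l)) \<longlonglongrightarrow> 0"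
    using cauchy by (intro complete) (auto simp: t K_in transport_diff transport_cnorm)
  then obtain l where l: "l \<in> carrier V" "(\<lambda>n. cnorm V (t n \<ominus> l)) \<longlonglongrightarrow> 0" by blast
  then have "l \<in> K" using K t(1) unfolding closed_subspace_def by blast
  then show "\<exists>l\<in>carrier (transport K \<Phi>).
      (\<lambda>n. cnorm (transport K \<Phi>) (s n \<ominus>\<^bsub>transport K \<Phi>\<^esub> l)) \<longlonglongrightarrow> 0"
    using l by (intro bexI[of _ "\<Phi> l"]) (auto simp: t transport_diff transport_cnorm transport_carrier)
next
  fix v w assume "v \<in> carrier (transport K \<Phi>)" "w \<in> carrier (transport K \<Phi>)"
  then show "cip (transport K \<Phi>) w v = cnj (cip (transport K \<Phi>) v w)"
    by (auto simp: transport_carrier transport_ops intro!: cip_commute intro: K_in)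
qed (auto simp: transport_carrier transport_ops K_ops K_in cip_add_left cip_smult_left
        cip_nonneg dest: cip_definite[OF K_in])

end

end

lemma (in unitary_representation) rep_diff:
  "g \<in> carrier G \<Longrightarrow> v \<in> carrier V \<Longrightarrow> w \<in> carrier V \<Longrightarrow> \<pi> g (v \<ominus>\<^bsub>V\<^esub> w) = \<pi> g v \<ominus>\<^bsub>V\<^esub> \<pi> g w"
  by (simp add: diff_eq rep_add rep_smult rep_closed)

lemma (in unitary_representation) vimage_closed_subspace:
  assumes L: "closed_subspace V L" and g: "g \<in> carrier G"
  shows "closed_subspace V {v \<in> carrier V. \<pi> g v \<in> L}"
  unfolding closed_subspace_def
proof (intro conjI allI ballI impI)
  have "\<pi> g \<zero>\<^bsub>V\<^esub> = \<zero>\<^bsub>V\<^esub>"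
    using rep_smult[OF g, of "\<zero>\<^bsub>V\<^esub>" 0] rep_closed[OF g, of "\<zero>\<^bsub>V\<^esub>"]
      smult_l_null[of "\<zero>\<^bsub>V\<^esub>"] smult_l_null[of "\<pi> g \<zero>\<^bsub>V\<^esub>"] by simp
  then show "\<zero>\<^bsub>V\<^esub> \<in> {v \<in> carrier V. \<pi> g v \<in> L}"
    using L by (simp add: closed_subspace_def)
next
  fix s l
  assume l: "l \<in> carrier V" and s: "\<forall>n. s n \<in> {v \<in> carrier V. \<pi> g v \<in> L}"
    and lim: "(\<lambda>n. cnorm V (s n \<ominus>\<^bsub>V\<^esub> l)) \<longlonglongrightarrow> 0"
  have "cnorm V (\<pi> g (s n) \<ominus>\<^bsub>V\<^esub> \<pi> g l) = cnorm V (s n \<ominus>\<^bsub>V\<^esub> l)" for n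
    using s l g by (simp add: rep_diff[symmetric] cnorm_def rep_cip diff_in)
  then have lim': "(\<lambda>n. cnorm V (\<pi> g (s n) \<ominus>\<^bsub>V\<^esub> \<pi> g l)) \<longlonglongrightarrow> 0" using lim by simp
  have "\<pi> g l \<in> L"
    using L s rep_closed[OF g l] lim' unfolding closed_subspace_def
    by (auto dest!: spec[of _ "\<lambda>n. \<pi> g (s n)"])
  then show "l \<in> {v \<in> carrier V. \<pi> g v \<in> L}" using l by simp
qed (use L g in \<open>auto simp: closed_subspace_def rep_add rep_smult rep_closed\<close>)

theorem kazhdan_pair_any_type:
  fixes G :: "('a, 'b) monoid_scheme"
  assumes pair: "kazhdan_pair TYPE('a \<Rightarrow> complex) G Q \<epsilon>" and Q: "Q \<subseteq> carrier G"
  shows "kazhdan_pair TYPE('h) G Q \<epsilon>"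
  unfolding kazhdan_pair_def
proof (intro allI impI)
  fix V :: "'h hermitian_space" and \<pi>
  assume "unitary_representation G V \<pi>"
    and "\<exists>v\<in>carrier V. v \<noteq> \<zero>\<^bsub>V\<^esub> \<and> (\<forall>g\<in>Q. cnorm V (\<pi> g v \<ominus>\<^bsub>V\<^esub> v) < \<epsilon> * cnorm V v)"
  then interpret unitary_representation G V \<pi> by simp
  have grp: "group G" by unfold_locales
  obtain v where v: "v \<in> carrier V" "v \<noteq> \<zero>\<^bsub>V\<^esub>"
    and almost: "\<And>g. g \<in> Q \<Longrightarrow> cnorm V (\<pi> g v \<ominus>\<^bsub>V\<^esub> v) < \<epsilon> * cnorm V v"
    using \<open>\<exists>v\<in>carrier V. _ v\<close> by blast
  let ?S = "{L. closed_subspace V L \<and> (\<forall>g\<in>carrier G. \<pi> g v \<in> L)}"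
  define K where "K = \<Inter>?S"
  define \<Phi> where "\<Phi> w = (\<lambda>g. if g \<in> carrier G then cip V w (\<pi> g v) else 0)" for w
  have whole: "carrier V \<in> ?S"
    using v rep_closed by (auto simp: closed_subspace_def)
  have KV: "K \<subseteq> carrier V" using whole unfolding K_def by blast
  have K: "closed_subspace V K"
    unfolding closed_subspace_def
  proof (intro conjI allI ballI impI)
    fix s l
    assume "l \<in> carrier V" "\<forall>n. s n \<in> K" "(\<lambda>n. cnorm V (s n \<ominus>\<^bsub>V\<^esub> l)) \<longlonglongrightarrow> 0"
    then show "l \<in> K" unfolding K_def closed_subspace_def by blast
  qed (use KV in \<open>auto simp: K_def closed_subspace_def\<close>)
  have orbit: "\<pi> g v \<in> K" if "g \<in> carrier G" for g using that by (auto simp: K_def)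
  have vK: "v \<in> K" using orbit[of "\<one>\<^bsub>G\<^esub>"] rep_one[OF v(1)] by simp
  have inv: "\<pi> g w \<in> K" if g: "g \<in> carrier G" and w: "w \<in> K" for g w
    unfolding K_def
  proof
    fix L assume L: "L \<in> ?S"
    have "\<pi> g (\<pi> h v) \<in> L" if "h \<in> carrier G" for h
    proof -
      have "g \<otimes>\<^bsub>G\<^esub> h \<in> carrier G" using monoid.m_closed[OF group.is_monoid[OF grp] g that] .
      then have "\<pi> (g \<otimes>\<^bsub>G\<^esub> h) v \<in> L" using L by auto
      then show ?thesis using rep_mult[OF g that v(1)] by simp
    qed
    then have "{w \<in> carrier V. \<pi> g w \<in> L} \<in> ?S"
      using L vimage_closed_subspace[OF _ g, of L] rep_closed v(1) by auto
    then show "\<pi> g w \<in> L" using w unfolding K_def by blast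
  qed
  have inj: "inj_on \<Phi> K"
  proof (rule inj_onI)
    fix a b assume a: "a \<in> K" and b: "b \<in> K" and eq: "\<Phi> a = \<Phi> b"
    have ab: "a \<in> carrier V" "b \<in> carrier V" using a b KV by auto
    let ?c = "a \<ominus>\<^bsub>V\<^esub> b"
    have c: "?c \<in> carrier V" using ab by (rule diff_in)
    have "cip V (\<pi> g v) ?c = 0" if g: "g \<in> carrier G" for g
    proof -
      have "cip V a (\<pi> g v) = cip V b (\<pi> g v)"
        using fun_cong[OF eq, of g] g by (simp add: \<Phi>_def)
      then have "cip V ?c (\<pi> g v) = 0"
        using ab rep_closed[OF g v(1)] by (simp add: cip_diff_left)
      then show ?thesis using cip_commute[OF c rep_closed[OF g v(1)]] by simp
    qed
    then have "{w \<in> carrier V. cip V w ?c = 0} \<in> ?S"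
      using orthogonal_closed_subspace[OF c] rep_closed v(1) by auto
    moreover have "?c \<in> K" using K ab a b by (simp add: diff_eq closed_subspace_def)
    ultimately have "cip V ?c ?c = 0" unfolding K_def by blast
    then have "?c = \<zero>\<^bsub>V\<^esub>" using c cip_definite by simp
    then have "a \<oplus>\<^bsub>V\<^esub> \<ominus>\<^bsub>V\<^esub> b = \<zero>\<^bsub>V\<^esub>" by (simp add: a_minus_def[of V])
    then show "a = b" using ab M.minus_equality[of a "\<ominus>\<^bsub>V\<^esub> b"] by simp
  qed
  note ops = transport_ops[OF K inj] and car = transport_carrier[OF K inj]
    and K_in' = K_in[OF K inj] and K_ops' = K_ops[OF K inj]
  let ?T = "transport K \<Phi>"
  define \<rho> where "\<rho> g f = \<Phi> (\<pi> g (the_inv_into K \<Phi> f))" for g f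
  have \<rho>: "\<rho> g (\<Phi> w) = \<Phi> (\<pi> g w)" if "w \<in> K" for g w
    using that by (simp add: \<rho>_def the_inv_into_f_f[OF inj])
  have "unitary_representation G ?T \<rho>"
  proof (intro unitary_representation.intro transport_hilbert[OF K inj])
    show "unitary_representation_axioms G ?T \<rho>"
      by unfold_locales
        (auto simp: car \<rho> ops inv K_in' K_ops' rep_add rep_smult rep_cip rep_mult rep_one)
  qed (rule grp)
  moreover have "\<exists>f\<in>carrier ?T. f \<noteq> \<zero>\<^bsub>?T\<^esub> \<and>
      (\<forall>g\<in>Q. cnorm ?T (\<rho> g f \<ominus>\<^bsub>?T\<^esub> f) < \<epsilon> * cnorm ?T f)"
  proof (rule bexI[of _ "\<Phi> v"], intro conjI ballI)
    show "\<Phi> v \<noteq> \<zero>\<^bsub>?T\<^esub>"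
      using v vK K_ops'(1) inj by (auto simp: ops dest: inj_onD)
    fix g assume g: "g \<in> Q"
    then have "\<pi> g v \<in> K" using Q orbit by auto
    then show "cnorm ?T (\<rho> g (\<Phi> v) \<ominus>\<^bsub>?T\<^esub> \<Phi> v) < \<epsilon> * cnorm ?T (\<Phi> v)"
      using almost[OF g] vK
      by (simp add: \<rho> transport_diff[OF K inj] transport_cnorm[OF K inj])
  qed (simp add: car vK)
  ultimately obtain f where f: "f \<in> carrier ?T" "f \<noteq> \<zero>\<^bsub>?T\<^esub>" "\<forall>g\<in>carrier G. \<rho> g f = f"
    using pair unfolding kazhdan_pair_def by blast
  then obtain w where w: "w \<in> K" "f = \<Phi> w" by (auto simp: car)
  have "\<pi> g w = w" if "g \<in> carrier G" for g
    using f(3) that w inv[OF that w(1)] \<rho>[OF w(1)] inj by (auto dest: inj_onD)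
  then show "\<exists>w\<in>carrier V. w \<noteq> \<zero>\<^bsub>V\<^esub> \<and> (\<forall>g\<in>carrier G. \<pi> g w = w)"
    using w f(2) K_in'[OF w(1)] by (intro bexI[of _ w]) (auto simp: ops)
qed

end

theory Submission
  imports Defs "HOL-Analysis.Analysis"
begin

text \<open>Let \<open>Z\<close> be the Hilbert \<open>G\<close>-module of cocycles on \<open>G\<close> with values in the regular representation on
  \<open>\<ell>\<^sup>2(G)\<close>. A cocycle is given by its values on the \<open>d\<close> generators, subject to one linear condition for
  each relator \<open>u\<^sub>i\<close> to the power \<open>m\<^sub>i\<close>. The left hand side of this condition is invariant under \<open>u\<^sub>i\<close>, so the
  condition lives in a module of dimension \<open>1 / m\<^sub>i\<close>, and \<open>Z\<close> has von Neumann dimension at least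
  \<open>d - (\<Sum>i. 1 / m\<^sub>i) > 1\<close>. On the other hand \<open>Z\<close> has dimension at most \<open>1\<close> in each of the following cases.
  If every cocycle is bounded, which holds when \<open>G\<close> is finite or has property (T), then every cocycle is
  inner, so \<open>Z\<close> is an image of \<open>\<ell>\<^sup>2(G)\<close>. If \<open>N\<close> is an infinite normal subgroup, then the restriction of
  cocycles to \<open>N\<close> is injective; when \<open>N\<close> is amenable, cocycles restricted to a F\<oslash>lner set of \<open>N\<close> are
  determined by a potential on only slightly more points.

  Dimensions are traces of projections. They are compared by the identity
  \<open>dim (ker M)\<^sup>\<bottom> = dim (ker M')\<^sup>\<bottom>\<close> for an equivariant operator \<open>M\<close> with adjoint \<open>M'\<close>. To obtain it, scale \<open>M\<close>
  to a contraction: the even powers of \<open>1 - M' M\<close> converge strongly to the projection onto \<open>ker M\<close>, and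
  the traces of \<open>1 - (1 - M' M)\<^sup>n\<close> and \<open>1 - (1 - M M')\<^sup>n\<close> agree.\<close>

section \<open>The real Hilbert space of square summable functions\<close>

text \<open>No dimension theory for Hilbert modules is developed. Closed submodules occur only as
  kernels of operators with an explicit adjoint, and each comparison is the index identity plus an
  estimate of single diagonal entries \<open>inner (P e) e\<close> at basis vectors
  \<open>e\<close>. What links the conclusions is that a cocycle with values in square summable
  functions is formally inner: among all functions on \<open>G\<close> it is the coboundary of a
  potential \<open>f\<close>, in general not square summable. For bounded cocycles a circumcenter
  supplies a square summable potential; for an amenable \<open>N\<close> the values of
  \<open>f\<close> on a finite set are counted. The order of the image of each \<open>u i\<close>
  must be exactly \<open>m i\<close> because an average over the cyclic group has squared norm one
  over its order. The obstacle in the amenable case is that \<open>N\<close> need not be finitely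
  generated: one Folner set controls only finitely many elements, so a decreasing sequence of kernel
  projections and its limit are needed. That limit is identified because a square summable function
  that is constant on an infinite coset of \<open>N\<close> vanishes there.\<close>

definition square_summable :: "('x \<Rightarrow> real) \<Rightarrow> bool" where
  "square_summable f \<longleftrightarrow> (\<lambda>x. (f x)\<^sup>2) summable_on UNIV"

lemma square_summable_bound:
  assumes "\<And>F. finite F \<Longrightarrow> (\<Sum>x\<in>F. (f x)\<^sup>2) \<le> B"
  shows "square_summable f"
  unfolding square_summable_def
  by (rule nonneg_bdd_above_summable_on) (use assms in \<open>auto intro!: bdd_aboveI[of _ B]\<close>)

lemma square_summable_mult:
  assumes "square_summable f" "square_summable g"
  shows "(\<lambda>x. f x * g x) summable_on UNIV"
proof -
  have s: "(\<lambda>x. (f x)\<^sup>2 + (g x)\<^sup>2) summable_on UNIV"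
    using assms unfolding square_summable_def by (rule summable_on_add)
  have le: "norm (f x * g x) \<le> (f x)\<^sup>2 + (g x)\<^sup>2" for x
  proof -
    have "0 \<le> (\<bar>f x\<bar> - \<bar>g x\<bar>)\<^sup>2" "0 \<le> \<bar>f x\<bar> * \<bar>g x\<bar>" by auto
    then show ?thesis unfolding power2_diff real_norm_def abs_mult power2_abs by linarith
  qed
  have "(\<lambda>x. norm (f x * g x)) summable_on UNIV"
    by (rule summable_on_comparison_test[OF s]) (use le in auto)
  then show ?thesis by (rule abs_summable_summable)
qed

lemma square_summable_add:
  assumes "square_summable f" "square_summable g"
  shows "square_summable (\<lambda>x. f x + g x)"
proof -
  have "(\<lambda>x. ((f x)\<^sup>2 + (g x)\<^sup>2) + 2 * (f x * g x)) summable_on UNIV"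
    using assms square_summable_mult[OF assms]
    unfolding square_summable_def by (intro summable_on_add summable_on_cmult_right)
  then show ?thesis by (simp add: square_summable_def power2_sum algebra_simps)
qed

lemma square_summable_scale: "square_summable f \<Longrightarrow> square_summable (\<lambda>x. c * f x)"
  unfolding square_summable_def power_mult_distrib by (rule summable_on_cmult_right)

lemma square_summable_finite:
  assumes "finite {x. f x \<noteq> 0}"
  shows "square_summable f"
  unfolding square_summable_def by (rule finite_nonzero_values_imp_summable_on) (use assms in simp)

text \<open>Real scalars suffice for all traces; complex ones enter only with property (T), through
  a complexification. As a type of its own the space inherits limits and closures from the type
  classes.\<close>

typedef 'x ell2 = "{f :: 'x \<Rightarrow> real. square_summable f}"
  morphisms fn ell2
  by (rule exI[of _ "\<lambda>_. 0"]) (simp add: square_summable_def)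

lemma square_summable_fn [simp]: "square_summable (fn v)"
  using fn[of v] by simp

lemma fn_ell2: "square_summable f \<Longrightarrow> fn (ell2 f) = f"
  by (simp add: ell2_inverse)

lemma ell2_eqI: "(\<And>x. fn v x = fn w x) \<Longrightarrow> v = w"
  by (metis ext fn_inject)

instantiation ell2 :: (type) real_inner
begin

definition zero_ell2 :: "'a ell2" where "zero_ell2 = ell2 (\<lambda>_. 0)"
definition plus_ell2 :: "'a ell2 \<Rightarrow> 'a ell2 \<Rightarrow> 'a ell2" where
  "plus_ell2 v w = ell2 (\<lambda>x. fn v x + fn w x)"
definition uminus_ell2 :: "'a ell2 \<Rightarrow> 'a ell2" where
  "uminus_ell2 v = ell2 (\<lambda>x. - fn v x)"
definition minus_ell2 :: "'a ell2 \<Rightarrow> 'a ell2 \<Rightarrow> 'a ell2" where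
  "minus_ell2 v w = ell2 (\<lambda>x. fn v x - fn w x)"
definition scaleR_ell2 :: "real \<Rightarrow> 'a ell2 \<Rightarrow> 'a ell2" where
  "scaleR_ell2 c v = ell2 (\<lambda>x. c * fn v x)"
definition inner_ell2 :: "'a ell2 \<Rightarrow> 'a ell2 \<Rightarrow> real" where
  "inner_ell2 v w = (\<Sum>\<^sub>\<infinity>x. fn v x * fn w x)"
definition norm_ell2 :: "'a ell2 \<Rightarrow> real" where "norm_ell2 v = sqrt (inner v v)"
definition sgn_ell2 :: "'a ell2 \<Rightarrow> 'a ell2" where "sgn_ell2 v = inverse (norm v) *\<^sub>R v"
definition dist_ell2 :: "'a ell2 \<Rightarrow> 'a ell2 \<Rightarrow> real" where "dist_ell2 v w = norm (v - w)"
definition uniformity_ell2 :: "('a ell2 \<times> 'a ell2) filter" where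
  "uniformity_ell2 = (INF e\<in>{0 <..}. principal {(x, y). dist x y < e})"
definition open_ell2 :: "'a ell2 set \<Rightarrow> bool" where
  "open_ell2 U = (\<forall>x\<in>U. eventually (\<lambda>(x', y). x' = x \<longrightarrow> y \<in> U) uniformity)"

lemma fn_zero [simp]: "fn 0 x = 0"
  by (simp add: zero_ell2_def fn_ell2 square_summable_def)

lemma fn_add [simp]: "fn (v + w) x = fn v x + fn w x"
  by (simp add: plus_ell2_def fn_ell2 square_summable_add)

lemma fn_scaleR [simp]: "fn (c *\<^sub>R v) x = c * fn v x"
  by (simp add: scaleR_ell2_def fn_ell2 square_summable_scale)

lemma fn_uminus [simp]: "fn (- v) x = - fn v x"
  using square_summable_scale[of "fn v" "-1"] by (simp add: uminus_ell2_def fn_ell2)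

lemma fn_diff [simp]: "fn (v - w) x = fn v x - fn w x"
  using square_summable_add[of "fn v" "\<lambda>x. - fn w x"] square_summable_scale[of "fn w" "-1"]
  by (simp add: minus_ell2_def fn_ell2)

instance
proof
  fix u v w :: "'a ell2" and a b :: real
  show "u + v + w = u + (v + w)" "u + v = v + u" "0 + u = u" "- u + u = 0" "u - v = u + - v"
    "a *\<^sub>R (u + v) = a *\<^sub>R u + a *\<^sub>R v" "(a + b) *\<^sub>R u = a *\<^sub>R u + b *\<^sub>R u"
    "a *\<^sub>R b *\<^sub>R u = (a * b) *\<^sub>R u" "1 *\<^sub>R u = u"
    by (rule ell2_eqI, simp add: algebra_simps)+
  show "sgn u = inverse (norm u) *\<^sub>R u" by (rule sgn_ell2_def)
  show "dist u v = norm (u - v)" by (rule dist_ell2_def)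
  show "(uniformity :: ('a ell2 \<times> 'a ell2) filter) = (INF e\<in>{0 <..}. principal {(x, y). dist x y < e})"
    by (rule uniformity_ell2_def)
  show "open U = (\<forall>x\<in>U. eventually (\<lambda>(x', y). x' = x \<longrightarrow> y \<in> U) uniformity)" for U :: "'a ell2 set"
    by (rule open_ell2_def)
  show "inner u v = inner v u" by (simp add: inner_ell2_def mult.commute)
  show "inner (u + v) w = inner u w + inner v w"
    by (simp add: inner_ell2_def distrib_right infsum_add square_summable_mult)
  show "inner (a *\<^sub>R u) v = a * inner u v"
    by (simp add: inner_ell2_def mult.assoc infsum_cmult_right square_summable_mult)
  show "0 \<le> inner u u" by (simp add: inner_ell2_def infsum_nonneg)
  show "inner u u = 0 \<longleftrightarrow> u = 0"
  proof
    assume 0: "inner u u = 0"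
    have "fn u x * fn u x = 0" for x
      by (rule nonneg_infsum_le_0D[of "\<lambda>x. fn u x * fn u x" UNIV])
        (use 0 in \<open>auto simp: inner_ell2_def square_summable_mult\<close>)
    then show "u = 0" by (intro ell2_eqI) simp
  qed (simp add: inner_ell2_def)
  show "norm u = sqrt (inner u u)" by (rule norm_ell2_def)
qed

end

section \<open>Point masses, finite partial sums and completeness\<close>

lemma fn_sum [simp]: "fn (sum v A) x = (\<Sum>i\<in>A. fn (v i) x)"
  by (induction A rule: infinite_finite_induct) auto

definition delta :: "'x \<Rightarrow> 'x ell2" where
  "delta x = ell2 (\<lambda>y. if y = x then 1 else 0)"

lemma fn_delta: "fn (delta x) y = (if y = x then 1 else 0)"
  by (simp add: delta_def fn_ell2 square_summable_finite)

lemma inner_delta: "inner v (delta x) = fn v x" "inner (delta x) v = fn v x"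
proof -
  have "inner v (delta x) = (\<Sum>\<^sub>\<infinity>y\<in>{x}. fn v y)"
    unfolding inner_ell2_def by (rule infsum_cong_neutral) (auto simp: fn_delta)
  then show "inner v (delta x) = fn v x" by simp
  then show "inner (delta x) v = fn v x" by (simp add: inner_commute)
qed

lemma norm_delta [simp]: "norm (delta x) = 1"
  by (simp add: norm_eq_sqrt_inner inner_delta fn_delta)

lemma bounded_linear_fn: "bounded_linear (\<lambda>v. fn v x)"
  unfolding inner_delta(1)[symmetric] by (rule bounded_linear_inner_left)

lemma norm2_ell2_has_sum: "((\<lambda>x. (fn v x)\<^sup>2) has_sum (norm v)\<^sup>2) UNIV"
proof -
  have "(norm v)\<^sup>2 = (\<Sum>\<^sub>\<infinity>x. (fn v x)\<^sup>2)"
    unfolding power2_norm_eq_inner inner_ell2_def by (simp add: power2_eq_square)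
  then show ?thesis using square_summable_fn[of v] unfolding square_summable_def by simp
qed

lemma norm_ell2_le:
  assumes "\<And>F. finite F \<Longrightarrow> (\<Sum>x\<in>F. (fn v x)\<^sup>2) \<le> B\<^sup>2" "0 \<le> B"
  shows "norm v \<le> B"
proof (rule power2_le_imp_le)
  show "(norm v)\<^sup>2 \<le> B\<^sup>2"
    by (rule has_sum_le_finite_sums[OF norm2_ell2_has_sum]) (use assms(1) in auto)
qed (fact assms(2))

lemma sum_fn_le_norm2: "finite F \<Longrightarrow> (\<Sum>x\<in>F. (fn v x)\<^sup>2) \<le> (norm v)\<^sup>2"
  using finite_sum_le_has_sum[OF norm2_ell2_has_sum[of v], of F] by auto

text \<open>This is where the infiniteness of a normal subgroup will enter: it is applied to a
  coset.\<close>

lemma infinite_const_fn_eq_0: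
  assumes "infinite A" "\<And>x. x \<in> A \<Longrightarrow> fn v x = c"
  shows "c = 0"
proof (rule ccontr)
  assume "c \<noteq> 0"
  then have c2: "c\<^sup>2 > 0" by simp
  obtain n :: nat where n: "(norm v)\<^sup>2 < of_nat n * c\<^sup>2"
    using reals_Archimedean3[OF c2] by blast
  obtain F where F: "F \<subseteq> A" "finite F" "card F = n"
    using infinite_arbitrarily_large[OF assms(1)] by blast
  have "(\<Sum>x\<in>F. (fn v x)\<^sup>2) = of_nat n * c\<^sup>2"
    using F assms(2) by (simp add: subset_iff)
  then show False using sum_fn_le_norm2[OF F(2), of v] n by simp
qed

instance ell2 :: (type) complete_space
proof
  fix s :: "nat \<Rightarrow> 'a ell2"
  assume C: "Cauchy s"
  have "convergent (\<lambda>n. fn (s n) x)" for x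
    using bounded_linear.Cauchy[OF bounded_linear_fn C] by (simp add: Cauchy_convergent_iff)
  then have "\<forall>x. \<exists>l. (\<lambda>n. fn (s n) x) \<longlonglongrightarrow> l" by (simp add: convergent_def)
  then obtain f where f: "\<And>x. (\<lambda>n. fn (s n) x) \<longlonglongrightarrow> f x" by metis
  \<comment> \<open>The bound is uniform in the finite set \<open>F\<close>. It therefore survives
    the pointwise limit and yields both the square summability of \<open>f\<close> and the
    convergence in norm.\<close>
  have tail: "\<exists>N. \<forall>n\<ge>N. \<forall>F. finite F \<longrightarrow> (\<Sum>x\<in>F. (fn (s n) x - f x)\<^sup>2) \<le> e\<^sup>2" if e: "e > 0" for e
  proof -
    obtain N where N: "\<And>m n. m \<ge> N \<Longrightarrow> n \<ge> N \<Longrightarrow> dist (s m) (s n) < e"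
      using metric_CauchyD[OF C e] by metis
    show ?thesis
    proof (intro exI[of _ N] allI impI)
      fix n F assume n: "n \<ge> N" and F: "finite (F :: 'a set)"
      have "(\<lambda>m. \<Sum>x\<in>F. (fn (s n) x - fn (s m) x)\<^sup>2) \<longlonglongrightarrow> (\<Sum>x\<in>F. (fn (s n) x - f x)\<^sup>2)"
        by (intro tendsto_intros f)
      moreover have "(\<Sum>x\<in>F. (fn (s n) x - fn (s m) x)\<^sup>2) \<le> e\<^sup>2" if "m \<ge> N" for m
      proof -
        have "(\<Sum>x\<in>F. (fn (s n) x - fn (s m) x)\<^sup>2) \<le> (norm (s n - s m))\<^sup>2"
          using sum_fn_le_norm2[OF F, of "s n - s m"] by simp
        also have "\<dots> \<le> e\<^sup>2" using N[OF n that] by (intro power_mono) (auto simp: dist_norm)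
        finally show ?thesis .
      qed
      ultimately show "(\<Sum>x\<in>F. (fn (s n) x - f x)\<^sup>2) \<le> e\<^sup>2"
        by (intro tendsto_upperbound[where F = sequentially]) (auto simp: eventually_sequentially)
    qed
  qed
  obtain N where N: "\<And>F. finite F \<Longrightarrow> (\<Sum>x\<in>F. (fn (s N) x - f x)\<^sup>2) \<le> 1\<^sup>2"
    using tail[of 1] by auto
  have "square_summable (\<lambda>x. fn (s N) x - f x)" by (rule square_summable_bound[OF N])
  then have "square_summable (\<lambda>x. fn (s N) x + (-1) * (fn (s N) x - f x))"
    by (intro square_summable_add square_summable_scale square_summable_fn)
  then have l: "fn (ell2 f) = f" by (intro fn_ell2) simp
  have "s \<longlonglongrightarrow> ell2 f"
    unfolding LIMSEQ_iff
  proof (intro allI impI)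
    fix e :: real assume "e > 0"
    then obtain N where N: "\<And>n F. n \<ge> N \<Longrightarrow> finite F \<Longrightarrow> (\<Sum>x\<in>F. (fn (s n) x - f x)\<^sup>2) \<le> (e/2)\<^sup>2"
      using tail[of "e/2"] by auto
    have "norm (s n - ell2 f) \<le> e/2" if "n \<ge> N" for n
      by (rule norm_ell2_le) (use N[OF that] l \<open>e > 0\<close> in auto)
    then have "norm (s n - ell2 f) < e" if "n \<ge> N" for n
      using that \<open>e > 0\<close> by fastforce
    then show "\<exists>no. \<forall>n\<ge>no. norm (s n - ell2 f) < e" by blast
  qed
  then show "convergent s" by (auto simp: convergent_def)
qed

lemma adjoint_eqI:
  fixes v w :: "'x::real_inner"
  assumes "\<And>z. inner v z = inner w z"
  shows "v = w"
  using assms[of "v - w"] by (metis assms inner_commute inner_diff_left inner_eq_zero_iff right_minus_eq)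


subsection \<open>Reindexing operators\<close>

text \<open>Translations and coordinate maps are all of this form. The value 0 off \<open>D\<close>
  handles carriers that are not the whole type; injectivity of \<open>p\<close> on \<open>D\<close>
  makes the operator a contraction.\<close>

definition pull :: "'y set \<Rightarrow> ('y \<Rightarrow> 'x) \<Rightarrow> 'x ell2 \<Rightarrow> 'y ell2" where
  "pull D p v = ell2 (\<lambda>y. if y \<in> D then fn v (p y) else 0)"

lemma pull_sum_le:
  assumes "inj_on p D" "finite F"
  shows "(\<Sum>y\<in>F. (if y \<in> D then fn v (p y) else 0)\<^sup>2) \<le> (norm v)\<^sup>2"
proof -
  have "(\<Sum>y\<in>F. (if y \<in> D then fn v (p y) else 0)\<^sup>2) = (\<Sum>y\<in>F \<inter> D. (fn v (p y))\<^sup>2)"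
    using assms(2) by (subst sum.inter_restrict) (auto intro: sum.cong)
  also have "\<dots> = (\<Sum>x\<in>p ` (F \<inter> D). (fn v x)\<^sup>2)"
    using assms(1) by (subst sum.reindex) (auto intro: inj_on_subset)
  also have "\<dots> \<le> (norm v)\<^sup>2" using assms(2) by (intro sum_fn_le_norm2) auto
  finally show ?thesis .
qed

lemma fn_pull:
  assumes "inj_on p D"
  shows "fn (pull D p v) y = (if y \<in> D then fn v (p y) else 0)"
  unfolding pull_def by (subst fn_ell2) (auto intro: square_summable_bound pull_sum_le[OF assms])

lemma norm_pull_le:
  assumes "inj_on p D"
  shows "norm (pull D p v) \<le> norm v"
  by (rule norm_ell2_le) (use pull_sum_le[OF assms] in \<open>auto simp: fn_pull[OF assms]\<close>)

lemma bounded_linear_pull: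
  assumes "inj_on p D"
  shows "bounded_linear (pull D p)"
proof (rule bounded_linear_intro[where K = 1])
  show "pull D p (v + w) = pull D p v + pull D p w" for v w
    by (rule ell2_eqI) (simp add: fn_pull[OF assms])
  show "pull D p (c *\<^sub>R v) = c *\<^sub>R pull D p v" for c v
    by (rule ell2_eqI) (simp add: fn_pull[OF assms])
qed (use norm_pull_le[OF assms] in simp)

lemma inner_pull:
  assumes "bij_betw p D E" "bij_betw q E D" "\<And>y. y \<in> D \<Longrightarrow> q (p y) = y"
  shows "inner (pull D p v) w = inner v (pull E q w)"
proof -
  have p: "inj_on p D" and q: "inj_on q E" using assms by (auto simp: bij_betw_def)
  have "inner (pull D p v) w = (\<Sum>\<^sub>\<infinity>y\<in>D. fn v (p y) * fn w (q (p y)))"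
    unfolding inner_ell2_def by (rule infsum_cong_neutral) (auto simp: fn_pull[OF p] assms(3))
  also have "\<dots> = (\<Sum>\<^sub>\<infinity>x\<in>E. fn v x * fn w (q x))"
    by (rule infsum_reindex_bij_betw[OF assms(1)])
  also have "\<dots> = inner v (pull E q w)"
    unfolding inner_ell2_def by (rule infsum_cong_neutral) (auto simp: fn_pull[OF q])
  finally show ?thesis .
qed


section \<open>Equivariant operators and their traces\<close>

text \<open>The left regular representation, which commutes with \<open>right_tr\<close>.
  Equivariance below always refers to \<open>right_tr\<close>, so the left translations that appear
  in cocycle conditions are admissible operators.\<close>

definition left_tr :: "('a, 'b) monoid_scheme \<Rightarrow> 'a \<Rightarrow> ('a \<times> 'i) ell2 \<Rightarrow> ('a \<times> 'i) ell2" where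
  "left_tr G g = pull (carrier G \<times> UNIV) (\<lambda>(x, i). (inv\<^bsub>G\<^esub> g \<otimes>\<^bsub>G\<^esub> x, i))"

definition right_tr :: "('a, 'b) monoid_scheme \<Rightarrow> 'a \<Rightarrow> ('a \<times> 'i) ell2 \<Rightarrow> ('a \<times> 'i) ell2" where
  "right_tr G h = pull (carrier G \<times> UNIV) (\<lambda>(x, i). (x \<otimes>\<^bsub>G\<^esub> h, i))"

definition coord :: "('a, 'b) monoid_scheme \<Rightarrow> 'i \<Rightarrow> 'j \<Rightarrow> ('a \<times> 'i) ell2 \<Rightarrow> ('a \<times> 'j) ell2" where
  "coord G i j = pull (carrier G \<times> {j}) (\<lambda>(x, _). (x, i))"

text \<open>As \<open>carrier G\<close> need not be the whole type, \<open>\<ell>\<^sup>2(G \<times> I)\<close> is the subspace \<open>hmod G I\<close> of functions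
  supported there.\<close>

definition hmod :: "('a, 'b) monoid_scheme \<Rightarrow> 'i set \<Rightarrow> ('a \<times> 'i) ell2 set" where
  "hmod G I = {v. \<forall>x i. fn v (x, i) \<noteq> 0 \<longrightarrow> x \<in> carrier G \<and> i \<in> I}"

definition gmap :: "('a, 'b) monoid_scheme \<Rightarrow> 'i set \<Rightarrow> 'j set \<Rightarrow>
    (('a \<times> 'i) ell2 \<Rightarrow> ('a \<times> 'j) ell2) \<Rightarrow> bool" where
  "gmap G I J A \<longleftrightarrow> bounded_linear A \<and>
     (\<forall>h\<in>carrier G. \<forall>v. A (right_tr G h v) = right_tr G h (A v)) \<and> A ` hmod G I \<subseteq> hmod G J"

definition adjoint_pair :: "('h::real_inner \<Rightarrow> 'k::real_inner) \<Rightarrow> ('k \<Rightarrow> 'h) \<Rightarrow> bool" where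
  "adjoint_pair A B \<longleftrightarrow> (\<forall>v w. inner (A v) w = inner v (B w))"

text \<open>The adjoint is carried as an explicit partner: every operator is assembled from
  translations and coordinate maps by sums and compositions, and its adjoint is assembled
  alongside.\<close>

definition gop :: "('a, 'b) monoid_scheme \<Rightarrow> 'i set \<Rightarrow> 'j set \<Rightarrow>
    (('a \<times> 'i) ell2 \<Rightarrow> ('a \<times> 'j) ell2) \<Rightarrow> (('a \<times> 'j) ell2 \<Rightarrow> ('a \<times> 'i) ell2) \<Rightarrow> bool" where
  "gop G I J A B \<longleftrightarrow> gmap G I J A \<and> gmap G J I B \<and> adjoint_pair A B"

text \<open>The von Neumann trace; its value at a projection is the dimension of the range.\<close>

definition gtrace :: "('a, 'b) monoid_scheme \<Rightarrow> 'i set \<Rightarrow> (('a \<times> 'i) ell2 \<Rightarrow> ('a \<times> 'i) ell2) \<Rightarrow> real" where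
  "gtrace G I A = (\<Sum>i\<in>I. inner (A (delta (\<one>\<^bsub>G\<^esub>, i))) (delta (\<one>\<^bsub>G\<^esub>, i)))"

lemma gmapI:
  assumes "bounded_linear A"
    "\<And>h v. h \<in> carrier G \<Longrightarrow> A (right_tr G h v) = right_tr G h (A v)"
    "\<And>v. v \<in> hmod G I \<Longrightarrow> A v \<in> hmod G J"
  shows "gmap G I J A"
  using assms by (auto simp: gmap_def)

lemma gmapD:
  assumes "gmap G I J A"
  shows "bounded_linear A"
    "h \<in> carrier G \<Longrightarrow> A (right_tr G h v) = right_tr G h (A v)"
    "v \<in> hmod G I \<Longrightarrow> A v \<in> hmod G J"
  using assms by (auto simp: gmap_def)

lemma adjoint_pairD: "adjoint_pair A B \<Longrightarrow> inner (A v) w = inner v (B w)"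
  by (simp add: adjoint_pair_def)

lemma adjoint_pair_sym: "adjoint_pair A B \<Longrightarrow> adjoint_pair B A"
  by (metis adjoint_pair_def inner_commute)

lemma adjoint_pair_comp:
  "adjoint_pair A A' \<Longrightarrow> adjoint_pair B B' \<Longrightarrow> adjoint_pair (\<lambda>v. A (B v)) (\<lambda>v. B' (A' v))"
  by (simp add: adjoint_pair_def)

lemma hmod_0 [simp]: "0 \<in> hmod G I"
  by (simp add: hmod_def)

lemma hmod_add: "v \<in> hmod G I \<Longrightarrow> w \<in> hmod G I \<Longrightarrow> v + w \<in> hmod G I"
  unfolding hmod_def by auto (metis add_0)+

lemma hmod_scaleR: "v \<in> hmod G I \<Longrightarrow> c *\<^sub>R v \<in> hmod G I"
  unfolding hmod_def by auto

lemma hmod_closed: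
  assumes "\<And>n. s n \<in> hmod G I" "s \<longlonglongrightarrow> l"
  shows "l \<in> hmod G I"
  unfolding hmod_def
proof (safe)
  fix x i assume nz: "fn l (x, i) \<noteq> 0"
  have lim: "(\<lambda>n. fn (s n) (x, i)) \<longlonglongrightarrow> fn l (x, i)"
    by (rule bounded_linear.tendsto[OF bounded_linear_fn assms(2)])
  have *: "x \<in> carrier G \<and> i \<in> I"
  proof (rule ccontr)
    assume "\<not> (x \<in> carrier G \<and> i \<in> I)"
    then have "fn (s n) (x, i) = 0" for n using assms(1)[of n] by (auto simp: hmod_def)
    then show False using lim nz by (simp add: LIMSEQ_const_iff)
  qed
  then show "x \<in> carrier G" "i \<in> I" by auto
qed

lemma (in group) delta_in_hmod: "i \<in> I \<Longrightarrow> delta (\<one>, i) \<in> hmod G I"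
  by (auto simp: hmod_def fn_delta split: if_splits)

lemma gmap_comp:
  assumes "gmap G J K A" "gmap G I J B"
  shows "gmap G I K (\<lambda>v. A (B v))"
  by (rule gmapI) (use gmapD[OF assms(1)] gmapD[OF assms(2)] in \<open>auto intro: bounded_linear_compose\<close>)

lemma gop_comp: "gop G J K A A' \<Longrightarrow> gop G I J B B' \<Longrightarrow> gop G I K (\<lambda>v. A (B v)) (\<lambda>v. B' (A' v))"
  by (auto simp: gop_def intro: gmap_comp adjoint_pair_comp)

lemma gop_sym: "gop G I J A B \<Longrightarrow> gop G J I B A"
  by (auto simp: gop_def adjoint_pair_sym)

section \<open>The calculus of equivariant operators with adjoints\<close>

context group
begin

lemma inj_on_left_tr: "g \<in> carrier G \<Longrightarrow> inj_on (\<lambda>(x, i). (inv g \<otimes> x, i)) (carrier G \<times> UNIV)"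
  by (auto simp: inj_on_def)

lemma inj_on_right_tr: "g \<in> carrier G \<Longrightarrow> inj_on (\<lambda>(x, i). (x \<otimes> g, i)) (carrier G \<times> UNIV)"
  by (auto simp: inj_on_def)

lemma inj_on_coord: "inj_on (\<lambda>(x, _). (x, i)) (carrier G \<times> {j})"
  by (auto simp: inj_on_def)

lemma fn_left_tr: "g \<in> carrier G \<Longrightarrow>
    fn (left_tr G g v) (x, i) = (if x \<in> carrier G then fn v (inv g \<otimes> x, i) else 0)"
  by (simp add: left_tr_def fn_pull[OF inj_on_left_tr])

lemma fn_right_tr: "g \<in> carrier G \<Longrightarrow>
    fn (right_tr G g v) (x, i) = (if x \<in> carrier G then fn v (x \<otimes> g, i) else 0)"
  by (simp add: right_tr_def fn_pull[OF inj_on_right_tr])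

lemma fn_coord: "fn (coord G i j v) (x, k) = (if x \<in> carrier G \<and> k = j then fn v (x, i) else 0)"
  by (simp add: coord_def fn_pull[OF inj_on_coord])

lemma bounded_linear_right_tr: "g \<in> carrier G \<Longrightarrow> bounded_linear (right_tr G g)"
  by (simp add: right_tr_def bounded_linear_pull[OF inj_on_right_tr])

lemma right_tr_delta:
  fixes i :: 'i
  assumes x: "x \<in> carrier G"
  shows "right_tr G (inv x) (delta (\<one>, i)) = delta (x, i)"
proof (rule ell2_eqI)
  fix z :: "'a \<times> 'i"
  obtain a b where z: "z = (a, b)" by (cases z)
  have "a \<otimes> inv x = \<one> \<longleftrightarrow> a = x" if "a \<in> carrier G"
  proof
    assume "a \<otimes> inv x = \<one>"
    then show "a = x" using inv_equality[of a "inv x"] that x by simp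
  qed (simp add: x)
  then show "fn (right_tr G (inv x) (delta (\<one>, i))) z = fn (delta (x, i)) z"
    using x by (auto simp: z fn_right_tr fn_delta)
qed

lemma gop_left_tr:
  assumes g: "g \<in> carrier G"
  shows "gop G I I (left_tr G g) (left_tr G (inv g))"
proof -
  have gm: "gmap G I I (left_tr G g)" if g: "g \<in> carrier G" for g
  proof (rule gmapI)
    show "bounded_linear (left_tr G g)" by (simp add: left_tr_def bounded_linear_pull[OF inj_on_left_tr[OF g]])
    show "left_tr G g (right_tr G h v) = right_tr G h (left_tr G g v)" if h: "h \<in> carrier G" for h v
      by (rule ell2_eqI) (auto simp: fn_left_tr fn_right_tr g h m_assoc)
    show "left_tr G g v \<in> hmod G I" if "v \<in> hmod G I" for v
      using that by (auto simp: hmod_def fn_left_tr g)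
  qed
  have "adjoint_pair (left_tr G g) (left_tr G (inv g))"
    unfolding adjoint_pair_def left_tr_def
    by (intro allI inner_pull bij_betwI[where g = "\<lambda>(x, i). (inv (inv g) \<otimes> x, i)"]
        bij_betwI[where g = "\<lambda>(x, i). (inv g \<otimes> x, i)"]) (use g in \<open>auto simp: m_assoc[symmetric]\<close>)
  then show ?thesis using gm g by (simp add: gop_def)
qed

lemma gop_coord:
  assumes "i \<in> I" "j \<in> J"
  shows "gop G I J (coord G i j) (coord G j i)"
proof -
  have gm: "gmap G I J (coord G i j)" if "j \<in> J" for i :: 'k and j :: 'l and I J
  proof (rule gmapI)
    show "bounded_linear (coord G i j)" by (simp add: coord_def bounded_linear_pull[OF inj_on_coord])
    show "coord G i j (right_tr G h v) = right_tr G h (coord G i j v)" if h: "h \<in> carrier G" for h v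
      by (rule ell2_eqI) (auto simp: fn_coord fn_right_tr h)
    show "coord G i j v \<in> hmod G J" if "v \<in> hmod G I" for v
      using \<open>j \<in> J\<close> by (auto simp: hmod_def fn_coord split: if_splits)
  qed
  have gm': "gmap G J I (coord G j i)"
  proof (rule gmapI)
    show "bounded_linear (coord G j i)" by (simp add: coord_def bounded_linear_pull[OF inj_on_coord])
    show "coord G j i (right_tr G h v) = right_tr G h (coord G j i v)" if h: "h \<in> carrier G" for h v
      by (rule ell2_eqI) (auto simp: fn_coord fn_right_tr h)
    show "coord G j i v \<in> hmod G I" if "v \<in> hmod G J" for v
      using assms by (auto simp: hmod_def fn_coord split: if_splits)
  qed
  have "adjoint_pair (coord G i j) (coord G j i)"
    unfolding adjoint_pair_def coord_def
    by (intro allI inner_pull bij_betwI[where g = "\<lambda>(x, _). (x, j)"]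
        bij_betwI[where g = "\<lambda>(x, _). (x, i)"]) auto
  then show ?thesis using gm[OF assms(2)] gm' by (simp add: gop_def)
qed

lemma gop_zero: "gop G I J (\<lambda>_. 0) (\<lambda>_. 0)"
  by (auto simp: gop_def adjoint_pair_def intro!: gmapI bounded_linear_zero
      linear_0[symmetric] bounded_linear.linear bounded_linear_right_tr)

lemma gop_id: "gop G I I (\<lambda>v. v) (\<lambda>v. v)"
  by (auto simp: gop_def adjoint_pair_def intro!: gmapI bounded_linear_ident)

lemma gop_add:
  assumes "gop G I J A A'" "gop G I J B B'"
  shows "gop G I J (\<lambda>v. A v + B v) (\<lambda>v. A' v + B' v)"
proof -
  have gm: "gmap G I J (\<lambda>v. A v + B v)" if "gmap G I J A" "gmap G I J B"
    for A B and I :: "'k set" and J :: "'l set"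
    by (rule gmapI) (use gmapD[OF that(1)] gmapD[OF that(2)] in
      \<open>auto intro: bounded_linear_add hmod_add simp: linear_add[OF bounded_linear.linear[OF bounded_linear_right_tr]]\<close>)
  show ?thesis
    using assms gm[of I J A B] gm[of J I A' B']
    by (auto simp: gop_def adjoint_pair_def inner_add_left inner_add_right)
qed

lemma gop_scaleR:
  assumes "gop G I J A A'"
  shows "gop G I J (\<lambda>v. c *\<^sub>R A v) (\<lambda>v. c *\<^sub>R A' v)"
proof -
  have gm: "gmap G I J (\<lambda>v. c *\<^sub>R A v)" if "gmap G I J A" for A and I :: "'k set" and J :: "'l set"
    by (rule gmapI) (use gmapD[OF that] in
      \<open>auto intro: bounded_linear_const_scaleR hmod_scaleR simp: linear_cmul[OF bounded_linear.linear[OF bounded_linear_right_tr]]\<close>)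
  show ?thesis
    using assms gm[of I J A] gm[of J I A'] by (auto simp: gop_def adjoint_pair_def)
qed

lemma gop_diff:
  assumes "gop G I J A A'" "gop G I J B B'"
  shows "gop G I J (\<lambda>v. A v - B v) (\<lambda>v. A' v - B' v)"
  using gop_add[OF assms(1) gop_scaleR[OF assms(2), of "-1"]] by simp

lemma gop_sum:
  assumes "\<And>k. k \<in> K \<Longrightarrow> gop G I J (A k) (A' k)"
  shows "gop G I J (\<lambda>v. \<Sum>k\<in>K. A k v) (\<lambda>v. \<Sum>k\<in>K. A' k v)"
  using assms by (induction K rule: infinite_finite_induct) (auto intro: gop_zero gop_add)

text \<open>An equivariant operator is a matrix of convolutions: the image of
  \<open>delta (x, i)\<close> is a right translate of the image of \<open>delta (\<one>, i)\<close>,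
  so the columns at the identity determine everything. The auxiliary vector \<open>a\<close>
  represents the functional that reads off the coordinate \<open>(\<one>, j)\<close> of
  \<open>A w\<close>.\<close>

lemma trace_expand:
  assumes A: "gop G I J A A'" and I: "finite I" and w: "w \<in> hmod G I"
  shows "fn (A w) (\<one>, j) =
    (\<Sum>i\<in>I. \<Sum>\<^sub>\<infinity>x\<in>carrier G. fn w (x, i) * fn (A (delta (\<one>, i))) (inv x, j))"
proof -
  note Am = gmapD[OF A[unfolded gop_def, THEN conjunct1]]
  have adj: "adjoint_pair A A'" using A by (simp add: gop_def)
  define a where "a = A' (delta (\<one>, j))"
  have a: "fn a (x, i) = fn (A (delta (\<one>, i))) (inv x, j)" if x: "x \<in> carrier G" for x i
  proof -
    have "fn a (x, i) = inner (A (delta (x, i))) (delta (\<one>, j))"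
      by (simp only: adjoint_pairD[OF adj] a_def inner_delta(2))
    also have "A (delta (x, i)) = right_tr G (inv x) (A (delta (\<one>, i)))"
      using Am(2)[of "inv x" "delta (\<one>, i)"] x right_tr_delta[OF x, of i] by simp
    also have "inner \<dots> (delta (\<one>, j)) = fn (A (delta (\<one>, i))) (inv x, j)"
      using x by (simp add: inner_delta fn_right_tr)
    finally show ?thesis .
  qed
  have "fn (A w) (\<one>, j) = inner w a"
    by (simp add: a_def adjoint_pairD[OF adj, symmetric] inner_delta)
  also have "\<dots> = (\<Sum>\<^sub>\<infinity>z\<in>(\<Union>i\<in>I. carrier G \<times> {i}). fn w z * fn a z)"
    unfolding inner_ell2_def by (rule infsum_cong_neutral) (use w in \<open>auto simp: hmod_def\<close>)
  also have "\<dots> = (\<Sum>i\<in>I. \<Sum>\<^sub>\<infinity>z\<in>carrier G \<times> {i}. fn w z * fn a z)"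
    by (rule sum_infsum[symmetric, OF I])
      (auto intro: summable_on_subset_banach[OF square_summable_mult])
  also have "\<dots> = (\<Sum>i\<in>I. \<Sum>\<^sub>\<infinity>x\<in>carrier G. fn w (x, i) * fn (A (delta (\<one>, i))) (inv x, j))"
  proof (rule sum.cong[OF refl])
    fix i
    have "(\<Sum>\<^sub>\<infinity>z\<in>carrier G \<times> {i}. fn w z * fn a z) = (\<Sum>\<^sub>\<infinity>x\<in>carrier G. fn w (x, i) * fn a (x, i))"
      by (rule infsum_reindex_bij_betw[symmetric, where g = "\<lambda>x. (x, i)", simplified])
        (auto simp: bij_betw_def inj_on_def)
    then show "(\<Sum>\<^sub>\<infinity>z\<in>carrier G \<times> {i}. fn w z * fn a z) =
        (\<Sum>\<^sub>\<infinity>x\<in>carrier G. fn w (x, i) * fn (A (delta (\<one>, i))) (inv x, j))"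
      by (simp add: a cong: infsum_cong)
  qed
  finally show ?thesis .
qed

text \<open>Both traces expand into the same sum over \<open>I\<close>, \<open>J\<close> and the
  group. The sums over \<open>I\<close> and \<open>J\<close> are finite and may be exchanged, and
  the substitution of \<open>inv x\<close> for \<open>x\<close> swaps the roles of \<open>A\<close>
  and \<open>B\<close>.\<close>

theorem gtrace_commute:
  assumes A: "gop G I J A A'" and B: "gop G J I B B'" and fin: "finite I" "finite J"
  shows "gtrace G J (\<lambda>v. A (B v)) = gtrace G I (\<lambda>v. B (A v))"
proof -
  let ?k = "\<lambda>i j x. fn (B (delta (\<one>, j))) (x, i) * fn (A (delta (\<one>, i))) (inv x, j)"
  have "gtrace G J (\<lambda>v. A (B v)) = (\<Sum>j\<in>J. \<Sum>i\<in>I. \<Sum>\<^sub>\<infinity>x\<in>carrier G. ?k i j x)"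
    unfolding gtrace_def inner_delta
    by (intro sum.cong refl trace_expand[OF A fin(1)])
      (auto intro!: gmapD(3)[OF B[unfolded gop_def, THEN conjunct1]] delta_in_hmod)
  also have "\<dots> = (\<Sum>i\<in>I. \<Sum>j\<in>J. \<Sum>\<^sub>\<infinity>x\<in>carrier G. ?k i j x)"
    by (rule sum.swap)
  also have "\<dots> = (\<Sum>i\<in>I. \<Sum>j\<in>J. \<Sum>\<^sub>\<infinity>x\<in>carrier G.
      fn (A (delta (\<one>, i))) (x, j) * fn (B (delta (\<one>, j))) (inv x, i))"
  proof (intro sum.cong refl)
    fix i j
    have "(\<Sum>\<^sub>\<infinity>x\<in>carrier G. ?k i j (inv x)) = (\<Sum>\<^sub>\<infinity>x\<in>carrier G. ?k i j x)"
      by (rule infsum_reindex_bij_betw) (rule bij_betwI[where g = "\<lambda>x. inv x"], auto)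
    then show "(\<Sum>\<^sub>\<infinity>x\<in>carrier G. ?k i j x) = (\<Sum>\<^sub>\<infinity>x\<in>carrier G.
        fn (A (delta (\<one>, i))) (x, j) * fn (B (delta (\<one>, j))) (inv x, i))"
      by (simp add: mult.commute cong: infsum_cong)
  qed
  also have "\<dots> = gtrace G I (\<lambda>v. B (A v))"
    unfolding gtrace_def inner_delta
    by (intro sum.cong refl trace_expand[OF B fin(2), symmetric])
      (auto intro!: gmapD(3)[OF A[unfolded gop_def, THEN conjunct1]] delta_in_hmod)
  finally show ?thesis .
qed

end


section \<open>Kernel projections and the index formula\<close>

definition kernel_proj :: "('h::real_inner \<Rightarrow> 'k::real_vector) \<Rightarrow> ('h \<Rightarrow> 'h) \<Rightarrow> bool" where
  "kernel_proj M P \<longleftrightarrow> adjoint_pair P P \<and> (\<forall>v. M (P v) = 0) \<and> (\<forall>v. M v = 0 \<longrightarrow> P v = v)"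

lemma kernel_projD:
  assumes "kernel_proj M P"
  shows "adjoint_pair P P" "M (P v) = 0" "M v = 0 \<Longrightarrow> P v = v" "P (P v) = P v"
  using assms by (auto simp: kernel_proj_def)

lemma inner_kernel_proj:
  assumes "kernel_proj M P"
  shows "inner (P v) v = (norm (P v))\<^sup>2"
  by (metis adjoint_pairD assms kernel_projD(1,4) power2_norm_eq_inner)

lemma norm_kernel_proj_le:
  assumes "kernel_proj M P"
  shows "norm (P v) \<le> norm v"
proof -
  have "(norm (P v))\<^sup>2 \<le> norm (P v) * norm v"
    using Cauchy_Schwarz_ineq2[of "P v" v] by (simp add: inner_kernel_proj[OF assms])
  then show ?thesis by (cases "norm (P v) = 0") (auto simp: power2_eq_square)
qed

locale contraction =
  fixes M :: "'h::{real_inner, complete_space} \<Rightarrow> 'k::real_inner" and M' :: "'k \<Rightarrow> 'h"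
  assumes bl: "bounded_linear M" and bl': "bounded_linear M'"
    and adj: "adjoint_pair M M'"
    and contr: "norm (M v) \<le> norm v"
begin

definition T :: "'h \<Rightarrow> 'h" where "T v = v - M' (M v)"
text \<open>Even exponents are chosen because the inner product of \<open>(T ^^ (2 * m)) v\<close>
  and \<open>(T ^^ (2 * n)) v\<close> is the squared norm of \<open>(T ^^ (m + n)) v\<close>.
  Convergence then follows from the monotone sequence of norms, without spectral theory.\<close>

definition P :: "'h \<Rightarrow> 'h" where "P v = lim (\<lambda>n. (T ^^ (2 * n)) v)"

lemma contr': "norm (M' w) \<le> norm w"
proof -
  have "(norm (M' w))\<^sup>2 = inner (M (M' w)) w"
    by (simp add: adjoint_pairD[OF adj] power2_norm_eq_inner)
  also have "\<dots> \<le> norm (M (M' w)) * norm w" using Cauchy_Schwarz_ineq2[of "M (M' w)" w] by simp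
  also have "\<dots> \<le> norm (M' w) * norm w" by (intro mult_right_mono contr) simp
  finally show ?thesis by (cases "norm (M' w) = 0") (auto simp: power2_eq_square)
qed

lemma bl_T: "bounded_linear T"
  unfolding T_def by (intro bounded_linear_sub bounded_linear_ident bounded_linear_compose[OF bl' bl])

lemma adj_T: "adjoint_pair T T"
  unfolding adjoint_pair_def T_def
  by (simp add: inner_diff_left inner_diff_right adjoint_pairD[OF adj]
      adjoint_pairD[OF adjoint_pair_sym[OF adj]])

text \<open>Applying \<open>T\<close> loses at least the squared norm of \<open>M v\<close>. Hence a
  vector whose norm is preserved lies in the kernel of \<open>M\<close>.\<close>

lemma norm_T: "(norm (T v))\<^sup>2 \<le> (norm v)\<^sup>2 - (norm (M v))\<^sup>2"
proof -
  have "(norm (T v))\<^sup>2 = (norm v)\<^sup>2 - 2 * inner v (M' (M v)) + (norm (M' (M v)))\<^sup>2"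
    by (simp add: T_def power2_norm_eq_inner inner_diff_left inner_diff_right inner_commute)
  also have "inner v (M' (M v)) = (norm (M v))\<^sup>2"
    by (simp add: adjoint_pairD[OF adj, symmetric] power2_norm_eq_inner)
  also have "(norm (M' (M v)))\<^sup>2 \<le> (norm (M v))\<^sup>2" by (intro power_mono contr') simp
  finally show ?thesis by simp
qed

lemma norm_T_le: "norm (T v) \<le> norm v"
proof (rule power2_le_imp_le)
  show "(norm (T v))\<^sup>2 \<le> (norm v)\<^sup>2" using norm_T[of v] zero_le_power2[of "norm (M v)"] by linarith
qed simp

lemma bl_Tn: "bounded_linear (T ^^ n)"
proof (induction n)
  case (Suc n)
  then show ?case using bounded_linear_compose[OF bl_T Suc] by (simp add: comp_def)
qed (simp add: id_def)

lemma Tn_adj: "inner ((T ^^ m) v) ((T ^^ n) w) = inner ((T ^^ (m + n)) v) w"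
proof (induction n arbitrary: m)
  case (Suc n)
  have "inner ((T ^^ m) v) ((T ^^ Suc n) w) = inner ((T ^^ Suc m) v) ((T ^^ n) w)"
    using adjoint_pairD[OF adj_T, of "(T ^^ m) v" "(T ^^ n) w"] by simp
  also have "\<dots> = inner ((T ^^ (Suc m + n)) v) w" by (rule Suc)
  finally show ?case by simp
qed simp

lemma norm_Tn_le: "norm ((T ^^ n) v) \<le> norm v"
  by (induction n) (auto intro: order_trans[OF norm_T_le])

lemma Cauchy_Tn: "Cauchy (\<lambda>n. (T ^^ (2 * n)) v)"
proof (rule metric_CauchyI)
  fix e :: real assume e: "e > 0"
  define b where "b n = (norm ((T ^^ n) v))\<^sup>2" for n
  have "decseq b"
    unfolding b_def by (rule decseq_SucI) (auto intro!: power_mono norm_T_le)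
  moreover have "bdd_below (range b)" by (rule bdd_belowI[of _ 0]) (auto simp: b_def)
  ultimately obtain L where L: "b \<longlonglongrightarrow> L" using decseq_convergent[of b 0] by (auto simp: b_def)
  have "e\<^sup>2 / 4 > 0" using e by simp
  \<comment> \<open>A quarter of the squared \<open>e\<close> is enough: the deviations of
    \<open>b\<close> from \<open>L\<close> enter the squared distance with weights 1, 1 and
    2.\<close>
  then obtain N where N: "\<And>n. n \<ge> N \<Longrightarrow> \<bar>b n - L\<bar> < e\<^sup>2 / 4"
    using L unfolding LIMSEQ_iff by (metis real_norm_def)
  show "\<exists>N. \<forall>m\<ge>N. \<forall>n\<ge>N. dist ((T ^^ (2 * m)) v) ((T ^^ (2 * n)) v) < e"
  proof (intro exI[of _ N] allI impI)
    fix m n assume mn: "m \<ge> N" "n \<ge> N"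
    have "inner ((T ^^ (2 * m)) v) ((T ^^ (2 * n)) v) = inner ((T ^^ ((m + n) + (m + n))) v) v"
      unfolding Tn_adj by (rule arg_cong[of _ _ "\<lambda>k. inner ((T ^^ k) v) v"]) simp
    also have "\<dots> = b (m + n)"
      unfolding b_def power2_norm_eq_inner Tn_adj ..
    finally have "(dist ((T ^^ (2 * m)) v) ((T ^^ (2 * n)) v))\<^sup>2 = b (2 * m) + b (2 * n) - 2 * b (m + n)"
      by (simp add: dist_norm power2_norm_eq_inner inner_diff_left inner_diff_right b_def inner_commute)
    also have "\<dots> < e\<^sup>2" using N[of "2 * m"] N[of "2 * n"] N[of "m + n"] mn by linarith
    finally show "dist ((T ^^ (2 * m)) v) ((T ^^ (2 * n)) v) < e"
      using e by (meson less_imp_le power_less_imp_less_base)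
  qed
qed

lemma P_lim: "(\<lambda>n. (T ^^ (2 * n)) v) \<longlonglongrightarrow> P v"
  using Cauchy_Tn[of v] unfolding P_def by (simp add: Cauchy_convergent_iff convergent_LIMSEQ_iff)

lemma bl_P: "bounded_linear P"
proof (rule bounded_linear_intro[where K = 1])
  fix v w c
  have "(\<lambda>n. (T ^^ (2 * n)) (v + w)) \<longlonglongrightarrow> P v + P w"
    using tendsto_add[OF P_lim[of v] P_lim[of w]]
    by (simp add: linear_add[OF bounded_linear.linear[OF bl_Tn]])
  then show "P (v + w) = P v + P w" by (rule LIMSEQ_unique[OF P_lim])
  have "(\<lambda>n. (T ^^ (2 * n)) (c *\<^sub>R v)) \<longlonglongrightarrow> c *\<^sub>R P v"
    using tendsto_scaleR[OF tendsto_const P_lim[of v], of c]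
    by (simp add: linear_cmul[OF bounded_linear.linear[OF bl_Tn]])
  then show "P (c *\<^sub>R v) = c *\<^sub>R P v" by (rule LIMSEQ_unique[OF P_lim])
  show "norm (P v) \<le> norm v * 1"
    using tendsto_norm[OF P_lim[of v]] norm_Tn_le by (auto intro: tendsto_upperbound)
qed

lemma kernel_proj_P: "kernel_proj M P"
  unfolding kernel_proj_def
proof (intro conjI allI impI)
  show "adjoint_pair P P"
    unfolding adjoint_pair_def
  proof (intro allI)
    fix v w
    have "inner ((T ^^ (2 * n)) v) w = inner v ((T ^^ (2 * n)) w)" for n
      using Tn_adj[of 0 v "2 * n" w] by simp
    then show "inner (P v) w = inner v (P w)"
      using tendsto_inner[OF P_lim[of v] tendsto_const[of w]] tendsto_inner[OF tendsto_const[of v] P_lim[of w]]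
      by (simp add: LIMSEQ_unique)
  qed
  fix v
  \<comment> \<open>The limit is fixed by the square of \<open>T\<close>, so \<open>T\<close> does
    not shrink it and \<open>norm_T\<close> puts it into the kernel of \<open>M\<close>.\<close>
  have "(\<lambda>n. T (T ((T ^^ (2 * n)) v))) \<longlonglongrightarrow> T (T (P v))"
    by (intro bounded_linear.tendsto[OF bl_T] P_lim)
  moreover have "(\<lambda>n. T (T ((T ^^ (2 * n)) v))) \<longlonglongrightarrow> P v"
    using LIMSEQ_Suc[OF P_lim[of v]] by simp
  ultimately have "T (T (P v)) = P v" by (rule LIMSEQ_unique)
  then have "norm (P v) \<le> norm (T (P v))" using norm_T_le[of "T (P v)"] by simp
  then have "(norm (P v))\<^sup>2 \<le> (norm (T (P v)))\<^sup>2" by (intro power_mono) auto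
  then have "(norm (M (P v)))\<^sup>2 \<le> 0" using norm_T[of "P v"] by linarith
  then show "M (P v) = 0" by simp
next
  fix v assume "M v = 0"
  then have "T v = v" using linear_0[OF bounded_linear.linear[OF bl']] by (simp add: T_def)
  then have "(T ^^ n) v = v" for n by (induction n) auto
  then show "P v = v" using P_lim[of v] by (simp add: LIMSEQ_const_iff)
qed

end

section \<open>Traces of kernel projections\<close>

context group
begin

lemma gop_funpow: "gop G I I A A' \<Longrightarrow> gop G I I (A ^^ n) (A' ^^ n)"
proof (induction n)
  case 0
  then show ?case using gop_id by (simp add: id_def)
next
  case (Suc n)
  have "A' ^^ Suc n = (\<lambda>v. (A' ^^ n) (A' v))" by (rule ext) (simp add: funpow_swap1)
  then show ?case using gop_comp[OF Suc.prems Suc.IH[OF Suc.prems]] by (simp add: comp_def)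
qed

lemma gtrace_diff: "gtrace G I (\<lambda>v. A v - B v) = gtrace G I A - gtrace G I B"
  by (simp add: gtrace_def inner_diff_left sum_subtractf)

lemma gtrace_id: "gtrace G I (\<lambda>v. v) = card I"
  by (simp add: gtrace_def inner_delta fn_delta)

lemma gtrace_kernel_proj_nonneg: "kernel_proj M P \<Longrightarrow> 0 \<le> gtrace G I P"
  by (simp add: gtrace_def inner_kernel_proj sum_nonneg)

lemma gop_contraction_proj:
  assumes "gop G I J M M'" "contraction M M'"
  shows "gop G I I (contraction.P M M') (contraction.P M M')"
    "(\<lambda>n. gtrace G I (contraction.T M M' ^^ (2 * n))) \<longlonglongrightarrow> gtrace G I (contraction.P M M')"
proof -
  interpret contraction M M' by fact
  have gT: "gop G I I T T"
    unfolding T_def by (intro gop_diff gop_id gop_comp[OF gop_sym[OF assms(1)] assms(1)])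
  note gTn = gmapD[OF gop_funpow[OF gT, unfolded gop_def, THEN conjunct1]]
  have "gmap G I I P"
  proof (rule gmapI[OF bl_P])
    fix h v assume h: "h \<in> carrier G"
    have "(\<lambda>n. (T ^^ (2 * n)) (right_tr G h v)) \<longlonglongrightarrow> right_tr G h (P v)"
      using bounded_linear.tendsto[OF bounded_linear_right_tr[OF h] P_lim[of v]]
      by (simp add: gTn(2)[OF h])
    then show "P (right_tr G h v) = right_tr G h (P v)" by (rule LIMSEQ_unique[OF P_lim])
  next
    fix v assume "v \<in> hmod G I"
    then show "P v \<in> hmod G I" by (intro hmod_closed[OF _ P_lim] gTn(3))
  qed
  then show "gop G I I P P" using kernel_projD(1)[OF kernel_proj_P] by (simp add: gop_def)
  show "(\<lambda>n. gtrace G I (T ^^ (2 * n))) \<longlonglongrightarrow> gtrace G I P"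
    unfolding gtrace_def by (intro tendsto_intros P_lim)
qed

text \<open>Each further power changes the defect by the trace of \<open>T ^^ n\<close> composed
  with \<open>M'\<close> and \<open>M\<close>. The relation \<open>inter\<close> moves
  \<open>M\<close> past the powers, after which \<open>gtrace_commute\<close> matches the increments
  on both sides.\<close>

lemma gtrace_defect:
  assumes g: "gop G I J M M'" and c: "contraction M M'" "contraction M' M" and fin: "finite I" "finite J"
  shows "card I - gtrace G I (contraction.T M M' ^^ n) = card J - gtrace G J (contraction.T M' M ^^ n)"
proof (induction n)
  case 0
  show ?case using gtrace_id[of I] gtrace_id[of J] by (simp add: id_def)
next
  case (Suc n)
  interpret A: contraction M M' by fact
  interpret B: contraction M' M by fact
  have gA: "gop G I I A.T A.T"
    unfolding A.T_def by (intro gop_diff gop_id gop_comp[OF gop_sym[OF g] g])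
  have inter: "M ((A.T ^^ k) v) = (B.T ^^ k) (M v)" for k v
  proof (induction k)
    case (Suc k)
    have "M (A.T w) = B.T (M w)" for w
      by (simp add: A.T_def B.T_def linear_diff[OF bounded_linear.linear[OF A.bl]])
    then show ?case using Suc by simp
  qed simp
  have A: "(A.T ^^ Suc n) v = (A.T ^^ n) v - (A.T ^^ n) (M' (M v))" for v
  proof -
    have "(A.T ^^ Suc n) v = (A.T ^^ n) (v - M' (M v))" by (metis A.T_def comp_apply funpow_Suc_right)
    then show ?thesis by (simp only: linear_diff[OF bounded_linear.linear[OF A.bl_Tn]])
  qed
  have B: "(B.T ^^ Suc n) v = (B.T ^^ n) v - (B.T ^^ n) (M (M' v))" for v
  proof -
    have "(B.T ^^ Suc n) v = (B.T ^^ n) (v - M (M' v))" by (metis B.T_def comp_apply funpow_Suc_right)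
    then show ?thesis by (simp only: linear_diff[OF bounded_linear.linear[OF B.bl_Tn]])
  qed
  have gM: "gop G J I (\<lambda>v. (A.T ^^ n) (M' v)) (\<lambda>v. M ((A.T ^^ n) v))"
    by (rule gop_comp[OF gop_funpow[OF gA] gop_sym[OF g]])
  have "gtrace G I (\<lambda>v. (A.T ^^ n) (M' (M v))) = gtrace G J (\<lambda>v. M ((A.T ^^ n) (M' v)))"
    by (rule gtrace_commute[OF gM g]) (use fin in auto)
  also have "\<dots> = gtrace G J (\<lambda>v. (B.T ^^ n) (M (M' v)))" by (simp add: inter)
  finally show ?case
    using Suc unfolding A[abs_def] B[abs_def] gtrace_diff by simp
qed

theorem index_formula:
  assumes g: "gop G I J M M'" and fin: "finite I" "finite J"
  obtains P P' where "gop G I I P P" "kernel_proj M P" "gop G J J P' P'" "kernel_proj M' P'"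
    "card I - gtrace G I P = card J - gtrace G J P'"
proof -
  obtain K where K: "K > 0" "\<And>v. norm (M v) \<le> norm v * K"
    using bounded_linear.pos_bounded[OF gmapD(1)[OF g[unfolded gop_def, THEN conjunct1]]] by blast
  \<comment> \<open>Dividing both operators by the same positive \<open>K\<close> keeps them
    adjoint, leaves their kernels unchanged and makes them contractions.\<close>
  define N where "N v = (1/K) *\<^sub>R M v" for v
  define N' where "N' v = (1/K) *\<^sub>R M' v" for v
  have gN: "gop G I J N N'" unfolding N_def N'_def by (rule gop_scaleR[OF g])
  have c: "contraction N N'"
  proof -
    have "norm (N v) \<le> norm v" for v using K by (simp add: N_def field_simps)
    then show ?thesis using gN by (auto simp: contraction_def gop_def gmap_def)
  qed
  have c': "contraction N' N"
    using gN contraction.contr'[OF c] by (auto simp: contraction_def gop_def gmap_def adjoint_pair_sym)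
  let ?P = "contraction.P N N'" and ?P' = "contraction.P N' N"
  have "(\<lambda>n. card I - gtrace G I (contraction.T N N' ^^ (2 * n))) \<longlonglongrightarrow> card I - gtrace G I ?P"
    by (intro tendsto_intros gop_contraction_proj(2)[OF gN c])
  moreover have "(\<lambda>n. card J - gtrace G J (contraction.T N' N ^^ (2 * n))) \<longlonglongrightarrow> card J - gtrace G J ?P'"
    by (intro tendsto_intros gop_contraction_proj(2)[OF gop_sym[OF gN] c'])
  ultimately have "card I - gtrace G I ?P = card J - gtrace G J ?P'"
    unfolding gtrace_defect[OF gN c c' fin] by (rule LIMSEQ_unique)
  moreover have "kernel_proj M ?P" "kernel_proj M' ?P'"
    using contraction.kernel_proj_P[OF c] contraction.kernel_proj_P[OF c'] K(1)
    by (auto simp: kernel_proj_def N_def N'_def)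
  ultimately show thesis
    using that gop_contraction_proj(1)[OF gN c] gop_contraction_proj(1)[OF gop_sym[OF gN] c'] by blast
qed

end


section \<open>Cocycles on a presented group\<close>

text \<open>Fox calculus: \<open>c (y, a)\<close> is the value at \<open>y\<close> of the cocycle on
  the generator \<open>a\<close>, and the recursion is the rule b(gh) = b(g) + g b(h) with
  \<open>G\<close> acting by left translation. The branch for an inverse letter uses b(g^-1) = -g^-1
  b(g). No summability of \<open>c\<close> is assumed.\<close>

primrec word_cocycle :: "('a, 'b) monoid_scheme \<Rightarrow> ('g \<Rightarrow> 'a) \<Rightarrow> ('a \<times> 'g \<Rightarrow> real) \<Rightarrow>
    ('g \<times> bool) list \<Rightarrow> 'a \<Rightarrow> real" where
  "word_cocycle G x c [] y = 0"
| "word_cocycle G x c (a # w) y =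
     (if snd a then c (y, fst a) + word_cocycle G x c w (inv\<^bsub>G\<^esub> x (fst a) \<otimes>\<^bsub>G\<^esub> y)
      else word_cocycle G x c w (x (fst a) \<otimes>\<^bsub>G\<^esub> y) - c (x (fst a) \<otimes>\<^bsub>G\<^esub> y, fst a))"

text \<open>The same recursion as an operator, with the result placed in the coordinate
  \<open>j\<close>; this form shows that the value on a word is again square summable.\<close>

primrec word_op :: "('a, 'b) monoid_scheme \<Rightarrow> ('g \<Rightarrow> 'a) \<Rightarrow> 'j \<Rightarrow> ('g \<times> bool) list \<Rightarrow>
    ('a \<times> 'g) ell2 \<Rightarrow> ('a \<times> 'j) ell2" where
  "word_op G x j [] v = 0"
| "word_op G x j (a # w) v =
     (if snd a then coord G (fst a) j v + left_tr G (x (fst a)) (word_op G x j w v)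
      else left_tr G (inv\<^bsub>G\<^esub> x (fst a)) (word_op G x j w v - coord G (fst a) j v))"

locale generated_group = group G for G :: "('a, 'b) monoid_scheme" (structure) +
  fixes x :: "'g \<Rightarrow> 'a" and S :: "'g set"
  assumes x: "x ` S \<subseteq> carrier G"
begin

abbreviation "F \<equiv> free_group S"
abbreviation "\<phi> \<equiv> free_lift G x"

sublocale F: group F by (rule group_free_group)

lemma x_closed: "a \<in> S \<Longrightarrow> x a \<in> carrier G"
  using x by auto

lemma \<phi>_hom: "\<phi> \<in> hom F G"
  by (rule free_lift_hom[OF x])

sublocale \<phi>: group_hom F G \<phi>
  by unfold_locales (rule \<phi>_hom)

lemma F_letters: "w \<in> carrier F \<Longrightarrow> fst ` set w \<subseteq> S"
  by (simp add: free_group_def)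

lemma \<phi>_closed: "fst ` set w \<subseteq> S \<Longrightarrow> \<phi> w \<in> carrier G"
  by (induction w) (auto simp: free_lift_def x_closed)

lemma \<phi>_Cons: "\<phi> (a # w) = (if snd a then x (fst a) else inv (x (fst a))) \<otimes> \<phi> w"
  by (cases a) (simp add: free_lift_def)

text \<open>A letter followed by its inverse contributes two cancelling terms, so products in the
  free group may be evaluated as unreduced concatenations.\<close>

lemma cocycle_push:
  assumes "fst a \<in> S" "y \<in> carrier G"
  shows "word_cocycle G x c (push_letter a w) y = word_cocycle G x c (a # w) y"
proof (cases w)
  case (Cons b w')
  have "inv (x (fst a)) \<otimes> (x (fst a) \<otimes> y) = y" "x (fst a) \<otimes> (inv (x (fst a)) \<otimes> y) = y"
    using assms by (simp_all add: m_assoc[symmetric] x_closed)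
  then show ?thesis using Cons by (auto simp: inv_letter_def)
qed simp

lemma cocycle_foldr:
  assumes "fst ` set w \<subseteq> S" "y \<in> carrier G"
  shows "word_cocycle G x c (foldr push_letter w w') y =
    word_cocycle G x c w y + word_cocycle G x c w' (inv (\<phi> w) \<otimes> y)"
  using assms
proof (induction w arbitrary: y)
  case Nil
  then show ?case by (simp add: free_lift_def)
next
  case (Cons a w)
  have a: "fst a \<in> S" "x (fst a) \<in> carrier G" and w: "fst ` set w \<subseteq> S" "\<phi> w \<in> carrier G"
    using Cons.prems x_closed \<phi>_closed by auto
  have i: "inv (\<phi> (a # w)) \<otimes> y = inv (\<phi> w) \<otimes> ((if snd a then inv (x (fst a)) else x (fst a)) \<otimes> y)"
    using a w Cons.prems by (simp add: \<phi>_Cons inv_mult_group m_assoc)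
  have "word_cocycle G x c (foldr push_letter (a # w) w') y =
      word_cocycle G x c (a # foldr push_letter w w') y"
    using cocycle_push[OF a(1) Cons.prems(2)] by simp
  also have "\<dots> = word_cocycle G x c (a # w) y + word_cocycle G x c w' (inv (\<phi> (a # w)) \<otimes> y)"
    unfolding i using a w Cons.prems Cons.IH[OF w(1)] by simp
  finally show ?case .
qed

lemma cocycle_mult:
  assumes "w \<in> carrier F" "y \<in> carrier G"
  shows "word_cocycle G x c (w \<otimes>\<^bsub>F\<^esub> w') y =
    word_cocycle G x c w y + word_cocycle G x c w' (inv (\<phi> w) \<otimes> y)"
  using cocycle_foldr[OF F_letters[OF assms(1)] assms(2)] by (simp add: free_group_def)

lemma cocycle_one [simp]: "word_cocycle G x c \<one>\<^bsub>F\<^esub> y = 0"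
  by (simp add: free_group_def)

text \<open>The relation \<open>u u\<^sup>m = u\<^sup>m u\<close> makes the cocycle value on \<open>u\<^sup>m\<close> invariant under \<open>u\<close>.\<close>

lemma cocycle_pow_invariant:
  assumes u: "u \<in> carrier F" and m: "\<phi> u [^] m = \<one>" and y: "y \<in> carrier G"
  shows "word_cocycle G x c (u [^]\<^bsub>F\<^esub> m) (inv (\<phi> u) \<otimes> y) = word_cocycle G x c (u [^]\<^bsub>F\<^esub> (m::nat)) y"
proof -
  have um: "u [^]\<^bsub>F\<^esub> m \<in> carrier F" using u by simp
  have "\<phi> (u [^]\<^bsub>F\<^esub> m) = \<one>" using u m by (simp add: \<phi>.hom_nat_pow)
  moreover have "u \<otimes>\<^bsub>F\<^esub> u [^]\<^bsub>F\<^esub> m = u [^]\<^bsub>F\<^esub> m \<otimes>\<^bsub>F\<^esub> u"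
    using u by (metis F.nat_pow_Suc F.nat_pow_Suc2)
  ultimately show ?thesis
    using cocycle_mult[OF u y, of c "u [^]\<^bsub>F\<^esub> m"] cocycle_mult[OF um y, of c u] y by simp
qed

text \<open>On the kernel of \<open>\<phi>\<close> the translation in the cocycle rule disappears,
  so the rule becomes additive. For a conjugate of such a \<open>w\<close> by \<open>g\<close>, the
  contributions of \<open>g\<close> and its inverse cancel. Hence vanishing passes from the relators
  to their normal closure.\<close>

lemma normal_cocycle_kernel:
  "{w \<in> kernel F G \<phi>. \<forall>y\<in>carrier G. word_cocycle G x c w y = 0} \<lhd> F" (is "?K \<lhd> F")
proof (rule F.normal_invI)
  have K: "w \<in> carrier F" "\<phi> w = \<one>" "y \<in> carrier G \<Longrightarrow> word_cocycle G x c w y = 0"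
    if "w \<in> ?K" for w y
    using that by (auto simp: kernel_def)
  have inv0: "word_cocycle G x c (inv\<^bsub>F\<^esub> w) (inv (\<phi> w) \<otimes> y) = - word_cocycle G x c w y"
    if "w \<in> carrier F" "y \<in> carrier G" for w y
    using cocycle_mult[OF that, of c "inv\<^bsub>F\<^esub> w"] that by simp
  show "subgroup ?K F"
  proof (rule F.subgroupI)
    show "?K \<noteq> {}" using cocycle_one by (auto simp: kernel_def intro!: exI[of _ "\<one>\<^bsub>F\<^esub>"])
    show "inv\<^bsub>F\<^esub> w \<in> ?K" if "w \<in> ?K" for w
      using K[OF that] inv0[of w] by (auto simp: kernel_def)
    show "v \<otimes>\<^bsub>F\<^esub> w \<in> ?K" if "v \<in> ?K" "w \<in> ?K" for v w
      using K[OF that(1)] K[OF that(2)] by (auto simp: kernel_def cocycle_mult)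
  qed (auto simp: kernel_def)
  fix g w assume g: "g \<in> carrier F" and w: "w \<in> ?K"
  show "g \<otimes>\<^bsub>F\<^esub> w \<otimes>\<^bsub>F\<^esub> inv\<^bsub>F\<^esub> g \<in> ?K"
    using g K[OF w] inv0[OF g] by (auto simp: kernel_def cocycle_mult)
qed

lemma cocycle_kernel:
  assumes pres: "presented_by G x S R"
    and R: "R \<subseteq> carrier F" "\<And>\<rho> y. \<rho> \<in> R \<Longrightarrow> y \<in> carrier G \<Longrightarrow> word_cocycle G x c \<rho> y = 0"
    and w: "w \<in> kernel F G \<phi>" and y: "y \<in> carrier G"
  shows "word_cocycle G x c w y = 0"
proof -
  have ker: "kernel F G \<phi> = normal_closure F R" using pres by (simp add: presented_by_def)
  have "R \<subseteq> kernel F G \<phi>" unfolding ker normal_closure_def by blast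
  then have "normal_closure F R \<subseteq> {w \<in> kernel F G \<phi>. \<forall>y\<in>carrier G. word_cocycle G x c w y = 0}"
    unfolding normal_closure_def using R normal_cocycle_kernel[of c] by blast
  then show ?thesis using w y ker by auto
qed

text \<open>The potential at \<open>y\<close> is the value at \<open>y\<close> of the cocycle on the
  group element \<open>y\<close>, computed from a representative word \<open>s y\<close>. The
  cocycle rule for y = g (g^-1 y) gives the coboundary formula, and vanishing on the kernel makes
  the choice of words immaterial.\<close>

theorem cocycle_potential:
  assumes pres: "presented_by G x S R"
    and R: "R \<subseteq> carrier F" "\<And>\<rho> y. \<rho> \<in> R \<Longrightarrow> y \<in> carrier G \<Longrightarrow> word_cocycle G x c \<rho> y = 0"
  obtains f where "\<And>w y. w \<in> carrier F \<Longrightarrow> y \<in> carrier G \<Longrightarrow>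
    word_cocycle G x c w y = f y - f (inv (\<phi> w) \<otimes> y)"
proof -
  have surj: "\<phi> ` carrier F = carrier G" using pres by (simp add: presented_by_def)
  define s where "s y = (SOME w. w \<in> carrier F \<and> \<phi> w = y)" for y
  have s: "s y \<in> carrier F" "\<phi> (s y) = y" if "y \<in> carrier G" for y
  proof -
    have "\<exists>w. w \<in> carrier F \<and> \<phi> w = y" using that surj by (metis imageE)
    then show "s y \<in> carrier F" "\<phi> (s y) = y" unfolding s_def by (metis (mono_tags, lifting) someI_ex)+
  qed
  have eq: "word_cocycle G x c v y = word_cocycle G x c w y"
    if "v \<in> carrier F" "w \<in> carrier F" "\<phi> v = \<phi> w" "y \<in> carrier G" for v w y
  proof -
    let ?k = "v \<otimes>\<^bsub>F\<^esub> inv\<^bsub>F\<^esub> w"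
    have k: "?k \<in> carrier F" "\<phi> ?k = \<one>" using that by simp_all
    have "v = ?k \<otimes>\<^bsub>F\<^esub> w" using that by (simp add: F.m_assoc)
    then have "word_cocycle G x c v y = word_cocycle G x c ?k y + word_cocycle G x c w y"
      using cocycle_mult[OF k(1) that(4), of c w] k(2) that(4) by simp
    then show ?thesis using cocycle_kernel[OF pres R _ that(4), of ?k] k by (simp add: kernel_def)
  qed
  show thesis
  proof (rule that[of "\<lambda>y. word_cocycle G x c (s y) y"])
    fix w y assume w: "w \<in> carrier F" and y: "y \<in> carrier G"
    let ?z = "inv (\<phi> w) \<otimes> y"
    have z: "?z \<in> carrier G" using w y by simp
    have "\<phi> (w \<otimes>\<^bsub>F\<^esub> s ?z) = y" using w y s[OF z] by (simp add: m_assoc[symmetric])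
    then have "word_cocycle G x c (s y) y = word_cocycle G x c (w \<otimes>\<^bsub>F\<^esub> s ?z) y"
      using s[OF y] s[OF z] w y by (intro eq) auto
    then show "word_cocycle G x c w y = word_cocycle G x c (s y) y - word_cocycle G x c (s ?z) ?z"
      using cocycle_mult[OF w y] by simp
  qed
qed

section \<open>Relator conditions as an equivariant operator\<close>

lemma fn_word_op:
  assumes "fst ` set w \<subseteq> S"
  shows "fn (word_op G x j w v) (y, k) =
    (if y \<in> carrier G \<and> k = j then word_cocycle G x (fn v) w y else 0)"
  using assms
proof (induction w arbitrary: y)
  case (Cons a w)
  then have "x (fst a) \<in> carrier G" "fst ` set w \<subseteq> S" using x_closed by auto
  then show ?case using Cons.IH by (auto simp: fn_left_tr fn_coord)
qed simp

lemma gop_word_op: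
  assumes "fst ` set w \<subseteq> S" "j \<in> J"
  shows "\<exists>B. gop G S J (word_op G x j w) B"
  using assms(1)
proof (induction w)
  case Nil
  have "word_op G x j [] = (\<lambda>_. 0)" by (simp add: fun_eq_iff)
  then show ?case using gop_zero[of S J] by auto
next
  case (Cons a w)
  then obtain B where B: "gop G S J (word_op G x j w) B" by auto
  have a: "fst a \<in> S" "x (fst a) \<in> carrier G" using Cons.prems x_closed by auto
  have c: "gop G S J (coord G (fst a) j) (coord G j (fst a))" by (rule gop_coord[OF a(1) assms(2)])
  show ?case
  proof (cases "snd a")
    case True
    then have "word_op G x j (a # w) = (\<lambda>v. coord G (fst a) j v + left_tr G (x (fst a)) (word_op G x j w v))"
      by (simp add: fun_eq_iff)
    then show ?thesis using gop_add[OF c gop_comp[OF gop_left_tr[OF a(2)] B]] by auto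
  next
    case False
    then have "word_op G x j (a # w) =
        (\<lambda>v. left_tr G (inv (x (fst a))) (word_op G x j w v - coord G (fst a) j v))"
      by (simp add: fun_eq_iff)
    then show ?thesis
      using gop_comp[OF gop_left_tr[of "inv (x (fst a))"] gop_diff[OF B c]] a(2) by auto
  qed
qed

lemma gop_word_op_sum:
  assumes "\<And>k. k \<in> K \<Longrightarrow> fst ` set (w k) \<subseteq> S" "finite K"
  obtains B where "gop G S K (\<lambda>v. \<Sum>k\<in>K. word_op G x k (w k) v) B"
    "\<And>v y k. fn (\<Sum>k\<in>K. word_op G x k (w k) v) (y, k) =
      (if y \<in> carrier G \<and> k \<in> K then word_cocycle G x (fn v) (w k) y else 0)"
proof -
  have "\<forall>k\<in>K. \<exists>B. gop G S K (word_op G x k (w k)) B"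
    by (intro ballI gop_word_op assms(1))
  then obtain B where B: "\<And>k. k \<in> K \<Longrightarrow> gop G S K (word_op G x k (w k)) (B k)" by metis
  have "fn (\<Sum>k\<in>K. word_op G x k (w k) v) (y, k) =
      (if y \<in> carrier G \<and> k \<in> K then word_cocycle G x (fn v) (w k) y else 0)" for v y k
  proof -
    have "fn (\<Sum>k\<in>K. word_op G x k (w k) v) (y, k) =
        (\<Sum>l\<in>K. if k = l then (if y \<in> carrier G then word_cocycle G x (fn v) (w k) y else 0) else 0)"
      unfolding fn_sum by (intro sum.cong refl) (auto simp: fn_word_op assms(1))
    then show ?thesis using assms(2) by simp
  qed
  from that[OF gop_sum[OF B] this] show thesis .
qed

end

section \<open>Lower bound for the dimension of the cocycle space\<close>

lemma kernel_proj_dist_le: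
  assumes P: "kernel_proj M P" and z: "M z = 0" and lin: "linear P"
  shows "norm (v - P v) \<le> norm (v - z)"
proof -
  let ?w = "v - z"
  have "v - P v = ?w - P ?w" using kernel_projD(3)[OF P z] linear_diff[OF lin, of v z] by simp
  moreover have "(norm (?w - P ?w))\<^sup>2 = (norm ?w)\<^sup>2 - (norm (P ?w))\<^sup>2"
    using inner_kernel_proj[OF P, of ?w]
    by (simp add: power2_norm_eq_inner inner_diff_left inner_diff_right inner_commute)
  ultimately have "(norm (v - P v))\<^sup>2 \<le> (norm ?w)\<^sup>2"
    using zero_le_power2[of "norm (P ?w)"] by (simp only:)
  then show ?thesis by (rule power2_le_imp_le) simp
qed

text \<open>By the index formula it suffices to find a large kernel of the adjoint
  \<open>\<Phi>'\<close>. For every relator some vector \<open>z\<close> in that kernel has squared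
  distance \<open>1 / m i\<close> from the basis vector at \<open>i\<close>, and the nearest kernel
  vector is no farther away.\<close>

theorem (in generated_group) cocycle_space_dimension:
  fixes u :: "'i \<Rightarrow> ('g \<times> bool) list" and m :: "'i \<Rightarrow> nat"
  assumes fin: "finite S" "finite I"
    and u: "\<And>i. i \<in> I \<Longrightarrow> u i \<in> carrier F" and m: "\<And>i. i \<in> I \<Longrightarrow> m i > 0"
    and pres: "presented_by G x S ((\<lambda>i. u i [^]\<^bsub>F\<^esub> m i) ` I)"
    and ord: "\<And>i. i \<in> I \<Longrightarrow> ord (\<phi> (u i)) = m i"
  obtains \<Phi> :: "('a \<times> 'g) ell2 \<Rightarrow> ('a \<times> 'i) ell2" and P where
    "gop G S S P P" "kernel_proj \<Phi> P" "gtrace G S P \<ge> card S - (\<Sum>i\<in>I. 1 / m i)"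
    "\<And>v. \<exists>f. \<forall>w\<in>carrier F. \<forall>y\<in>carrier G.
      word_cocycle G x (fn (P v)) w y = f y - f (inv (\<phi> w) \<otimes> y)"
proof -
  define \<rho> where "\<rho> i = u i [^]\<^bsub>F\<^esub> m i" for i
  have \<rho>: "\<rho> i \<in> carrier F" if "i \<in> I" for i using u[OF that] by (simp add: \<rho>_def)
  define \<Phi> where "\<Phi> v = (\<Sum>i\<in>I. word_op G x i (\<rho> i) v)" for v
  obtain \<Phi>' where gop: "gop G S I \<Phi> \<Phi>'" and fn\<Phi>: "\<And>v y i. fn (\<Phi> v) (y, i) =
      (if y \<in> carrier G \<and> i \<in> I then word_cocycle G x (fn v) (\<rho> i) y else 0)"
    using gop_word_op_sum[of I \<rho>] F_letters[OF \<rho>] fin(2) unfolding \<Phi>_def by blast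
  obtain P P' where P: "gop G S S P P" "kernel_proj \<Phi> P" and P': "gop G I I P' P'" "kernel_proj \<Phi>' P'"
    and index: "card S - gtrace G S P = card I - gtrace G I P'"
    using index_formula[OF gop fin] by blast
  have adj: "adjoint_pair \<Phi> \<Phi>'" using gop by (simp add: gop_def)
  have lin: "linear P'" using P'(1) by (auto simp: gop_def gmap_def bounded_linear.linear)
  have "inner (P' (delta (\<one>, i))) (delta (\<one>, i)) \<ge> 1 - 1 / m i" if i: "i \<in> I" for i
  proof -
    define g where "g = \<phi> (u i)"
    have g: "g \<in> carrier G" using u[OF i] by (simp add: g_def)
    have gm: "g [^] m i = \<one>" using ord[OF i] pow_ord_eq_1[OF g] by (simp add: g_def)
    \<comment> \<open>The vector \<open>z\<close> is the basis vector minus its average over the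
      cyclic group of \<open>g\<close>. Pairing with \<open>\<Phi> v\<close> compares one value with
      its average along that group, which is zero by invariance.\<close>
    define a where "a = (\<Sum>k<m i. delta (g [^] k, i))"
    define z where "z = delta (\<one>, i) - (1 / m i) *\<^sub>R a"
    have inva: "fn (\<Phi> v) (g [^] k, i) = fn (\<Phi> v) (\<one>, i)" for v and k :: nat
    proof (induction k)
      case (Suc k)
      have "inv g \<otimes> g [^] Suc k = g [^] k"
        using g by (metis nat_pow_Suc2 inv_closed l_inv l_one m_assoc nat_pow_closed)
      then have "fn (\<Phi> v) (g [^] Suc k, i) = fn (\<Phi> v) (g [^] k, i)"
        using cocycle_pow_invariant[OF u[OF i], of "m i" "g [^] Suc k" "fn v"] g gm i
        by (simp add: fn\<Phi> \<rho>_def g_def)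
      then show ?case using Suc by simp
    qed simp
    have "inner v (\<Phi>' z) = inner v 0" for v
    proof -
      have "inner v (\<Phi>' z) = fn (\<Phi> v) (\<one>, i) - (1 / m i) * (\<Sum>k<m i. fn (\<Phi> v) (g [^] k, i))"
        unfolding adjoint_pairD[OF adj, symmetric] z_def a_def
        by (simp add: inner_diff_right inner_sum_right inner_delta)
      then show ?thesis using m[OF i] by (simp add: inva)
    qed
    then have z: "\<Phi>' z = 0" by (metis adjoint_eqI inner_commute)
    \<comment> \<open>The exact order enters here: the \<open>m i\<close> powers of \<open>g\<close>
      are distinct, so \<open>a\<close> is a sum of orthonormal vectors and has squared norm
      \<open>m i\<close>.\<close>
    have inj: "inj_on (\<lambda>k. g [^] k) {..<m i}"
    proof -
      have "{0..ord g - 1} = {..<m i}" using ord[OF i] m[OF i] by (auto simp: g_def)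
      then show ?thesis using ord_inj[OF g] by simp
    qed
    have "fn (delta (g [^] k, i)) (g [^] l, i) = (if k = l then 1 else 0)" if "k < m i" "l < m i" for k l
      using inj that by (auto simp: fn_delta dest: inj_onD)
    then have "(\<Sum>l<m i. \<Sum>k<m i. fn (delta (g [^] k, i)) (g [^] l, i)) =
        (\<Sum>l<m i. \<Sum>k<m i. if k = l then 1 else 0)"
      by (intro sum.cong refl) auto
    then have "inner a a = m i"
      by (simp add: a_def inner_sum_left inner_sum_right inner_delta)
    then have "(norm a)\<^sup>2 = m i" by (simp add: power2_norm_eq_inner)
    then have "(norm (delta (\<one>, i) - z))\<^sup>2 = (1 / m i)\<^sup>2 * m i"
      by (simp add: z_def power_divide)
    then have "(norm (delta (\<one>, i) - z))\<^sup>2 = 1 / m i"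
      using m[OF i] by (simp add: power2_eq_square)
    moreover have "(norm (delta (\<one>, i) - P' (delta (\<one>, i))))\<^sup>2 \<le> (norm (delta (\<one>, i) - z))\<^sup>2"
      by (intro power_mono kernel_proj_dist_le[OF P'(2) z lin]) simp
    moreover have "(norm (delta (\<one>, i) - P' (delta (\<one>, i))))\<^sup>2 =
        1 - inner (P' (delta (\<one>, i))) (delta (\<one>, i))"
      using inner_kernel_proj[OF P'(2), of "delta (\<one>, i)"]
      by (simp add: power2_norm_eq_inner inner_diff_left inner_diff_right inner_commute inner_delta fn_delta)
    ultimately show ?thesis by linarith
  qed
  then have "gtrace G I P' \<ge> (\<Sum>i\<in>I. 1 - 1 / m i)" unfolding gtrace_def by (rule sum_mono)
  then have "gtrace G S P \<ge> card S - (\<Sum>i\<in>I. 1 / m i)"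
    using index by (simp add: sum_subtractf)
  moreover have "\<exists>f. \<forall>w\<in>carrier F. \<forall>y\<in>carrier G.
      word_cocycle G x (fn (P v)) w y = f y - f (inv (\<phi> w) \<otimes> y)" for v
  proof -
    have rel: "word_cocycle G x (fn (P v)) r y = 0" if r: "r \<in> (\<lambda>i. u i [^]\<^bsub>F\<^esub> m i) ` I" and y: "y \<in> carrier G" for r y
    proof -
      obtain i where i: "i \<in> I" "r = \<rho> i" using r by (auto simp: \<rho>_def)
      show ?thesis using fn\<Phi>[of "P v" y i] kernel_projD(2)[OF P(2), of v] i y by simp
    qed
    have "(\<lambda>i. u i [^]\<^bsub>F\<^esub> m i) ` I \<subseteq> carrier F" using \<rho> by (auto simp: \<rho>_def)
    from cocycle_potential[OF pres this rel] obtain f where "\<And>w y. w \<in> carrier F \<Longrightarrow> y \<in> carrier G \<Longrightarrow>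
        word_cocycle G x (fn (P v)) w y = f y - f (inv (\<phi> w) \<otimes> y)"
      by blast
    then show ?thesis by blast
  qed
  ultimately show thesis using that P by blast
qed


section \<open>Upper bounds for the dimension of the cocycle space\<close>

lemma norm2_diff_kernel_proj:
  assumes "kernel_proj M P"
  shows "(norm (v - P v))\<^sup>2 = (norm v)\<^sup>2 - inner (P v) v"
  using inner_kernel_proj[OF assms, of v]
  by (simp add: power2_norm_eq_inner inner_diff_left inner_diff_right inner_commute)

text \<open>The operator \<open>D\<close> sends a function to its coboundary. Columns of
  \<open>P\<close> in the range of \<open>D\<close> are killed by the projection \<open>Q'\<close>
  onto the kernel of the adjoint, so the traces of \<open>P\<close> and \<open>Q'\<close> add up to
  at most \<open>card S\<close>. The index formula for \<open>D\<close>, whose source has rank 1,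
  bounds the trace of \<open>P\<close> by 1.\<close>

lemma (in generated_group) inner_cocycles_dimension:
  assumes fin: "finite S" and P: "gop G S S P P" "kernel_proj \<Phi> P"
    and inner: "\<And>a. a \<in> S \<Longrightarrow> \<exists>\<xi> :: ('a \<times> unit) ell2. \<forall>i\<in>S. \<forall>y\<in>carrier G.
      fn (P (delta (\<one>, a))) (y, i) = fn \<xi> (y, ()) - fn \<xi> (inv x i \<otimes> y, ())"
  shows "gtrace G S P \<le> 1"
proof -
  define D :: "('a \<times> unit) ell2 \<Rightarrow> ('a \<times> 'g) ell2"
    where "D \<xi> = (\<Sum>i\<in>S. coord G () i \<xi> - left_tr G (x i) (coord G () i \<xi>))" for \<xi>
  define D' :: "('a \<times> 'g) ell2 \<Rightarrow> ('a \<times> unit) ell2"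
    where "D' v = (\<Sum>i\<in>S. coord G i () v - coord G i () (left_tr G (inv x i) v))" for v
  have gop: "gop G {()} S D D'"
    unfolding D_def D'_def
    by (intro gop_sum gop_diff gop_comp[OF gop_left_tr] gop_coord) (auto simp: x_closed)
  have fnD: "fn (D \<xi>) (y, i) = (if i \<in> S \<and> y \<in> carrier G then fn \<xi> (y, ()) - fn \<xi> (inv x i \<otimes> y, ()) else 0)"
    for \<xi> y i
  proof -
    have "fn (D \<xi>) (y, i) = (\<Sum>l\<in>S. if i = l then
        (if y \<in> carrier G then fn \<xi> (y, ()) - fn \<xi> (inv x i \<otimes> y, ()) else 0) else 0)"
      unfolding D_def fn_sum by (intro sum.cong refl) (auto simp: fn_left_tr fn_coord x_closed)
    then show ?thesis using fin by simp
  qed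
  obtain Q Q' where Q: "kernel_proj D Q" and Q': "gop G S S Q' Q'" "kernel_proj D' Q'"
    and index: "real (card {()}) - gtrace G {()} Q = card S - gtrace G S Q'"
    using index_formula[OF gop] fin by (metis finite.emptyI finite_insert)
  have adj: "adjoint_pair D D'" using gop by (simp add: gop_def)
  have lin: "linear Q'" using Q'(1) by (auto simp: gop_def gmap_def bounded_linear.linear)
  have Pmod: "P (delta (\<one>, a)) \<in> hmod G S" if "a \<in> S" for a
    using P(1) delta_in_hmod[OF that] by (auto simp: gop_def gmap_def)
  have Q'0: "Q' (P (delta (\<one>, a))) = 0" if a: "a \<in> S" for a
  proof -
    obtain \<xi> :: "('a \<times> unit) ell2" where \<xi>: "\<And>i y. i \<in> S \<Longrightarrow> y \<in> carrier G \<Longrightarrow>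
        fn (P (delta (\<one>, a))) (y, i) = fn \<xi> (y, ()) - fn \<xi> (inv x i \<otimes> y, ())"
      using inner[OF a] by blast
    have "fn (P (delta (\<one>, a))) (y, i) = fn (D \<xi>) (y, i)" for y i
      using Pmod[OF a] \<xi>[of i y] by (auto simp: fnD hmod_def)
    then have eq: "P (delta (\<one>, a)) = D \<xi>" by (intro ell2_eqI) auto
    show ?thesis
      unfolding eq
    proof (rule adjoint_eqI)
      fix w
      have "inner (Q' (D \<xi>)) w = inner \<xi> (D' (Q' w))"
        by (simp only: adjoint_pairD[OF kernel_projD(1)[OF Q'(2)]] adjoint_pairD[OF adj])
      then show "inner (Q' (D \<xi>)) w = inner 0 w" by (simp add: kernel_projD(2)[OF Q'(2)])
    qed
  qed
  have "inner (Q' (delta (\<one>, a))) (delta (\<one>, a)) \<le> 1 - inner (P (delta (\<one>, a))) (delta (\<one>, a))"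
    if a: "a \<in> S" for a
  proof -
    let ?e = "delta (\<one>, a)"
    \<comment> \<open>Since \<open>Q'\<close> annihilates \<open>P ?e\<close>, it sees only the part
      of the basis vector orthogonal to the range of \<open>P\<close>.\<close>
    have "Q' ?e = Q' (?e - P ?e)" by (simp add: linear_diff[OF lin] Q'0[OF a])
    then have "inner (Q' ?e) ?e = (norm (Q' (?e - P ?e)))\<^sup>2" using inner_kernel_proj[OF Q'(2), of ?e] by simp
    also have "\<dots> \<le> (norm (?e - P ?e))\<^sup>2" by (intro power_mono norm_kernel_proj_le[OF Q'(2)]) simp
    also have "\<dots> = 1 - inner (P ?e) ?e" by (simp add: norm2_diff_kernel_proj[OF P(2)])
    finally show ?thesis .
  qed
  then have "gtrace G S Q' \<le> (\<Sum>a\<in>S. 1 - inner (P (delta (\<one>, a))) (delta (\<one>, a)))"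
    unfolding gtrace_def by (rule sum_mono)
  also have "\<dots> = card S - gtrace G S P" by (simp add: gtrace_def sum_subtractf)
  finally show ?thesis
    using index gtrace_kernel_proj_nonneg[OF Q, of "{()}"] by simp
qed

section \<open>The trace of a projection in a finite window\<close>

lemma inner_finite_support:
  assumes "finite X" "\<And>z. z \<notin> X \<Longrightarrow> fn v z = 0"
  shows "inner v w = (\<Sum>z\<in>X. fn v z * fn w z)"
proof -
  have "inner v w = (\<Sum>\<^sub>\<infinity>z\<in>X. fn v z * fn w z)"
    unfolding inner_ell2_def by (rule infsum_cong_neutral) (auto simp: assms(2))
  then show ?thesis by (simp add: assms(1))
qed

text \<open>On functions supported in \<open>X\<close>, the complementary projection
  \<open>Q\<close> kills everything orthogonal to the restrictions of the \<open>b y\<close>. Its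
  trace over \<open>X\<close> can therefore be computed in an orthogonal basis of their span, where
  each of the at most \<open>card Y\<close> vectors contributes at most 1.\<close>

lemma kernel_proj_rank_bound:
  fixes b :: "'i \<Rightarrow> 'x ell2" and M :: "'x ell2 \<Rightarrow> 'k::real_vector"
  assumes P: "kernel_proj M P" and lin: "linear P" and fin: "finite X" "finite Y"
    and ker: "\<And>\<eta>. (\<And>z. z \<notin> X \<Longrightarrow> fn \<eta> z = 0) \<Longrightarrow> (\<And>y. y \<in> Y \<Longrightarrow> inner \<eta> (b y) = 0) \<Longrightarrow> M \<eta> = 0"
  shows "(\<Sum>z\<in>X. inner (P (delta z)) (delta z)) \<ge> real (card X) - real (card Y)"
proof -
  define r :: "'x ell2 \<Rightarrow> 'x ell2" where "r = pull X (\<lambda>z. z)"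
  have fn_r: "fn (r v) z = (if z \<in> X then fn v z else 0)" for v z
    by (simp add: r_def fn_pull)
  let ?B = "(\<lambda>y. r (b y)) ` Y"
  obtain C where C: "finite C" "card C \<le> card ?B" "span C = span ?B" "pairwise orthogonal C"
    using basis_orthogonal[of ?B] fin by auto
  \<comment> \<open>Removing 0 permits division by \<open>inner c c\<close> in the expansion
    below.\<close>
  define D where "D = C - {0}"
  have D: "finite D" "card D \<le> card Y" "\<And>c. c \<in> D \<Longrightarrow> inner c c > 0"
    using C card_image_le[OF fin(2), of "\<lambda>y. r (b y)"] card_mono[of C D] by (auto simp: D_def)
  have orth: "inner c c' = 0" if "c \<in> D" "c' \<in> D" "c \<noteq> c'" for c c'
    using C(4) that by (auto simp: D_def pairwise_def orthogonal_def)
  have supp: "fn c z = 0" if "c \<in> D" "z \<notin> X" for c z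
  proof -
    have "c \<in> span ?B" using that(1) C(3) span_base by (auto simp: D_def)
    moreover have "subspace {c. fn c z = 0}" by (auto simp: subspace_def)
    moreover have "fn c z = 0" if "c \<in> ?B" for c using that \<open>z \<notin> X\<close> by (auto simp: fn_r)
    ultimately show ?thesis using span_induct[of c ?B "\<lambda>c. fn c z = 0"] by blast
  qed
  define Q where "Q v = v - P v" for v
  have linQ: "linear Q" unfolding Q_def by (intro linear_compose_sub linear_id[unfolded id_def] lin)
  \<comment> \<open>The remainder after projecting \<open>delta z\<close> to the span of
    \<open>D\<close> satisfies the hypothesis \<open>ker\<close>, so \<open>Q\<close> annihilates
    it.\<close>
  have Qd: "Q (delta z) = (\<Sum>c\<in>D. (fn c z / inner c c) *\<^sub>R Q c)" if z: "z \<in> X" for z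
  proof -
    define \<eta> where "\<eta> = delta z - (\<Sum>c\<in>D. (fn c z / inner c c) *\<^sub>R c)"
    have \<eta>D: "inner \<eta> c = 0" if c: "c \<in> D" for c
    proof -
      have "inner (\<Sum>c\<in>D. (fn c z / inner c c) *\<^sub>R c) c = (\<Sum>c'\<in>D. if c' = c then fn c z else 0)"
        unfolding inner_sum_left by (intro sum.cong refl) (use orth c D(3)[OF c] in auto)
      then show ?thesis using c D(1) by (simp add: \<eta>_def inner_diff_left inner_delta)
    qed
    have supp\<eta>: "fn \<eta> w = 0" if "w \<notin> X" for w
      using that z supp by (auto simp: \<eta>_def fn_delta)
    have "M \<eta> = 0"
    proof (rule ker[OF supp\<eta>])
      fix y assume y: "y \<in> Y"
      have "r (b y) \<in> span C" using y C(3) by (auto intro: span_base)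
      moreover have "subspace {c. inner \<eta> c = 0}" by (auto simp: subspace_def inner_add_right)
      moreover have "inner \<eta> c = 0" if "c \<in> C" for c
        using \<eta>D[of c] that by (cases "c = 0") (auto simp: D_def)
      ultimately have "inner \<eta> (r (b y)) = 0"
        using span_induct[of "r (b y)" C "\<lambda>c. inner \<eta> c = 0"] by auto
      moreover have "inner \<eta> (b y) = inner \<eta> (r (b y))"
        using supp\<eta> fin(1) by (simp add: inner_finite_support[of X] fn_r)
      ultimately show "inner \<eta> (b y) = 0" by simp
    qed
    then have "Q \<eta> = 0" using kernel_projD(3)[OF P] by (simp add: Q_def)
    then have "Q (delta z) = Q (\<Sum>c\<in>D. (fn c z / inner c c) *\<^sub>R c)"
      by (simp add: \<eta>_def linear_diff[OF linQ])
    then show ?thesis by (simp add: linear_sum[OF linQ] linear_cmul[OF linQ])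
  qed
  have "(\<Sum>z\<in>X. inner (Q (delta z)) (delta z)) = (\<Sum>z\<in>X. \<Sum>c\<in>D. (fn c z / inner c c) * fn (Q c) z)"
    by (intro sum.cong refl) (simp add: Qd inner_sum_left inner_delta)
  also have "\<dots> = (\<Sum>c\<in>D. \<Sum>z\<in>X. (fn c z / inner c c) * fn (Q c) z)" by (rule sum.swap)
  also have "\<dots> \<le> (\<Sum>c\<in>D. 1)"
  proof (rule sum_mono)
    fix c assume c: "c \<in> D"
    have "(\<Sum>z\<in>X. (fn c z / inner c c) * fn (Q c) z) = inner c (Q c) / inner c c"
      using supp[OF c] fin(1) by (simp add: inner_finite_support[of X c] sum_divide_distrib)
    moreover have "inner c (Q c) \<le> inner c c"
      using inner_kernel_proj[OF P, of c] by (simp add: Q_def inner_diff_right inner_commute)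
    ultimately show "(\<Sum>z\<in>X. (fn c z / inner c c) * fn (Q c) z) \<le> 1" using D(3)[OF c] by simp
  qed
  also have "\<dots> \<le> card Y" using D(2) by simp
  finally show ?thesis by (simp add: Q_def inner_diff_left sum_subtractf inner_delta fn_delta)
qed

section \<open>Restriction of cocycles to an infinite normal subgroup\<close>

context generated_group
begin

text \<open>Diagonal entries do not depend on the group element, so the trace over a window
  \<open>A\<close> is \<open>card A\<close> times the von Neumann trace.\<close>

lemma fn_gop_translate:
  assumes P: "gop G I J P P'" and y: "y \<in> carrier G"
  shows "fn (P (delta (y, k))) (y, l) = fn (P (delta (\<one>, k))) (\<one>, l)"
proof -
  have "P (delta (y, k)) = right_tr G (inv y) (P (delta (\<one>, k)))"
    using P y right_tr_delta[OF y, of k] unfolding gop_def gmap_def by (metis inv_closed)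
  then show ?thesis using y by (simp add: fn_right_tr)
qed

text \<open>The values \<open>c(k)(y)\<close> of a cocycle \<open>c\<close>, for \<open>k \<in> K\<close> and \<open>y\<close> in a F\<oslash>lner set \<open>A\<close>, depend only on the
  values of a potential at the points of \<open>A\<close> and \<open>K\<^sup>-\<^sup>1A\<close>.\<close>

lemma folner_restriction_dimension:
  assumes fin: "finite S" "finite K" and K: "K \<subseteq> carrier G"
    and P: "gop G S S P P"
    and pot: "\<And>v. \<exists>f. \<forall>w\<in>carrier F. \<forall>y\<in>carrier G.
      word_cocycle G x (fn (P v)) w y = f y - f (inv (\<phi> w) \<otimes> y)"
    and s: "\<And>k. k \<in> K \<Longrightarrow> s k \<in> carrier F" "\<And>k. k \<in> K \<Longrightarrow> \<phi> (s k) = k"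
    and folner: "\<And>e::real. e > 0 \<Longrightarrow> \<exists>A. finite A \<and> A \<noteq> {} \<and> A \<subseteq> carrier G \<and>
      card (A \<union> (\<Union>k\<in>K. (\<lambda>y. inv k \<otimes> y) ` A)) \<le> (1 + e) * real (card A)"
  obtains M :: "('a \<times> 'g) ell2 \<Rightarrow> ('a \<times> 'a) ell2" and Q
  where "bounded_linear M" "gop G S S Q Q" "kernel_proj M Q" "gtrace G S Q \<ge> real (card S) - 1"
    "\<And>v. M v = 0 \<longleftrightarrow> (\<forall>k\<in>K. \<forall>y\<in>carrier G. word_cocycle G x (fn (P v)) (s k) y = 0)"
proof -
  obtain B where B: "gop G S K (\<lambda>v. \<Sum>k\<in>K. word_op G x k (s k) v) B"
    and fnB: "\<And>v y k. fn (\<Sum>k\<in>K. word_op G x k (s k) v) (y, k) =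
      (if y \<in> carrier G \<and> k \<in> K then word_cocycle G x (fn v) (s k) y else 0)"
    using gop_word_op_sum[of K s] F_letters[OF s(1)] fin(2) by blast
  define M where "M v = (\<Sum>k\<in>K. word_op G x k (s k) (P v))" for v
  define M' where "M' v = P (B v)" for v
  have gM: "gop G S K M M'" unfolding M_def M'_def by (rule gop_comp[OF B P])
  note fnM = fnB[of "P _", folded M_def]
  have adj: "adjoint_pair M M'" using gM by (simp add: gop_def)
  obtain Q Q' where Q: "gop G S S Q Q" "kernel_proj M Q" and Q': "gop G K K Q' Q'" "kernel_proj M' Q'"
    and index: "card S - gtrace G S Q = card K - gtrace G K Q'"
    using index_formula[OF gM fin] by blast
  have lin: "linear Q'" using Q'(1) by (auto simp: gop_def gmap_def bounded_linear.linear)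
  have bound: "card S - gtrace G S Q \<le> 1 + e" if e: "e > 0" for e
  proof -
    obtain A where A: "finite A" "A \<noteq> {}" "A \<subseteq> carrier G"
      and small: "card (A \<union> (\<Union>k\<in>K. (\<lambda>y. inv k \<otimes> y) ` A)) \<le> (1 + e) * card A"
      using folner[OF e] by blast
    define Y where "Y = A \<union> (\<Union>k\<in>K. (\<lambda>y. inv k \<otimes> y) ` A)"
    have Y: "finite Y" using A(1) fin(2) by (simp add: Y_def)
    define \<theta> where "\<theta> z y k = ((if y = z then 1 else 0) - (if inv k \<otimes> y = z then 1 else 0) :: real)"
      for z y k
    \<comment> \<open>On the window, \<open>M v\<close> is the combination of the vectors
      \<open>b z\<close> with coefficients \<open>f z\<close>. A vector supported in the window and
      orthogonal to all of them is thus orthogonal to the range of \<open>M\<close>, that is, in the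
      kernel of \<open>M'\<close>.\<close>
    define b where "b z = ell2 (\<lambda>(y, k). if (y, k) \<in> A \<times> K then \<theta> z y k else 0)" for z
    have fnb: "fn (b z) (y, k) = (if (y, k) \<in> A \<times> K then \<theta> z y k else 0)" for z y k
    proof -
      have "{p. (case p of (y, k) \<Rightarrow> if (y, k) \<in> A \<times> K then \<theta> z y k else 0) \<noteq> 0} \<subseteq> A \<times> K"
        by (auto split: if_splits)
      then have "square_summable (\<lambda>(y, k). if (y, k) \<in> A \<times> K then \<theta> z y k else 0)"
        using A(1) fin(2) by (intro square_summable_finite) (meson finite_SigmaI finite_subset)
      then show ?thesis by (simp add: b_def fn_ell2)
    qed
    have "(\<Sum>z\<in>A \<times> K. inner (Q' (delta z)) (delta z)) \<ge> real (card (A \<times> K)) - real (card Y)"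
    proof (rule kernel_proj_rank_bound[OF Q'(2) lin _ Y, where b = b])
      show "finite (A \<times> K)" using A(1) fin(2) by simp
      fix \<eta> :: "('a \<times> 'a) ell2"
      assume supp: "\<And>z. z \<notin> A \<times> K \<Longrightarrow> fn \<eta> z = 0" and orth: "\<And>y. y \<in> Y \<Longrightarrow> inner \<eta> (b y) = 0"
      show "M' \<eta> = 0"
      proof (rule adjoint_eqI)
        fix v
        obtain f where f: "\<And>w y. w \<in> carrier F \<Longrightarrow> y \<in> carrier G \<Longrightarrow>
            word_cocycle G x (fn (P v)) w y = f y - f (inv (\<phi> w) \<otimes> y)"
          using pot by blast
        have val: "fn (M v) (y, k) = (\<Sum>z\<in>Y. f z * \<theta> z y k)" if "y \<in> A" "k \<in> K" for y k
        proof -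
          have yY: "y \<in> Y" "inv k \<otimes> y \<in> Y" using that by (auto simp: Y_def)
          have "(\<Sum>z\<in>Y. f z * \<theta> z y k) =
              (\<Sum>z\<in>Y. if y = z then f z else 0) - (\<Sum>z\<in>Y. if inv k \<otimes> y = z then f z else 0)"
            unfolding sum_subtractf[symmetric] by (intro sum.cong refl) (auto simp: \<theta>_def)
          also have "\<dots> = f y - f (inv k \<otimes> y)" using Y yY by simp
          finally show ?thesis using that A(3) f[OF s(1), of k y] s(2)[of k] by (auto simp: fnM)
        qed
        have "inner (M' \<eta>) v = inner \<eta> (M v)"
          by (rule adjoint_pairD[OF adjoint_pair_sym[OF adj]])
        also have "\<dots> = (\<Sum>p\<in>A \<times> K. fn \<eta> p * fn (M v) p)"
          by (rule inner_finite_support) (use A(1) fin(2) supp in auto)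
        also have "\<dots> = (\<Sum>p\<in>A \<times> K. \<Sum>z\<in>Y. f z * (fn \<eta> p * fn (b z) p))"
          by (intro sum.cong refl) (auto simp: val fnb sum_distrib_left mult_ac)
        also have "\<dots> = (\<Sum>z\<in>Y. \<Sum>p\<in>A \<times> K. f z * (fn \<eta> p * fn (b z) p))" by (rule sum.swap)
        also have "\<dots> = (\<Sum>z\<in>Y. f z * inner \<eta> (b z))"
          using A(1) fin(2) supp by (simp add: inner_finite_support[of "A \<times> K" \<eta>] sum_distrib_left)
        also have "\<dots> = 0" using orth by simp
        finally show "inner (M' \<eta>) v = inner 0 v" by simp
      qed
    qed
    also have "(\<Sum>z\<in>A \<times> K. inner (Q' (delta z)) (delta z)) =
        (\<Sum>y\<in>A. \<Sum>k\<in>K. inner (Q' (delta (y, k))) (delta (y, k)))"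
      by (simp add: sum.cartesian_product)
    also have "\<dots> = (\<Sum>y\<in>A. gtrace G K Q')"
      unfolding gtrace_def inner_delta
      by (intro sum.cong refl fn_gop_translate[OF Q'(1)]) (use A(3) in auto)
    \<comment> \<open>Dividing by \<open>card A\<close> turns the count of potential values into a
      bound per group element; the Folner condition makes it at most \<open>1 + e\<close>.\<close>
    finally have "real (card A) * (card K - gtrace G K Q') \<le> card Y"
      by (simp add: card_cartesian_product algebra_simps)
    also have "\<dots> \<le> (1 + e) * card A" using small by (simp add: Y_def)
    finally have "card K - gtrace G K Q' \<le> 1 + e"
      using A(1,2) by (simp add: mult.commute[of "1 + e"] mult_le_cancel_left_pos card_gt_0_iff)
    then show ?thesis using index by simp
  qed
  have "card S - gtrace G S Q \<le> 1" by (rule field_le_epsilon) (rule bound)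
  moreover have "M v = 0 \<longleftrightarrow> (\<forall>k\<in>K. \<forall>y\<in>carrier G. word_cocycle G x (fn (P v)) (s k) y = 0)" for v
  proof
    assume "M v = 0"
    then have "fn (M v) (y, k) = 0" for y k by simp
    then show "\<forall>k\<in>K. \<forall>y\<in>carrier G. word_cocycle G x (fn (P v)) (s k) y = 0"
      unfolding fnM by (metis (full_types))
  next
    assume *: "\<forall>k\<in>K. \<forall>y\<in>carrier G. word_cocycle G x (fn (P v)) (s k) y = 0"
    have "fn (M v) (y, k) = 0" for y k unfolding fnM using * by auto
    then show "M v = 0" by (intro ell2_eqI) auto
  qed
  moreover have "bounded_linear M" using gM by (simp add: gop_def gmap_def)
  ultimately show thesis using that[OF _ Q] by auto
qed


lemma countable_carrier:
  assumes "finite S" "presented_by G x S R"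
  shows "countable (carrier G)"
proof -
  have "carrier F \<subseteq> lists (S \<times> UNIV)" by (auto simp: free_group_def subset_iff image_iff Ball_def)
  moreover have "countable (lists (S \<times> (UNIV :: bool set)))"
    using assms(1) by (intro countable_lists countable_finite) simp
  ultimately have "countable (carrier F)" by (rule countable_subset)
  then show ?thesis using assms(2) by (metis countable_image presented_by_def)
qed

text \<open>The potential is constant on the cosets \<open>N y\<close>. Moving \<open>k\<close> in
  \<open>N\<close> past \<open>inv x i\<close> replaces it by a conjugate, which is again in
  \<open>N\<close>, so every component of \<open>v\<close> is also constant on these infinite cosets
  and must be zero.\<close>

lemma cocycle_vanishing_on_normal:
  assumes N: "N \<lhd> G" "infinite N" and v: "v \<in> hmod G S"
    and f: "\<And>w y. w \<in> carrier F \<Longrightarrow> y \<in> carrier G \<Longrightarrow>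
      word_cocycle G x (fn v) w y = f y - f (inv (\<phi> w) \<otimes> y)"
    and vanish: "\<And>k y. k \<in> N \<Longrightarrow> y \<in> carrier G \<Longrightarrow> f y = f (inv k \<otimes> y)"
  shows "v = 0"
proof (rule ell2_eqI)
  fix p :: "'a \<times> 'g"
  obtain y i where p: "p = (y, i)" by (cases p)
  have Nc: "k \<in> carrier G" if "k \<in> N" for k
    using that N(1) by (meson normal_imp_subgroup subgroup.mem_carrier)
  have "fn v (y, i) = 0" if y: "y \<in> carrier G" and i: "i \<in> S"
  proof (rule infinite_const_fn_eq_0)
    have xi: "x i \<in> carrier G" using i by (rule x_closed)
    have gen: "fn v (z, i) = f z - f (inv x i \<otimes> z)" if "z \<in> carrier G" for z
    proof -
      have "[(i, True)] \<in> carrier F" using i by (simp add: free_group_def Defs.reduced_def)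
      moreover have "\<phi> [(i, True)] = x i" using xi by (rule free_lift_generator[OF is_group])
      ultimately show ?thesis using f[of "[(i, True)]" z] that by simp
    qed
    have inj: "inj_on (\<lambda>k. (k \<otimes> y, i)) N" using y Nc by (auto simp: inj_on_def)
    then show "infinite ((\<lambda>k. (k \<otimes> y, i)) ` N)" using N(2) by (simp add: finite_image_iff)
    fix q assume "q \<in> (\<lambda>k. (k \<otimes> y, i)) ` N"
    then obtain k where k: "k \<in> N" "q = (k \<otimes> y, i)" by auto
    have kc: "k \<in> carrier G" using Nc k(1) by simp
    define l where "l = inv x i \<otimes> k \<otimes> x i"
    have l: "l \<in> N" using normal.inv_op_closed1[OF N(1) xi k(1)] by (simp add: l_def)
    have lc: "l \<in> carrier G" using Nc l by simp
    have "f (k \<otimes> y) = f (inv k \<otimes> (k \<otimes> y))" using kc y k(1) by (intro vanish) auto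
    also have "inv k \<otimes> (k \<otimes> y) = y" using kc y by (simp add: m_assoc[symmetric])
    finally have 1: "f (k \<otimes> y) = f y" .
    have "inv x i \<otimes> (k \<otimes> y) = l \<otimes> (inv x i \<otimes> y)"
      using kc y xi inv_solve_left by (simp add: l_def m_assoc) (simp add: m_assoc[symmetric])
    moreover have "f (l \<otimes> (inv x i \<otimes> y)) = f (inv l \<otimes> (l \<otimes> (inv x i \<otimes> y)))"
      using lc y xi l by (intro vanish) auto
    moreover have "inv l \<otimes> (l \<otimes> (inv x i \<otimes> y)) = inv x i \<otimes> y"
      using lc y xi by (simp add: m_assoc[symmetric])
    ultimately have 2: "f (inv x i \<otimes> (k \<otimes> y)) = f (inv x i \<otimes> y)" by simp
    show "fn v q = fn v (y, i)" using k(2) kc y by (simp add: gen 1 2)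
  qed
  then show "fn v p = fn 0 p" using v by (auto simp: p hmod_def)
qed

text \<open>For each finite \<open>K n\<close> the vectors \<open>v\<close> for which
  \<open>P v\<close> vanishes on \<open>K n\<close> have dimension at least
  \<open>card S - 1\<close>. Their projections decrease to vectors \<open>v\<close> for which
  \<open>P v\<close> vanishes on all of \<open>N\<close>, hence \<open>P v = 0\<close>. Comparing
  diagonal entries in the limit leaves dimension at most 1 for the range of
  \<open>P\<close>.\<close>

theorem folner_normal_dimension:
  assumes fin: "finite S" and pres: "presented_by G x S R"
    and P: "gop G S S P P" "kernel_proj \<Phi> P"
    and pot: "\<And>v. \<exists>f. \<forall>w\<in>carrier F. \<forall>y\<in>carrier G.
      word_cocycle G x (fn (P v)) w y = f y - f (inv (\<phi> w) \<otimes> y)"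
    and N: "N \<lhd> G" "infinite N"
    and folner: "\<And>K e. finite K \<Longrightarrow> K \<subseteq> N \<Longrightarrow> (e::real) > 0 \<Longrightarrow> \<exists>A. finite A \<and> A \<noteq> {} \<and> A \<subseteq> N \<and>
      card (A \<union> (\<Union>k\<in>K. (\<lambda>y. inv k \<otimes> y) ` A)) \<le> (1 + e) * real (card A)"
  shows "gtrace G S P \<le> 1"
proof -
  have Nc: "N \<subseteq> carrier G" using N(1) by (meson normal_imp_subgroup subgroup.subset)
  have surj: "\<phi> ` carrier F = carrier G" using pres by (simp add: presented_by_def)
  have "\<forall>y\<in>carrier G. \<exists>w. w \<in> carrier F \<and> \<phi> w = y" using surj by (metis imageE)
  then obtain s where s: "\<And>y. y \<in> carrier G \<Longrightarrow> s y \<in> carrier F" "\<And>y. y \<in> carrier G \<Longrightarrow> \<phi> (s y) = y"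
    by metis
  have cN: "countable N" by (rule countable_subset[OF Nc countable_carrier[OF fin pres]])
  \<comment> \<open>Countability of \<open>N\<close> yields an exhaustion by a sequence of finite
    sets, so sequential limits are enough.\<close>
  define K where "K n = from_nat_into N ` {..(n::nat)}" for n
  have K: "finite (K n)" "K n \<subseteq> N" for n
    using N(2) from_nat_into[of N] by (auto simp: K_def)
  have UK: "\<exists>n. k \<in> K n" if "k \<in> N" for k
    using from_nat_into_to_nat_on[OF cN that] unfolding K_def by (metis atMost_iff image_eqI order_refl)
  have Kmono: "K n \<subseteq> K m" if "n \<le> m" for n m using that by (auto simp: K_def)
  define vanish where "vanish n v \<longleftrightarrow>
    (\<forall>k\<in>K n. \<forall>y\<in>carrier G. word_cocycle G x (fn (P v)) (s k) y = 0)" for n v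
  have "\<exists>(M :: ('a \<times> 'g) ell2 \<Rightarrow> ('a \<times> 'a) ell2) Q. bounded_linear M \<and> gop G S S Q Q \<and> kernel_proj M Q \<and>
      gtrace G S Q \<ge> real (card S) - 1 \<and> (\<forall>v. M v = 0 \<longleftrightarrow> vanish n v)" for n
  proof -
    have sK: "s k \<in> carrier F" "\<phi> (s k) = k" if "k \<in> K n" for k
      using s K(2)[of n] Nc that by auto
    have fol: "\<exists>A. finite A \<and> A \<noteq> {} \<and> A \<subseteq> carrier G \<and>
        card (A \<union> (\<Union>k\<in>K n. (\<lambda>y. inv k \<otimes> y) ` A)) \<le> (1 + e) * real (card A)" if "e > 0" for e :: real
      using folner[OF K that, of n] Nc by blast
    obtain M :: "('a \<times> 'g) ell2 \<Rightarrow> ('a \<times> 'a) ell2" and Q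
      where "bounded_linear M" "gop G S S Q Q" "kernel_proj M Q" "gtrace G S Q \<ge> real (card S) - 1"
        "\<And>v. M v = 0 \<longleftrightarrow> (\<forall>k\<in>K n. \<forall>y\<in>carrier G. word_cocycle G x (fn (P v)) (s k) y = 0)"
      by (rule folner_restriction_dimension[OF fin K(1) subset_trans[OF K(2) Nc] P(1) pot sK fol]) blast+
    then show ?thesis unfolding vanish_def by (intro exI[of _ M] exI[of _ Q]) auto
  qed
  then obtain M :: "nat \<Rightarrow> ('a \<times> 'g) ell2 \<Rightarrow> ('a \<times> 'a) ell2" and Q
    where M: "\<And>n. bounded_linear (M n)" and Q: "\<And>n. gop G S S (Q n) (Q n)" "\<And>n. kernel_proj (M n) (Q n)"
      and trQ: "\<And>n. gtrace G S (Q n) \<ge> real (card S) - 1" and Mvan: "\<And>n v. M n v = 0 \<longleftrightarrow> vanish n v"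
    by metis
  have nested: "Q n (Q m v) = Q m v" if "n \<le> m" for n m v
  proof -
    have "vanish m (Q m v)" using Mvan kernel_projD(2)[OF Q(2)[of m]] by simp
    then have "vanish n (Q m v)" using Kmono[OF that] by (auto simp: vanish_def)
    then show ?thesis using Mvan kernel_projD(3)[OF Q(2)[of n]] by simp
  qed
  have adjP: "adjoint_pair P P" using P(1) by (simp add: gop_def)
  have lim: "\<exists>L. (\<lambda>n. inner (Q n (delta (\<one>, a))) (delta (\<one>, a))) \<longlonglongrightarrow> L \<and>
      L \<le> 1 - inner (P (delta (\<one>, a))) (delta (\<one>, a))" if a: "a \<in> S" for a
  proof -
    let ?e = "delta (\<one>, a)"
    define t where "t n = Q n ?e" for n
    define b where "b n = (norm (t n))\<^sup>2" for n
    have bin: "b n = inner (t n) ?e" for n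
      using inner_kernel_proj[OF Q(2)[of n], of ?e] by (simp add: b_def t_def)
    \<comment> \<open>For nested projections this makes the squared distance of two iterates the
      difference of their squared norms, which forces convergence.\<close>
    have ip: "inner (t n) (t m) = b m" if "n \<le> m" for n m
    proof -
      have "inner (t n) (t m) = inner ?e (Q n (Q m ?e))"
        unfolding t_def by (rule adjoint_pairD[OF kernel_projD(1)[OF Q(2)[of n]]])
      then show ?thesis by (simp add: nested[OF that] bin t_def inner_commute)
    qed
    have dist2: "(dist (t n) (t m))\<^sup>2 = b n - b m" if "n \<le> m" for n m
      using ip[OF that] by (simp add: dist_norm power2_norm_eq_inner inner_diff_left inner_diff_right b_def inner_commute)
    have "decseq b"
      using dist2 unfolding decseq_def by (metis diff_ge_0_iff_ge zero_le_power2)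
    then obtain L where L: "b \<longlonglongrightarrow> L" using decseq_convergent[of b 0] by (auto simp: b_def)
    have "Cauchy t"
    proof (rule metric_CauchyI)
      fix e :: real assume e: "e > 0"
      then have "e\<^sup>2 / 2 > 0" by simp
      then obtain n0 where n0: "\<And>n. n \<ge> n0 \<Longrightarrow> \<bar>b n - L\<bar> < e\<^sup>2 / 2"
        using L unfolding LIMSEQ_iff by (metis real_norm_def)
      have le: "dist (t n) (t m) < e" if "n0 \<le> n" "n \<le> m" for n m
      proof -
        have "(dist (t n) (t m))\<^sup>2 < e\<^sup>2"
          using n0[of n] n0[of m] that dist2[OF that(2)] by (simp add: abs_if split: if_splits)
        then show ?thesis using e by (meson less_imp_le power_less_imp_less_base)
      qed
      show "\<exists>n0. \<forall>m\<ge>n0. \<forall>n\<ge>n0. dist (t m) (t n) < e"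
        using le by (metis dist_commute nle_le)
    qed
    then obtain v where v: "t \<longlonglongrightarrow> v" by (auto simp: Cauchy_convergent_iff convergent_def)
    \<comment> \<open>From index \<open>n\<close> on, the sequence \<open>t\<close> stays in the
      kernel of \<open>M n\<close>, which is closed.\<close>
    have "M n v = 0" for n
    proof -
      have "(\<lambda>m. M n (t (m + n))) \<longlonglongrightarrow> M n v"
        by (intro bounded_linear.tendsto[OF M] LIMSEQ_ignore_initial_segment v)
      moreover have "M n (t (m + n)) = 0" for m
      proof -
        have "t (m + n) = Q n (t (m + n))" by (simp add: t_def nested)
        then show ?thesis by (metis kernel_projD(2)[OF Q(2)[of n]])
      qed
      ultimately show ?thesis by (simp add: LIMSEQ_const_iff)
    qed
    then have van: "vanish n v" for n using Mvan by simp
    have tm: "t n \<in> hmod G S" for n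
      using Q(1)[of n] delta_in_hmod[OF a] by (auto simp: gop_def gmap_def t_def)
    then have "v \<in> hmod G S" using v by (rule hmod_closed)
    then have Pv: "P v \<in> hmod G S" using P(1) by (auto simp: gop_def gmap_def)
    obtain f where f: "\<And>w y. w \<in> carrier F \<Longrightarrow> y \<in> carrier G \<Longrightarrow>
        word_cocycle G x (fn (P v)) w y = f y - f (inv (\<phi> w) \<otimes> y)"
      using pot by blast
    have "P v = 0"
    proof (rule cocycle_vanishing_on_normal[OF N Pv f])
      fix k y assume k: "k \<in> N" and y: "y \<in> carrier G"
      then obtain n where "k \<in> K n" using UK by blast
      then have "word_cocycle G x (fn (P v)) (s k) y = 0" using van[of n] y by (simp add: vanish_def)
      then show "f y = f (inv k \<otimes> y)" using f[OF s(1) y, of k] s(2)[of k] k Nc by auto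
    qed
    \<comment> \<open>The limit \<open>v\<close> is orthogonal to the range of \<open>P\<close>, so
      its squared norm, which equals its pairing with the basis vector, is controlled by the part of
      that vector outside the range.\<close>
    then have "inner v ?e = inner v (?e - P ?e)"
      using adjoint_pairD[OF adjP, of v ?e] by (simp add: inner_diff_right)
    moreover have "(\<lambda>n. inner (t n) ?e) \<longlonglongrightarrow> inner v ?e" by (intro tendsto_intros v)
    then have "L = inner v ?e" using L unfolding bin[abs_def] by (rule LIMSEQ_unique[rotated])
    moreover have "b \<longlonglongrightarrow> (norm v)\<^sup>2" unfolding b_def by (intro tendsto_intros v)
    then have "L = (norm v)\<^sup>2" using L by (rule LIMSEQ_unique[rotated])
    ultimately have "(norm v)\<^sup>2 \<le> norm v * norm (?e - P ?e)"
      using norm_cauchy_schwarz[of v "?e - P ?e"] by simp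
    then have "norm v \<le> norm (?e - P ?e)"
      by (cases "norm v = 0") (auto simp: power2_eq_square)
    then have "L \<le> (norm (?e - P ?e))\<^sup>2" unfolding \<open>L = (norm v)\<^sup>2\<close> by (intro power_mono) auto
    then have "L \<le> 1 - inner (P ?e) ?e" by (simp add: norm2_diff_kernel_proj[OF P(2)])
    then show ?thesis using L unfolding bin[abs_def] t_def by blast
  qed
  then obtain L where L: "\<And>a. a \<in> S \<Longrightarrow> (\<lambda>n. inner (Q n (delta (\<one>, a))) (delta (\<one>, a))) \<longlonglongrightarrow> L a"
    "\<And>a. a \<in> S \<Longrightarrow> L a \<le> 1 - inner (P (delta (\<one>, a))) (delta (\<one>, a))" by metis
  have "(\<lambda>n. gtrace G S (Q n)) \<longlonglongrightarrow> (\<Sum>a\<in>S. L a)"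
    unfolding gtrace_def by (intro tendsto_sum L)
  then have "real (card S) - 1 \<le> (\<Sum>a\<in>S. L a)"
    by (rule tendsto_lowerbound) (auto simp: trQ)
  also have "\<dots> \<le> (\<Sum>a\<in>S. 1 - inner (P (delta (\<one>, a))) (delta (\<one>, a)))" by (rule sum_mono) (rule L(2))
  also have "\<dots> = card S - gtrace G S P" by (simp add: gtrace_def sum_subtractf)
  finally show ?thesis by linarith
qed

end


section \<open>F\<oslash>lner sets in amenable groups\<close>

text \<open>Rado's proof of Hall's theorem: a minimal subrelation with Hall's property is a function.\<close>

definition hall_relation :: "'i set \<Rightarrow> ('i \<times> 'y) set \<Rightarrow> bool" where
  "hall_relation I R \<longleftrightarrow> (\<forall>J. finite J \<longrightarrow> J \<subseteq> I \<longrightarrow> card J \<le> card (R `` J))"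

text \<open>Zorn's lemma is applied to the sets of deleted pairs. A union of a chain is admissible
  because only finitely many pairs matter for a finite \<open>J\<close>, and one member of the chain
  already contains those of them that are deleted.\<close>

lemma hall_relation_minimal:
  assumes fin: "\<And>i. i \<in> I \<Longrightarrow> finite (A i)" and hall: "hall_relation I (Sigma I A)"
  obtains R where "R \<subseteq> Sigma I A" "hall_relation I R"
    "\<And>R'. R' \<subseteq> R \<Longrightarrow> hall_relation I R' \<Longrightarrow> R' = R"
proof -
  let ?D = "Sigma I A"
  define \<C> where "\<C> = {E. E \<subseteq> ?D \<and> hall_relation I (?D - E)}"
  have "\<exists>M\<in>\<C>. \<forall>E\<in>\<C>. M \<subseteq> E \<longrightarrow> E = M"
  proof (rule subset_Zorn_nonempty)
    show "\<C> \<noteq> {}" using hall by (auto simp: \<C>_def intro!: exI[of _ "{}"])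
    fix C assume C: "C \<noteq> {}" "subset.chain \<C> C"
    then have sub: "C \<subseteq> \<C>" by (simp add: subset.chain_def)
    have "card J \<le> card ((?D - \<Union>C) `` J)" if J: "finite J" "J \<subseteq> I" for J
    proof -
      have "finite (Sigma J A \<inter> \<Union>C)" using J fin by (intro finite_Int disjI1 finite_SigmaI) auto
      then obtain E where E: "E \<in> C" "Sigma J A \<inter> \<Union>C \<subseteq> E"
        by (rule finite_subset_Union_chain[OF _ _ C]) auto
      have "(?D - \<Union>C) `` J = (?D - E) `` J" using E J by auto
      then show ?thesis using E(1) sub J by (auto simp: \<C>_def hall_relation_def)
    qed
    then show "\<Union>C \<in> \<C>" using sub by (auto simp: \<C>_def hall_relation_def)
  qed
  then obtain M where M: "M \<in> \<C>" "\<And>E. E \<in> \<C> \<Longrightarrow> M \<subseteq> E \<Longrightarrow> E = M" by blast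
  show thesis
  proof (rule that[of "?D - M"])
    show "hall_relation I (?D - M)" using M(1) by (simp add: \<C>_def)
    fix R' assume R': "R' \<subseteq> ?D - M" "hall_relation I R'"
    have "?D - (?D - R') = R'" using R'(1) by auto
    then have "?D - R' \<in> \<C>" using R'(2) by (auto simp: \<C>_def)
    moreover have "M \<subseteq> ?D - R'" using M(1) R'(1) by (auto simp: \<C>_def)
    ultimately have "?D - R' = M" by (rule M(2))
    then show "R' = ?D - M" using R'(1) by auto
  qed auto
qed

text \<open>If \<open>i\<close> had two values in a minimal relation, deleting either pair would
  break Hall's condition at a finite set containing \<open>i\<close>. Removing \<open>i\<close> from
  these sets gives \<open>K\<close> and \<open>L\<close>, and a count of unions and intersections
  excludes this.\<close>

theorem hall_infinite:
  assumes fin: "\<And>i. i \<in> I \<Longrightarrow> finite (A i)"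
    and hall: "\<And>J. finite J \<Longrightarrow> J \<subseteq> I \<Longrightarrow> card J \<le> card (\<Union>i\<in>J. A i)"
  obtains \<sigma> where "inj_on \<sigma> I" "\<And>i. i \<in> I \<Longrightarrow> \<sigma> i \<in> A i"
proof -
  have "Sigma I A `` J = (\<Union>i\<in>J. A i)" if "J \<subseteq> I" for J using that by auto
  then have "hall_relation I (Sigma I A)" using hall by (auto simp: hall_relation_def)
  from fin this obtain R where R: "R \<subseteq> Sigma I A" "hall_relation I R"
    and minimal: "\<And>R'. R' \<subseteq> R \<Longrightarrow> hall_relation I R' \<Longrightarrow> R' = R"
    by (rule hall_relation_minimal) blast+
  have card: "card J \<le> card (R `` J)" if "finite J" "J \<subseteq> I" for J
    using R(2) that by (simp add: hall_relation_def)
  have finR: "finite (R `` J)" if J: "finite J" "J \<subseteq> I" for J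
  proof (rule finite_subset)
    show "R `` J \<subseteq> (\<Union>i\<in>J. A i)" using R(1) by auto
    show "finite (\<Union>i\<in>J. A i)" using J fin by auto
  qed
  have tight: "\<exists>K. finite K \<and> K \<subseteq> I \<and> i \<notin> K \<and> card (R `` K \<union> (R `` {i} - {a})) \<le> card K"
    if i: "i \<in> I" and a: "(i, a) \<in> R" for i a
  proof -
    have "\<not> hall_relation I (R - {(i, a)})" using minimal[of "R - {(i, a)}"] a by auto
    then obtain J where J: "finite J" "J \<subseteq> I" "card ((R - {(i, a)}) `` J) < card J"
      by (auto simp: hall_relation_def not_le)
    have iJ: "i \<in> J"
    proof (rule ccontr)
      assume "i \<notin> J"
      then have "(R - {(i, a)}) `` J = R `` J" by auto
      then show False using J card[OF J(1,2)] by simp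
    qed
    have "(R - {(i, a)}) `` J \<supseteq> R `` (J - {i}) \<union> (R `` {i} - {a})" using iJ by auto
    moreover have "finite ((R - {(i, a)}) `` J)" by (rule finite_subset[OF _ finR[OF J(1,2)]]) auto
    ultimately have "card (R `` (J - {i}) \<union> (R `` {i} - {a})) \<le> card ((R - {(i, a)}) `` J)"
      by (intro card_mono)
    also have "\<dots> \<le> card (J - {i})" using J iJ by simp
    finally show ?thesis using J by (intro exI[of _ "J - {i}"]) auto
  qed
  have single: "\<exists>!y. (i, y) \<in> R" if i: "i \<in> I" for i
  proof -
    have "R `` {i} \<noteq> {}"
    proof
      assume "R `` {i} = {}"
      then show False using card[of "{i}"] i by simp
    qed
    moreover have "a = b" if a: "(i, a) \<in> R" and b: "(i, b) \<in> R" for a b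
    proof (rule ccontr)
      assume ab: "a \<noteq> b"
      obtain K where K: "finite K" "K \<subseteq> I" "i \<notin> K" "card (R `` K \<union> (R `` {i} - {a})) \<le> card K"
        using tight[OF i a] by blast
      obtain L where L: "finite L" "L \<subseteq> I" "i \<notin> L" "card (R `` L \<union> (R `` {i} - {b})) \<le> card L"
        using tight[OF i b] by blast
      let ?X = "R `` K \<union> (R `` {i} - {a})" and ?Y = "R `` L \<union> (R `` {i} - {b})"
      have f: "finite ?X" "finite ?Y" using finR K L finR[of "{i}"] i by auto
      have "card (insert i (K \<union> L)) \<le> card (R `` insert i (K \<union> L))"
        by (rule card) (use K L i in auto)
      also have "\<dots> \<le> card (?X \<union> ?Y)" by (rule card_mono) (use f ab in auto)
      finally have "Suc (card (K \<union> L)) \<le> card (?X \<union> ?Y)" using K L by simp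
      moreover have "card (K \<inter> L) \<le> card (?X \<inter> ?Y)"
      proof -
        have "card (K \<inter> L) \<le> card (R `` (K \<inter> L))" by (rule card) (use K in auto)
        also have "\<dots> \<le> card (?X \<inter> ?Y)" by (rule card_mono) (use f in auto)
        finally show ?thesis .
      qed
      moreover have "card ?X + card ?Y = card (?X \<union> ?Y) + card (?X \<inter> ?Y)" using f by (rule card_Un_Int)
      moreover have "card K + card L = card (K \<union> L) + card (K \<inter> L)" using K(1) L(1) by (rule card_Un_Int)
      \<comment> \<open>The sum of \<open>card K\<close> and \<open>card L\<close> is at least that
        of \<open>card ?X\<close> and \<open>card ?Y\<close>. By the bounds for union and
        intersection the latter exceeds \<open>card (K \<union> L) + card (K \<inter> L)\<close> by
        at least 1, a contradiction.\<close>
      ultimately show False using K(4) L(4) by linarith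
    qed
    ultimately show ?thesis by blast
  qed
  define \<sigma> where "\<sigma> i = (THE y. (i, y) \<in> R)" for i
  have \<sigma>: "(i, \<sigma> i) \<in> R" if "i \<in> I" for i unfolding \<sigma>_def by (rule theI'[OF single[OF that]])
  show thesis
  proof
    show "\<sigma> i \<in> A i" if "i \<in> I" for i using \<sigma>[OF that] R(1) by auto
    show "inj_on \<sigma> I"
    proof (rule inj_onI, rule ccontr)
      fix i j assume ij: "i \<in> I" "j \<in> I" "\<sigma> i = \<sigma> j" "i \<noteq> j"
      have "R `` {i, j} \<subseteq> {\<sigma> i}" using \<sigma> single ij by auto
      then have "card (R `` {i, j}) \<le> 1" using card_mono[of "{\<sigma> i}" "R `` {i, j}"] by simp
      moreover have "card {i, j} = 2" using ij(4) by simp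
      ultimately show False using card[of "{i, j}"] ij by simp
    qed
  qed
qed

lemma finitely_additive_sum:
  fixes \<mu> :: "'a set \<Rightarrow> real"
  assumes add: "\<And>A B. A \<subseteq> \<Omega> \<Longrightarrow> B \<subseteq> \<Omega> \<Longrightarrow> A \<inter> B = {} \<Longrightarrow> \<mu> (A \<union> B) = \<mu> A + \<mu> B"
    and I: "finite I" and X: "\<And>i. i \<in> I \<Longrightarrow> X i \<subseteq> \<Omega>"
    and disj: "\<And>i j. i \<in> I \<Longrightarrow> j \<in> I \<Longrightarrow> i \<noteq> j \<Longrightarrow> X i \<inter> X j = {}"
  shows "\<mu> (\<Union>i\<in>I. X i) = (\<Sum>i\<in>I. \<mu> (X i))"
  using I X disj
proof (induction I)
  case empty
  then show ?case using add[of "{}" "{}"] by simp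
next
  case (insert i I)
  have "\<mu> (X i \<union> (\<Union>j\<in>I. X j)) = \<mu> (X i) + \<mu> (\<Union>j\<in>I. X j)"
    using insert.prems insert.hyps by (intro add) blast+
  then show ?case using insert by simp
qed

section \<open>From paradoxical decompositions to Folner sets\<close>

context group
begin

definition thicken :: "'a set \<Rightarrow> 'a set \<Rightarrow> 'a set" where
  "thicken W A = (\<Union>w\<in>W. (\<lambda>y. w \<otimes> y) ` A)"

lemma finite_thicken: "finite W \<Longrightarrow> finite A \<Longrightarrow> finite (thicken W A)"
  by (simp add: thicken_def)

lemma thicken_closed: "W \<subseteq> carrier G \<Longrightarrow> A \<subseteq> carrier G \<Longrightarrow> thicken W A \<subseteq> carrier G"
  by (auto simp: thicken_def)

lemma thicken_thicken:
  assumes "V \<subseteq> carrier G" "W \<subseteq> carrier G" "A \<subseteq> carrier G"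
  shows "thicken V (thicken W A) = thicken (thicken V W) A"
proof -
  have "(\<lambda>y. v \<otimes> y) ` (\<lambda>y. w \<otimes> y) ` A = (\<lambda>y. v \<otimes> w \<otimes> y) ` A" if "v \<in> V" "w \<in> W" for v w
    unfolding image_image using that assms by (intro image_cong refl) (auto simp: m_assoc subset_iff)
  then have "thicken V (thicken W A) = (\<Union>v\<in>V. \<Union>w\<in>W. (\<lambda>y. v \<otimes> w \<otimes> y) ` A)"
    by (simp add: thicken_def image_UN)
  also have "\<dots> = thicken (thicken V W) A" by (auto simp: thicken_def)
  finally show ?thesis .
qed

text \<open>Doubling is Hall's condition for two copies of the group, with \<open>(y, b)\<close>
  matched to points of \<open>W y\<close>. The matching is a paradoxical decomposition: finitely
  many disjoint translates of pieces would have total mean 2.\<close>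

lemma amenable_not_doubling:
  assumes am: "amenable_group G" and W: "finite W" "W \<subseteq> carrier G"
    and doubling: "\<And>A. finite A \<Longrightarrow> A \<subseteq> carrier G \<Longrightarrow> 2 * card A \<le> card (thicken W A)"
  shows False
proof -
  obtain \<mu> :: "'a set \<Rightarrow> real" where "(\<forall>A. A \<subseteq> carrier G \<longrightarrow> 0 \<le> \<mu> A) \<and> \<mu> (carrier G) = 1 \<and>
      (\<forall>A B. A \<subseteq> carrier G \<longrightarrow> B \<subseteq> carrier G \<longrightarrow> A \<inter> B = {} \<longrightarrow> \<mu> (A \<union> B) = \<mu> A + \<mu> B) \<and>
      (\<forall>g\<in>carrier G. \<forall>A. A \<subseteq> carrier G \<longrightarrow> \<mu> (g <# A) = \<mu> A)"
    using am unfolding amenable_group_def by (rule exE)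
  then have nonneg: "\<And>A. A \<subseteq> carrier G \<Longrightarrow> 0 \<le> \<mu> A" and one: "\<mu> (carrier G) = 1"
    and add: "\<And>A B. A \<subseteq> carrier G \<Longrightarrow> B \<subseteq> carrier G \<Longrightarrow> A \<inter> B = {} \<Longrightarrow> \<mu> (A \<union> B) = \<mu> A + \<mu> B"
    and inv: "\<And>g A. g \<in> carrier G \<Longrightarrow> A \<subseteq> carrier G \<Longrightarrow> \<mu> (g <# A) = \<mu> A"
    by simp_all
  let ?I = "carrier G \<times> (UNIV :: bool set)"
  obtain \<sigma> where \<sigma>: "inj_on \<sigma> ?I" "\<And>p. p \<in> ?I \<Longrightarrow> \<sigma> p \<in> (\<lambda>w. w \<otimes> fst p) ` W"
  proof (rule hall_infinite[of ?I "\<lambda>p. (\<lambda>w. w \<otimes> fst p) ` W"])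
    show "finite ((\<lambda>w. w \<otimes> fst p) ` W)" for p :: "'a \<times> bool" using W(1) by simp
    show "card J \<le> card (\<Union>p\<in>J. (\<lambda>w. w \<otimes> fst p) ` W)" if J: "finite J" "J \<subseteq> ?I" for J
    proof -
      have "J \<subseteq> fst ` J \<times> UNIV" by force
      then have "card J \<le> card (fst ` J \<times> (UNIV :: bool set))" using J(1) by (intro card_mono) auto
      also have "\<dots> = 2 * card (fst ` J)" by (simp add: card_cartesian_product)
      also have "\<dots> \<le> card (thicken W (fst ` J))" using J by (intro doubling) auto
      also have "thicken W (fst ` J) = (\<Union>p\<in>J. (\<lambda>w. w \<otimes> fst p) ` W)" by (auto simp: thicken_def)
      finally show ?thesis .
    qed
  qed blast
  then have "\<forall>p\<in>?I. \<exists>w. w \<in> W \<and> \<sigma> p = w \<otimes> fst p" by blast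
  then obtain \<tau> where \<tau>: "\<And>p. p \<in> ?I \<Longrightarrow> \<tau> p \<in> W" "\<And>p. p \<in> ?I \<Longrightarrow> \<sigma> p = \<tau> p \<otimes> fst p" by metis
  \<comment> \<open>For each copy \<open>b\<close> the group is cut according to the element of
    \<open>W\<close> that the matching uses; on such a piece the matching is a left
    translation.\<close>
  define X where "X w b = {y \<in> carrier G. \<tau> (y, b) = w}" for w b
  define Z where "Z q = fst q <# X (fst q) (snd q)" for q
  have Xc: "X w b \<subseteq> carrier G" for w b by (auto simp: X_def)
  have Zc: "Z q \<subseteq> carrier G" if "q \<in> W \<times> UNIV" for q
    using that W(2) Xc by (auto simp: Z_def l_coset_def X_def)
  have Z\<sigma>: "\<exists>y\<in>carrier G. z = \<sigma> (y, snd q) \<and> \<tau> (y, snd q) = fst q" if z: "z \<in> Z q" for z q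
  proof -
    obtain y where "y \<in> carrier G" "\<tau> (y, snd q) = fst q" "z = fst q \<otimes> y"
      using z by (auto simp: Z_def X_def l_coset_def)
    then show ?thesis using \<tau>(2)[of "(y, snd q)"] by (intro bexI[of _ y]) auto
  qed
  have disjZ: "Z p \<inter> Z q = {}" if "p \<noteq> q" for p q
  proof (rule ccontr)
    assume "Z p \<inter> Z q \<noteq> {}"
    then obtain z where "z \<in> Z p" "z \<in> Z q" by blast
    then obtain y y' where y: "y \<in> carrier G" "z = \<sigma> (y, snd p)" "\<tau> (y, snd p) = fst p"
      and y': "y' \<in> carrier G" "z = \<sigma> (y', snd q)" "\<tau> (y', snd q) = fst q" using Z\<sigma> by metis
    then have "(y, snd p) = (y', snd q)" using \<sigma>(1) by (auto dest: inj_onD)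
    then have "p = q" using y y' by (simp add: prod_eq_iff)
    then show False using that by simp
  qed
  have sum1: "(\<Sum>w\<in>W. \<mu> (X w b)) = 1" for b
  proof -
    have "(\<Union>w\<in>W. X w b) = carrier G" using \<tau>(1) by (auto simp: X_def)
    moreover have "\<mu> (\<Union>w\<in>W. X w b) = (\<Sum>w\<in>W. \<mu> (X w b))"
      by (rule finitely_additive_sum[OF add W(1) Xc]) (auto simp: X_def)
    ultimately show ?thesis using one by simp
  qed
  let ?U = "\<Union>q\<in>W \<times> UNIV. Z q"
  have Uc: "?U \<subseteq> carrier G" using Zc by blast
  have "\<mu> ?U = (\<Sum>q\<in>W \<times> UNIV. \<mu> (Z q))"
    by (rule finitely_additive_sum[OF add _ Zc disjZ]) (use W(1) in auto)
  also have "\<dots> = (\<Sum>q\<in>W \<times> (UNIV :: bool set). \<mu> (X (fst q) (snd q)))"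
    unfolding Z_def using W(2) Xc by (intro sum.cong refl inv) auto
  also have "\<dots> = (\<Sum>b\<in>(UNIV :: bool set). \<Sum>w\<in>W. \<mu> (X w b))"
    by (subst sum.swap) (simp add: sum.cartesian_product case_prod_beta)
  also have "\<dots> = 2" by (simp add: sum1)
  finally have "\<mu> ?U = 2" .
  moreover have "\<mu> (?U \<union> (carrier G - ?U)) = \<mu> ?U + \<mu> (carrier G - ?U)" using Uc by (intro add) auto
  moreover have "?U \<union> (carrier G - ?U) = carrier G" using Uc by blast
  ultimately show False using one nonneg[of "carrier G - ?U"] by simp
qed

text \<open>Without such a set every finite set grows by the factor \<open>1 + e\<close> under
  \<open>insert \<one> K\<close>. Repeated products of this set then give growth by any power of
  \<open>1 + e\<close>, in particular doubling.\<close>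

theorem amenable_folner:
  assumes am: "amenable_group G" and K: "finite K" "K \<subseteq> carrier G" and e: "(e::real) > 0"
  shows "\<exists>A. finite A \<and> A \<noteq> {} \<and> A \<subseteq> carrier G \<and>
    card (A \<union> (\<Union>k\<in>K. (\<lambda>y. k \<otimes> y) ` A)) \<le> (1 + e) * real (card A)" (is "\<exists>A. ?P A")
proof (rule ccontr)
  assume contra: "\<nexists>A. ?P A"
  let ?L = "insert \<one> K"
  have L: "finite ?L" "?L \<subseteq> carrier G" using K by auto
  have tL: "thicken ?L A = A \<union> (\<Union>k\<in>K. (\<lambda>y. k \<otimes> y) ` A)" if "A \<subseteq> carrier G" for A
  proof -
    have "(\<lambda>y. \<one> \<otimes> y) ` A = A" using that by (force simp: subset_iff image_iff)
    then show ?thesis by (simp add: thicken_def)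
  qed
  have grow: "(1 + e) * card A \<le> card (thicken ?L A)" if A: "finite A" "A \<subseteq> carrier G" for A
  proof (cases "A = {}")
    case False
    then show ?thesis using contra A tL[OF A(2)] by (metis less_imp_le not_le)
  qed simp
  have iterate: "\<exists>W. finite W \<and> W \<subseteq> carrier G \<and>
      (\<forall>A. finite A \<longrightarrow> A \<subseteq> carrier G \<longrightarrow> (1 + e) ^ n * card A \<le> card (thicken W A))" for n
  proof (induction n)
    case 0
    have "thicken {\<one>} A = A" if "A \<subseteq> carrier G" for A
      using that by (force simp: thicken_def subset_iff image_iff)
    then show ?case by (intro exI[of _ "{\<one>}"]) auto
  next
    case (Suc n)
    then obtain W where W: "finite W" "W \<subseteq> carrier G"
      "\<And>A. finite A \<Longrightarrow> A \<subseteq> carrier G \<Longrightarrow> (1 + e) ^ n * card A \<le> card (thicken W A)" by blast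
    have "(1 + e) ^ Suc n * card A \<le> card (thicken (thicken ?L W) A)"
      if A: "finite A" "A \<subseteq> carrier G" for A
    proof -
      have "(1 + e) ^ Suc n * card A \<le> (1 + e) * card (thicken W A)"
        using W(3)[OF A] e by (simp add: mult.assoc)
      also have "\<dots> \<le> card (thicken ?L (thicken W A))"
        using A W by (intro grow finite_thicken thicken_closed)
      finally show ?thesis using thicken_thicken[OF L(2) W(2) A(2)] by simp
    qed
    then show ?case
      using finite_thicken[OF L(1) W(1)] thicken_closed[OF L(2) W(2)] by blast
  qed
  obtain n where "2 < (1 + e) ^ n"
    using real_arch_pow[of "1 + e" 2] e by auto
  from iterate[of n] obtain W where W: "finite W" "W \<subseteq> carrier G"
    "\<And>A. finite A \<Longrightarrow> A \<subseteq> carrier G \<Longrightarrow> (1 + e) ^ n * card A \<le> card (thicken W A)"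
    by (elim exE conjE) simp
  have "2 * card A \<le> card (thicken W A)" if "finite A" "A \<subseteq> carrier G" for A
  proof -
    have "2 * real (card A) \<le> (1 + e) ^ n * card A"
      using \<open>2 < (1 + e) ^ n\<close> by (intro mult_right_mono) auto
    also have "\<dots> \<le> card (thicken W A)" by (rule W(3)[OF that])
    finally show ?thesis by linarith
  qed
  then show False by (rule amenable_not_doubling[OF am W(1,2)])
qed

text \<open>Inverses of \<open>K\<close> are used since the coboundary formula evaluates the
  potential at \<open>inv k \<otimes> y\<close>.\<close>

lemma amenable_subgroup_folner:
  assumes N: "subgroup N G" and am: "amenable_group (G\<lparr>carrier := N\<rparr>)"
    and K: "finite K" "K \<subseteq> N" and e: "(e::real) > 0"
  shows "\<exists>A. finite A \<and> A \<noteq> {} \<and> A \<subseteq> N \<and>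
    card (A \<union> (\<Union>k\<in>K. (\<lambda>y. inv k \<otimes> y) ` A)) \<le> (1 + e) * real (card A)"
proof -
  interpret N: group "G\<lparr>carrier := N\<rparr>" by (rule subgroup.subgroup_is_group[OF N is_group])
  have "m_inv G ` K \<subseteq> N" using K(2) subgroup.m_inv_closed[OF N] by auto
  then obtain A where "finite A \<and> A \<noteq> {} \<and> A \<subseteq> N \<and>
    card (A \<union> (\<Union>k\<in>m_inv G ` K. (\<lambda>y. k \<otimes> y) ` A)) \<le> (1 + e) * real (card A)"
    using N.amenable_folner[OF am, of "m_inv G ` K" e] K(1) e by auto
  then show ?thesis by (intro exI[of _ A]) simp
qed

end


section \<open>Property (T) and bounded cocycles\<close>

subsection \<open>Exponential vectors in the Fock space\<close>

text \<open>Expanding a power of a sum over all words of length \<open>n\<close>. The absolute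
  version runs through the same induction because it supplies the summability needed to sum over
  first letter and rest separately.\<close>

lemma prod_list_has_sum_power:
  fixes a :: "'x \<Rightarrow> real"
  assumes "(\<lambda>x. \<bar>a x\<bar>) summable_on UNIV"
  shows "((\<lambda>w. \<bar>prod_list (map a w)\<bar>) has_sum (\<Sum>\<^sub>\<infinity>x. \<bar>a x\<bar>) ^ n) {w. length w = n}"
    "((\<lambda>w. prod_list (map a w)) has_sum (\<Sum>\<^sub>\<infinity>x. a x) ^ n) {w. length w = n}"
proof (induction n)
  case 0
  have "{w :: 'x list. length w = 0} = {[]}" by auto
  then show "((\<lambda>w. \<bar>prod_list (map a w)\<bar>) has_sum (\<Sum>\<^sub>\<infinity>x. \<bar>a x\<bar>) ^ 0) {w. length w = 0}"
    "((\<lambda>w. prod_list (map a w)) has_sum (\<Sum>\<^sub>\<infinity>x. a x) ^ 0) {w. length w = 0}"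
    using has_sum_finite[of "{[] :: 'x list}"] by (metis (mono_tags, lifting) abs_one finite.emptyI finite_insert
        has_sum_finiteI list.simps(8) power_0 prod_list.Nil sum.empty sum.insert_remove empty_Diff add_0_right)+
next
  case (Suc n)
  let ?L = "\<lambda>n. {w :: 'x list. length w = n}"
  have bij: "bij_betw (\<lambda>(x, w). x # w) (UNIV \<times> ?L n) (?L (Suc n))"
    by (rule bij_betwI[where g = "\<lambda>w. (hd w, tl w)"]) (auto simp: length_Suc_conv)
  have s: "(a has_sum (\<Sum>\<^sub>\<infinity>x. a x)) UNIV" using abs_summable_summable[of a UNIV] assms by simp
  have t: "((\<lambda>x. \<bar>a x\<bar>) has_sum (\<Sum>\<^sub>\<infinity>x. \<bar>a x\<bar>)) UNIV" using assms by simp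
  have i1: "((\<lambda>w. \<bar>a x\<bar> * \<bar>prod_list (map a w)\<bar>) has_sum \<bar>a x\<bar> * (\<Sum>\<^sub>\<infinity>x. \<bar>a x\<bar>) ^ n) (?L n)" for x
    by (intro has_sum_cmult_right Suc.IH(1))
  have i2: "((\<lambda>w. a x * prod_list (map a w)) has_sum a x * (\<Sum>\<^sub>\<infinity>x. a x) ^ n) (?L n)" for x
    by (intro has_sum_cmult_right Suc.IH(2))
  have o1: "((\<lambda>x. \<bar>a x\<bar> * (\<Sum>\<^sub>\<infinity>x. \<bar>a x\<bar>) ^ n) has_sum (\<Sum>\<^sub>\<infinity>x. \<bar>a x\<bar>) * (\<Sum>\<^sub>\<infinity>x. \<bar>a x\<bar>) ^ n) UNIV"
    by (intro has_sum_cmult_left t)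
  have o2: "((\<lambda>x. a x * (\<Sum>\<^sub>\<infinity>x. a x) ^ n) has_sum (\<Sum>\<^sub>\<infinity>x. a x) * (\<Sum>\<^sub>\<infinity>x. a x) ^ n) UNIV"
    by (intro has_sum_cmult_left s)
  have sum1: "(\<lambda>(x, w). \<bar>a x\<bar> * \<bar>prod_list (map a w)\<bar>) summable_on UNIV \<times> ?L n"
    by (rule summable_on_SigmaI[where g = "\<lambda>x. \<bar>a x\<bar> * (\<Sum>\<^sub>\<infinity>x. \<bar>a x\<bar>) ^ n"])
      (use i1 has_sum_imp_summable[OF o1] in auto)
  have sum2: "(\<lambda>(x, w). a x * prod_list (map a w)) summable_on UNIV \<times> ?L n"
    by (rule abs_summable_summable) (use sum1 in \<open>simp add: case_prod_unfold abs_mult\<close>)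
  have "((\<lambda>(x, w). \<bar>a x\<bar> * \<bar>prod_list (map a w)\<bar>) has_sum (\<Sum>\<^sub>\<infinity>x. \<bar>a x\<bar>) * (\<Sum>\<^sub>\<infinity>x. \<bar>a x\<bar>) ^ n) (UNIV \<times> ?L n)"
    by (rule has_sum_SigmaI[OF _ o1 sum1]) (use i1 in simp)
  then show "((\<lambda>w. \<bar>prod_list (map a w)\<bar>) has_sum (\<Sum>\<^sub>\<infinity>x. \<bar>a x\<bar>) ^ Suc n) (?L (Suc n))"
    by (subst has_sum_reindex_bij_betw[OF bij, symmetric]) (simp add: case_prod_unfold abs_mult)
  have "((\<lambda>(x, w). a x * prod_list (map a w)) has_sum (\<Sum>\<^sub>\<infinity>x. a x) * (\<Sum>\<^sub>\<infinity>x. a x) ^ n) (UNIV \<times> ?L n)"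
    by (rule has_sum_SigmaI[OF _ o2 sum2]) (use i2 in simp)
  then show "((\<lambda>w. prod_list (map a w)) has_sum (\<Sum>\<^sub>\<infinity>x. a x) ^ Suc n) (?L (Suc n))"
    by (subst has_sum_reindex_bij_betw[OF bij, symmetric]) (simp add: case_prod_unfold)
qed

lemma exp_has_sum: "((\<lambda>n. s ^ n / fact n) has_sum exp (s::real)) UNIV"
proof (rule norm_summable_imp_has_sum)
  show "summable (\<lambda>n. norm (s ^ n / fact n))"
    using summable_norm_exp[of s] by (simp add: field_simps)
  show "(\<lambda>n. s ^ n / fact n) sums exp s"
    using exp_converges[of s] by (simp add: field_simps)
qed

lemma prod_list_has_sum_exp:
  fixes a :: "'x \<Rightarrow> real"
  assumes a: "(\<lambda>x. \<bar>a x\<bar>) summable_on UNIV"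
  shows "((\<lambda>w. prod_list (map a w) / fact (length w)) has_sum exp (\<Sum>\<^sub>\<infinity>x. a x)) UNIV"
proof -
  let ?L = "\<lambda>n. {w :: 'x list. length w = n}"
  have bij: "bij_betw snd (Sigma UNIV ?L) UNIV"
    by (rule bij_betwI[where g = "\<lambda>w. (length w, w)"]) auto
  have i1: "((\<lambda>w. \<bar>prod_list (map a w)\<bar> / fact n) has_sum (\<Sum>\<^sub>\<infinity>x. \<bar>a x\<bar>) ^ n / fact n) (?L n)" for n
    by (intro has_sum_divide_const prod_list_has_sum_power(1) a)
  have i2: "((\<lambda>w. prod_list (map a w) / fact n) has_sum (\<Sum>\<^sub>\<infinity>x. a x) ^ n / fact n) (?L n)" for n
    by (intro has_sum_divide_const prod_list_has_sum_power(2) a)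
  have sum1: "(\<lambda>(n, w). \<bar>prod_list (map a w)\<bar> / fact n) summable_on Sigma UNIV ?L"
    by (rule summable_on_SigmaI[where g = "\<lambda>n. (\<Sum>\<^sub>\<infinity>x. \<bar>a x\<bar>) ^ n / fact n"])
      (use i1 has_sum_imp_summable[OF exp_has_sum] in auto)
  have sum2: "(\<lambda>(n, w). prod_list (map a w) / fact n) summable_on Sigma UNIV ?L"
    by (rule abs_summable_summable) (use sum1 in \<open>simp add: case_prod_unfold\<close>)
  have "((\<lambda>(n, w). prod_list (map a w) / fact n) has_sum exp (\<Sum>\<^sub>\<infinity>x. a x)) (Sigma UNIV ?L)"
    by (rule has_sum_SigmaI[OF _ exp_has_sum sum2]) (use i2 in simp)
  then have "((\<lambda>p. prod_list (map a (snd p)) / fact (length (snd p))) has_sum exp (\<Sum>\<^sub>\<infinity>x. a x)) (Sigma UNIV ?L)"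
    by (rule has_sum_cong[THEN iffD1, rotated]) auto
  then show ?thesis by (subst has_sum_reindex_bij_betw[OF bij, symmetric])
qed

lemma prod_list_map_mult:
  "prod_list (map (\<lambda>x. f x * g x) w) = prod_list (map f w) * prod_list (map (g :: _ \<Rightarrow> real) w)"
  by (induction w) auto

text \<open>Lists of length \<open>n\<close> index a basis of the \<open>n\<close>-th tensor power, and \<open>coherent v\<close> is the sum of the vectors
  \<open>v\<^sup>\<otimes>\<^sup>n / \<surd>n!\<close>.\<close>

definition coherent :: "'x ell2 \<Rightarrow> 'x list ell2" where
  "coherent v = ell2 (\<lambda>w. prod_list (map (fn v) w) / sqrt (fact (length w)))"

lemma fn_coherent: "fn (coherent v) w = prod_list (map (fn v) w) / sqrt (fact (length w))"
proof -
  have "(\<lambda>x. \<bar>fn v x * fn v x\<bar>) summable_on UNIV"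
    using square_summable_mult[of "fn v" "fn v"] by simp
  from has_sum_imp_summable[OF prod_list_has_sum_exp[OF this]]
  have "square_summable (\<lambda>w. prod_list (map (fn v) w) / sqrt (fact (length w)))"
    by (simp add: square_summable_def power_divide prod_list_map_mult power2_eq_square)
  then show ?thesis by (simp add: coherent_def fn_ell2)
qed

lemma inner_coherent: "inner (coherent v) (coherent w) = exp (inner v w)"
proof -
  have "(\<lambda>x. \<bar>fn v x * fn w x\<bar>) summable_on UNIV"
    using square_summable_mult[of "fn v" "fn w"]
      summable_on_iff_abs_summable_on_real[of "\<lambda>x. fn v x * fn w x" UNIV] by simp
  from infsumI[OF prod_list_has_sum_exp[OF this]]
  show ?thesis by (simp add: inner_ell2_def fn_coherent prod_list_map_mult)
qed

text \<open>A feature map for the Gaussian kernel: the scaling inside \<open>coherent\<close> yields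
  the mixed term of the squared distance, the scalar in front the two pure terms.\<close>

definition gauss_vec :: "real \<Rightarrow> 'x ell2 \<Rightarrow> 'x list ell2" where
  "gauss_vec t v = exp (- t * (norm v)\<^sup>2) *\<^sub>R coherent (sqrt (2 * t) *\<^sub>R v)"

lemma inner_gauss_vec:
  assumes "t \<ge> 0"
  shows "inner (gauss_vec t v) (gauss_vec t w) = exp (- t * (norm (v - w))\<^sup>2)"
proof -
  have "inner (gauss_vec t v) (gauss_vec t w) =
      exp (- t * (norm v)\<^sup>2 + (- t * (norm w)\<^sup>2) + 2 * t * inner v w)"
    unfolding gauss_vec_def inner_scaleR_left inner_scaleR_right inner_coherent exp_add
    using assms by (simp add: mult.assoc[symmetric])
  also have "- t * (norm v)\<^sup>2 + (- t * (norm w)\<^sup>2) + 2 * t * inner v w = - t * (norm (v - w))\<^sup>2"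
    by (simp add: power2_norm_eq_inner inner_diff_left inner_diff_right inner_commute algebra_simps)
  finally show ?thesis .
qed


subsection \<open>The orthogonal representation generated by an invariant family\<close>

lemma subspace_closure_span: "subspace (closure (span (A :: 'h::real_normed_vector set)))"
  unfolding subspace_def
proof (intro conjI ballI allI)
  show "0 \<in> closure (span A)" by (rule subsetD[OF closure_subset]) (rule span_zero)
next
  fix x y assume "x \<in> closure (span A)" "y \<in> closure (span A)"
  then obtain s t where "\<And>n. s n \<in> span A" "\<And>n. t n \<in> span A" "s \<longlonglongrightarrow> x" "t \<longlonglongrightarrow> y"
    unfolding closure_sequential by blast
  then show "x + y \<in> closure (span A)"
    unfolding closure_sequential by (intro exI[of _ "\<lambda>n. s n + t n"]) (auto intro: span_add tendsto_add)
next
  fix c x assume "x \<in> closure (span A)"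
  then obtain s where "\<And>n. s n \<in> span A" "s \<longlonglongrightarrow> x"
    unfolding closure_sequential by blast
  then show "c *\<^sub>R x \<in> closure (span A)"
    unfolding closure_sequential by (intro exI[of _ "\<lambda>n. c *\<^sub>R s n"]) (auto intro: span_scale tendsto_scaleR)
qed

lemma closure_span_minimal: "A \<subseteq> S \<Longrightarrow> subspace S \<Longrightarrow> closed S \<Longrightarrow> closure (span A) \<subseteq> S"
  by (intro closure_minimal span_minimal)

text \<open>Invariance of the Gram kernel says that \<open>E k \<mapsto> E (h \<otimes> k)\<close>
  preserves inner products. It therefore extends to a unitary representation on the closed span of
  the family.\<close>

locale invariant_family = group G for G :: "('a, 'b) monoid_scheme" (structure) +
  fixes E :: "'a \<Rightarrow> 'h::{real_inner, complete_space}"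
  assumes invariant: "\<lbrakk>h \<in> carrier G; k \<in> carrier G; l \<in> carrier G\<rbrakk>
    \<Longrightarrow> inner (E (h \<otimes> k)) (E (h \<otimes> l)) = inner (E k) (E l)"
begin

definition L :: "'h set" where "L = closure (span (E ` carrier G))"

lemma subspace_L: "subspace L" unfolding L_def by (rule subspace_closure_span)
lemma closed_L: "closed L" unfolding L_def by simp
lemma E_in_L: "k \<in> carrier G \<Longrightarrow> E k \<in> L"
  unfolding L_def by (rule subsetD[OF closure_subset]) (simp add: span_base)

lemma L_eq_0:
  assumes "v \<in> L" "\<And>k. k \<in> carrier G \<Longrightarrow> inner v (E k) = 0"
  shows "v = 0"
proof -
  have "L \<subseteq> {z. inner v z = 0}"
    unfolding L_def
  proof (rule closure_span_minimal)
    show "subspace {z. inner v z = 0}" by (auto simp: subspace_def inner_add_right)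
    show "closed {z. inner v z = 0}" by (rule closed_hyperplane)
  qed (use assms(2) in auto)
  then have "inner v v = 0" using assms(1) by blast
  then show ?thesis by simp
qed

text \<open>The operator is first a closed linear relation. Well-definedness on dependent vectors
  and extension to the closure are then settled together.\<close>

definition graph :: "'a \<Rightarrow> ('h \<times> 'h) set" where
  "graph h = closure (span ((\<lambda>k. (E k, E (h \<otimes> k))) ` carrier G))"

lemma graph_isometric:
  assumes h: "h \<in> carrier G" and p: "p \<in> graph h" and q: "q \<in> graph h"
  shows "inner (snd p) (snd q) = inner (fst p) (fst q)"
proof -
  \<comment> \<open>Minimality of the closed span is used once per argument: first against a
    generating pair, then against an arbitrary \<open>q\<close>.\<close>
  have sub: "graph h \<subseteq> {p. inner (snd p) (snd q) = inner (fst p) (fst q)}"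
    if "(\<lambda>k. (E k, E (h \<otimes> k))) ` carrier G \<subseteq> {p. inner (snd p) (snd q) = inner (fst p) (fst q)}" for q
    unfolding graph_def
  proof (rule closure_span_minimal[OF that])
    show "subspace {p. inner (snd p) (snd q) = inner (fst p) (fst q)}"
      by (auto simp: subspace_def inner_add_left)
    show "closed {p. inner (snd p) (snd q) = inner (fst p) (fst q)}"
      by (intro closed_Collect_eq continuous_intros)
  qed
  have "(E k, E (h \<otimes> k)) \<in> {p. inner (snd p) (snd q) = inner (fst p) (fst q)}" if k: "k \<in> carrier G" for k
  proof -
    have "(\<lambda>k. (E k, E (h \<otimes> k))) ` carrier G \<subseteq> {p. inner (snd p) (E (h \<otimes> k)) = inner (fst p) (E k)}"
      using invariant[OF h _ k] by auto
    then have "graph h \<subseteq> {p. inner (snd p) (E (h \<otimes> k)) = inner (fst p) (E k)}"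
      using sub[of "(E k, E (h \<otimes> k))"] by simp
    then show ?thesis using q by (auto simp: inner_commute)
  qed
  then have "graph h \<subseteq> {p. inner (snd p) (snd q) = inner (fst p) (fst q)}" by (intro sub) auto
  then show ?thesis using p by blast
qed

lemma subspace_graph: "subspace (graph h)" unfolding graph_def by (rule subspace_closure_span)

lemma graph_in_L: "h \<in> carrier G \<Longrightarrow> graph h \<subseteq> L \<times> L"
  unfolding graph_def
  by (intro closure_span_minimal subspace_Times closed_Times subspace_L closed_L) (auto simp: E_in_L)

text \<open>The first projection of the graph is closed: the relation is isometric, so convergence
  of first components makes the second components Cauchy.\<close>

lemma graph_total:
  assumes h: "h \<in> carrier G" and v: "v \<in> L"
  shows "\<exists>w. (v, w) \<in> graph h"
proof -
  have "L \<subseteq> fst ` graph h"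
    unfolding L_def
  proof (rule closure_span_minimal)
    show "E ` carrier G \<subseteq> fst ` graph h"
    proof
      fix z assume "z \<in> E ` carrier G"
      then obtain k where k: "k \<in> carrier G" "z = E k" by blast
      then have "(E k, E (h \<otimes> k)) \<in> graph h"
        unfolding graph_def by (intro subsetD[OF closure_subset] span_base) auto
      then show "z \<in> fst ` graph h" using k(2) by force
    qed
    show "subspace (fst ` graph h)" by (intro linear_subspace_image linear_fst subspace_graph)
    show "closed (fst ` graph h)"
    proof (unfold closed_sequential_limits, intro allI impI, elim conjE)
      fix s l assume s: "\<forall>n. s n \<in> fst ` graph h" and l: "s \<longlonglongrightarrow> l"
      then have "\<forall>n. \<exists>w. (s n, w) \<in> graph h" by force
      then obtain w where w: "\<And>n. (s n, w n) \<in> graph h" by metis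
      have d: "dist (w m) (w n) = dist (s m) (s n)" for m n
      proof -
        have "(s m - s n, w m - w n) \<in> graph h" using subspace_diff[OF subspace_graph w[of m] w[of n]] by simp
        from graph_isometric[OF h this this] show ?thesis by (simp add: dist_norm norm_eq_sqrt_inner)
      qed
      have "Cauchy w" using LIMSEQ_imp_Cauchy[OF l] unfolding Cauchy_def d .
      then obtain r where "w \<longlonglongrightarrow> r" by (auto simp: Cauchy_convergent_iff convergent_def)
      then have "(\<lambda>n. (s n, w n)) \<longlonglongrightarrow> (l, r)" using l by (rule tendsto_Pair[rotated])
      then have "(l, r) \<in> graph h"
        unfolding graph_def by (rule closed_sequentially[OF closed_closure w[unfolded graph_def]])
      then show "l \<in> fst ` graph h" by force
    qed
  qed
  then show ?thesis using v by force
qed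

text \<open>Elements of \<open>L\<close> are identified by their inner products with the family
  (\<open>L_eq_0\<close>), so this weak description is unique and the algebraic laws follow by
  comparing inner products.\<close>

definition U :: "'a \<Rightarrow> 'h \<Rightarrow> 'h" where
  "U h v = (THE w. w \<in> L \<and> (\<forall>k\<in>carrier G. inner w (E (h \<otimes> k)) = inner v (E k)))"

lemma U_unique:
  assumes h: "h \<in> carrier G" and w: "w \<in> L" "\<And>k. k \<in> carrier G \<Longrightarrow> inner w (E (h \<otimes> k)) = inner v (E k)"
  shows "U h v = w"
  unfolding U_def
proof (rule the_equality)
  fix w' assume w': "w' \<in> L \<and> (\<forall>k\<in>carrier G. inner w' (E (h \<otimes> k)) = inner v (E k))"
  have "inner (w' - w) (E k) = 0" if k: "k \<in> carrier G" for k
  proof -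
    have "k = h \<otimes> (inv h \<otimes> k)" using h k by (simp add: m_assoc[symmetric])
    moreover have "inv h \<otimes> k \<in> carrier G" using h k by simp
    ultimately have "inner w' (E k) = inner w (E k)" using w' w(2) by metis
    then show ?thesis by (simp add: inner_diff_left)
  qed
  then have "w' - w = 0" using L_eq_0 subspace_diff[OF subspace_L] w' w(1) by blast
  then show "w' = w" by simp
qed (use w in auto)

lemma U_graph:
  assumes h: "h \<in> carrier G" and v: "v \<in> L"
  shows "(v, U h v) \<in> graph h"
proof -
  obtain w where w: "(v, w) \<in> graph h" using graph_total[OF h v] by blast
  have "U h v = w"
  proof (rule U_unique[OF h])
    show "w \<in> L" using graph_in_L[OF h] w by blast
    fix k assume "k \<in> carrier G"
    then have "(E k, E (h \<otimes> k)) \<in> graph h"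
      unfolding graph_def by (intro subsetD[OF closure_subset] span_base) auto
    from graph_isometric[OF h w this] show "inner w (E (h \<otimes> k)) = inner v (E k)" by simp
  qed
  then show ?thesis using w by simp
qed

lemma U_closed: "h \<in> carrier G \<Longrightarrow> v \<in> L \<Longrightarrow> U h v \<in> L"
  using U_graph graph_in_L by blast

lemma U_inner: "h \<in> carrier G \<Longrightarrow> v \<in> L \<Longrightarrow> w \<in> L \<Longrightarrow> inner (U h v) (U h w) = inner v w"
  using graph_isometric[OF _ U_graph U_graph, of h v w] by simp

lemma U_E: "h \<in> carrier G \<Longrightarrow> k \<in> carrier G \<Longrightarrow> U h (E k) = E (h \<otimes> k)"
  by (rule U_unique) (auto simp: E_in_L invariant)

lemma U_inner_E: "h \<in> carrier G \<Longrightarrow> v \<in> L \<Longrightarrow> k \<in> carrier G \<Longrightarrow> inner (U h v) (E (h \<otimes> k)) = inner v (E k)"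
  using U_inner[of h v "E k"] by (simp add: U_E E_in_L)

lemma U_add: "h \<in> carrier G \<Longrightarrow> v \<in> L \<Longrightarrow> w \<in> L \<Longrightarrow> U h (v + w) = U h v + U h w"
  by (rule U_unique) (auto simp: inner_add_left U_inner_E intro: subspace_add[OF subspace_L] U_closed)

lemma U_scaleR: "h \<in> carrier G \<Longrightarrow> v \<in> L \<Longrightarrow> U h (c *\<^sub>R v) = c *\<^sub>R U h v"
  by (rule U_unique) (auto simp: U_inner_E intro: subspace_scale[OF subspace_L] U_closed)

lemma U_mult: "g \<in> carrier G \<Longrightarrow> h \<in> carrier G \<Longrightarrow> v \<in> L \<Longrightarrow> U (g \<otimes> h) v = U g (U h v)"
  by (rule U_unique) (auto simp: m_assoc U_inner_E U_closed)

lemma U_one: "v \<in> L \<Longrightarrow> U \<one> v = v"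
  by (rule U_unique) auto

text \<open>The complexification of \<open>L\<close>, with \<open>(a, b)\<close> standing for \<open>a + \<i> b\<close>.\<close>

definition V :: "('h \<times> 'h) hermitian_space" where
  "V = \<lparr>carrier = L \<times> L, monoid.mult = undefined, one = undefined, zero = (0, 0), add = (+),
        module.smult = (\<lambda>c (a, b). (Re c *\<^sub>R a - Im c *\<^sub>R b, Re c *\<^sub>R b + Im c *\<^sub>R a)),
        cip = (\<lambda>(a, b) (c, d). Complex (inner a c + inner b d) (inner b c - inner a d))\<rparr>"

lemma V_simps:
  "carrier V = L \<times> L" "\<zero>\<^bsub>V\<^esub> = (0, 0)" "p \<oplus>\<^bsub>V\<^esub> q = p + q"
  "c \<odot>\<^bsub>V\<^esub> (a, b) = (Re c *\<^sub>R a - Im c *\<^sub>R b, Re c *\<^sub>R b + Im c *\<^sub>R a)"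
  "cip V (a, b) (a', b') = Complex (inner a a' + inner b b') (inner b a' - inner a b')"
  by (simp_all add: V_def)

lemma cnorm_V: "cnorm V p = norm p"
  by (cases p) (simp add: cnorm_def V_simps norm_Pair power2_norm_eq_inner)

lemma module_V: "module complex_ring V"
proof (rule moduleI)
  show "cring complex_ring" by (rule cring_complex_ring)
  show "abelian_group V"
  proof (rule abelian_groupI)
    fix p assume "p \<in> carrier V"
    then show "\<exists>q\<in>carrier V. q \<oplus>\<^bsub>V\<^esub> p = \<zero>\<^bsub>V\<^esub>"
      by (intro bexI[of _ "- p"]) (auto simp: V_simps zero_prod_def intro: subspace_neg[OF subspace_L])
  qed (auto simp: V_simps zero_prod_def algebra_simps intro: subspace_add[OF subspace_L] subspace_0[OF subspace_L])
qed (auto simp: V_simps algebra_simps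
    intro!: subspace_add[OF subspace_L] subspace_diff[OF subspace_L] subspace_scale[OF subspace_L])

lemma minus_V:
  assumes "p \<in> carrier V" "q \<in> carrier V"
  shows "p \<ominus>\<^bsub>V\<^esub> q = p - q"
proof -
  interpret module complex_ring V by (rule module_V)
  have "\<ominus>\<^bsub>V\<^esub> q = - q"
    by (rule M.minus_equality) (use assms in \<open>auto simp: V_simps zero_prod_def intro: subspace_neg[OF subspace_L]\<close>)
  then show ?thesis by (simp add: a_minus_def V_simps)
qed

lemma hilbert_V: "complex_hilbert_space V"
proof (rule complex_hilbert_space.intro[OF module_V], unfold_locales)
  fix s :: "nat \<Rightarrow> 'h \<times> 'h"
  assume s: "\<And>n. s n \<in> carrier V"
    and C: "\<And>e. e > 0 \<Longrightarrow> \<exists>N. \<forall>m\<ge>N. \<forall>n\<ge>N. cnorm V (s m \<ominus>\<^bsub>V\<^esub> s n) < e"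
  have "Cauchy s"
    by (rule metric_CauchyI) (use C in \<open>simp add: dist_norm cnorm_V minus_V s\<close>)
  then have "Cauchy (\<lambda>n. fst (s n))" "Cauchy (\<lambda>n. snd (s n))"
    by (auto intro: Cauchy_fst Cauchy_snd)
  then obtain a b where ab: "(\<lambda>n. fst (s n)) \<longlonglongrightarrow> a" "(\<lambda>n. snd (s n)) \<longlonglongrightarrow> b"
    by (auto simp: Cauchy_convergent_iff convergent_def)
  have lim: "s \<longlonglongrightarrow> (a, b)" using tendsto_Pair[OF ab] by simp
  have "closed (L \<times> L)" by (intro closed_Times closed_L)
  then have l: "(a, b) \<in> carrier V"
    using s lim by (metis V_simps(1) closed_sequentially)
  show "\<exists>l\<in>carrier V. (\<lambda>n. cnorm V (s n \<ominus>\<^bsub>V\<^esub> l)) \<longlonglongrightarrow> 0"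
    by (rule bexI[OF _ l]) (simp add: cnorm_V minus_V s l LIM_zero tendsto_norm_zero lim)
qed (auto simp: V_simps inner_add_left inner_add_right inner_diff_left inner_diff_right inner_commute
    complex_eq_iff algebra_simps zero_prod_def add_nonneg_eq_0_iff)

lemma unitary_U: "unitary_representation G V (\<lambda>g (a, b). (U g a, U g b))"
proof (intro unitary_representation.intro is_group hilbert_V)
  have diff: "U g (v - w) = U g v - U g w" if "g \<in> carrier G" "v \<in> L" "w \<in> L" for g v w
    using U_add[of g v "- 1 *\<^sub>R w"] U_scaleR[of g w "-1"] that subspace_neg[OF subspace_L] by simp
  show "unitary_representation_axioms G V (\<lambda>g (a, b). (U g a, U g b))"
    by unfold_locales (auto simp: V_simps U_closed U_add diff U_scaleR U_inner U_mult U_one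
        subspace_scale[OF subspace_L])
qed

end


text \<open>Delorme's argument: the Gaussian kernels \<open>exp (- t \<parallel>b(k) - b(l)\<parallel>\<^sup>2)\<close> with small \<open>t\<close> have almost invariant
  vectors, while an invariant vector prevents \<open>b\<close> from being unbounded.\<close>

theorem (in group) property_T_bounded:
  fixes b :: "'a \<Rightarrow> 'x ell2"
  assumes T: "property_T G"
    and inv: "\<And>h k l. \<lbrakk>h \<in> carrier G; k \<in> carrier G; l \<in> carrier G\<rbrakk>
      \<Longrightarrow> norm (b (h \<otimes> k) - b (h \<otimes> l)) = norm (b k - b l)"
  shows "bounded (b ` carrier G)"
proof -
  obtain Q e where Q: "finite Q" "Q \<subseteq> carrier G" and e: "e > 0"
    and pair: "kazhdan_pair TYPE('a \<Rightarrow> complex) G Q e"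
    using T unfolding property_T_def by blast
  \<comment> \<open>The summand 1 makes \<open>B\<close> positive and strictly larger than every
    displacement over \<open>Q\<close>.\<close>
  define B where "B = 1 + (\<Sum>q\<in>Q. (norm (b q - b \<one>))\<^sup>2)"
  have B: "B > 0" unfolding B_def by (intro add_pos_nonneg sum_nonneg) auto
  have Bq: "(norm (b q - b \<one>))\<^sup>2 < B" if "q \<in> Q" for q
    using member_le_sum[of q Q "\<lambda>q. (norm (b q - b \<one>))\<^sup>2"] that Q(1) by (simp add: B_def)
  \<comment> \<open>Chosen so that \<open>2 * t * B\<close> is the square of \<open>e\<close>, since
    \<open>2 * t\<close> times the squared displacement bounds the squared norm of
    \<open>E g - E \<one>\<close>.\<close>
  define t where "t = e\<^sup>2 / (2 * B)"
  have t: "t > 0" using e B by (simp add: t_def)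
  define E where "E k = gauss_vec t (b k)" for k
  have EE: "inner (E k) (E l) = exp (- t * (norm (b k - b l))\<^sup>2)" for k l
    using t by (simp add: E_def inner_gauss_vec)
  interpret invariant_family G E
    by unfold_locales (simp add: EE inv)
  have nE: "norm (E k) = 1" for k by (simp add: norm_eq_sqrt_inner EE)
  \<comment> \<open>The representation lives on a complexified Fock space rather than on
    \<open>'a \<Rightarrow> complex\<close>, hence the change of type.\<close>
  have "kazhdan_pair TYPE('x list ell2 \<times> 'x list ell2) G Q e"
    by (rule kazhdan_pair_any_type[OF pair Q(2)])
  moreover have "\<exists>v\<in>carrier V. v \<noteq> \<zero>\<^bsub>V\<^esub> \<and>
      (\<forall>g\<in>Q. cnorm V ((\<lambda>g (a, b). (U g a, U g b)) g v \<ominus>\<^bsub>V\<^esub> v) < e * cnorm V v)"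
  proof (intro bexI[of _ "(E \<one>, 0)"] conjI ballI)
    show v: "(E \<one>, 0) \<in> carrier V" using E_in_L subspace_0[OF subspace_L] by (simp add: V_simps)
    show "(E \<one>, 0) \<noteq> \<zero>\<^bsub>V\<^esub>" using nE[of \<one>] by (auto simp: V_simps)
    fix g assume g: "g \<in> Q"
    then have gc: "g \<in> carrier G" using Q(2) by blast
    have U0: "U g 0 = 0" using U_scaleR[OF gc, of 0 0] subspace_0[OF subspace_L] by simp
    have Ug: "U g (E \<one>) = E g" using U_E[OF gc, of \<one>] gc by simp
    have "(norm (E g - E \<one>))\<^sup>2 = 2 - 2 * exp (- (t * (norm (b g - b \<one>))\<^sup>2))"
      by (simp add: power2_norm_eq_inner inner_diff_left inner_diff_right EE norm_minus_commute)
    also have "\<dots> \<le> 2 * (t * (norm (b g - b \<one>))\<^sup>2)"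
      using exp_ge_add_one_self[of "- (t * (norm (b g - b \<one>))\<^sup>2)"] by simp
    also have "\<dots> < 2 * (t * B)" using t Bq[OF g] by simp
    also have "\<dots> = e\<^sup>2" using B by (simp add: t_def)
    finally have "norm (E g - E \<one>) < e" using e by (meson less_imp_le power_less_imp_less_base)
    moreover have "(E g, 0) \<in> carrier V" using E_in_L[OF gc] subspace_0[OF subspace_L] by (simp add: V_simps)
    ultimately show "cnorm V ((\<lambda>g (a, b). (U g a, U g b)) g (E \<one>, 0) \<ominus>\<^bsub>V\<^esub> (E \<one>, 0)) < e * cnorm V (E \<one>, 0)"
      using v by (simp add: Ug U0 minus_V cnorm_V norm_Pair nE)
  qed
  ultimately obtain p where p: "p \<in> carrier V" "p \<noteq> \<zero>\<^bsub>V\<^esub>"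
    "\<And>g. g \<in> carrier G \<Longrightarrow> (\<lambda>(a, b). (U g a, U g b)) p = p"
    using unitary_U unfolding kazhdan_pair_def by blast
  then obtain w where w: "w \<in> L" "w \<noteq> 0" "\<And>g. g \<in> carrier G \<Longrightarrow> U g w = w"
    by (cases p) (auto simp: V_simps)
  \<comment> \<open>An invariant vector pairs equally with the whole family, and by totality of the
    family this common value is not zero.\<close>
  have const: "inner w (E g) = inner w (E \<one>)" if "g \<in> carrier G" for g
    using U_inner_E[OF that w(1), of \<one>] that by (simp add: w(3))
  have nz: "inner w (E \<one>) \<noteq> 0" using L_eq_0[OF w(1)] w(2) const by metis
  show ?thesis
  proof (rule ccontr)
    assume "\<not> bounded (b ` carrier G)"
    then have "\<forall>n::nat. \<exists>g\<in>carrier G. real n < norm (b g)"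
      unfolding bounded_iff by (metis imageE not_le)
    then obtain g where g: "\<And>n. g n \<in> carrier G" "\<And>n. real n < norm (b (g n))" by metis
    \<comment> \<open>Along elements with unbounded \<open>b\<close>, the Gaussian decay makes
      \<open>E (g n)\<close> tend weakly to zero on \<open>L\<close>. This contradicts the constant
      nonzero pairing with \<open>w\<close>.\<close>
    let ?S = "{z. (\<lambda>n. inner (E (g n)) z) \<longlonglongrightarrow> 0}"
    have "L \<subseteq> ?S"
      unfolding L_def
    proof (rule closure_span_minimal)
      show "E ` carrier G \<subseteq> ?S"
      proof safe
        fix k
        have "filterlim (\<lambda>n. real n - norm (b k)) at_top sequentially" by real_asymp
        then have "filterlim (\<lambda>n. norm (b (g n) - b k)) at_top sequentially"
        proof (rule filterlim_at_top_mono)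
          show "eventually (\<lambda>n. real n - norm (b k) \<le> norm (b (g n) - b k)) sequentially"
            using g(2) norm_triangle_ineq2[of "b (g _)" "b k"]
            by (intro always_eventually allI) (meson diff_right_mono less_imp_le order_trans)
        qed
        then have "filterlim (\<lambda>n. t * (norm (b (g n) - b k))\<^sup>2) at_top sequentially"
          by (intro filterlim_tendsto_pos_mult_at_top[OF tendsto_const t] filterlim_pow_at_top) auto
        then have "(\<lambda>n. exp (- (t * (norm (b (g n) - b k))\<^sup>2))) \<longlonglongrightarrow> 0"
          by (intro filterlim_compose[OF exp_at_bot] filterlim_compose[OF filterlim_uminus_at_bot_at_top])
        then show "(\<lambda>n. inner (E (g n)) (E k)) \<longlonglongrightarrow> 0" by (simp add: EE)
      qed
      show "subspace ?S"
        unfolding subspace_def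
        by (auto simp: inner_add_right intro: tendsto_add_zero tendsto_mult_right_zero)
      show "closed ?S"
        unfolding closed_sequential_limits
      proof (intro allI impI, elim conjE)
        fix s l assume s: "\<forall>m. s m \<in> ?S" and l: "s \<longlonglongrightarrow> l"
        have "(\<lambda>n. inner (E (g n)) l) \<longlonglongrightarrow> 0"
        proof (rule LIMSEQ_I)
          fix r :: real assume r: "r > 0"
          then obtain m where m: "norm (s m - l) < r / 2"
            using LIMSEQ_D[OF l, of "r/2"] by auto
          obtain n0 where n0: "\<And>n. n \<ge> n0 \<Longrightarrow> \<bar>inner (E (g n)) (s m)\<bar> < r / 2"
            using LIMSEQ_D[of "\<lambda>n. inner (E (g n)) (s m)" 0 "r/2"] s r by auto
          have "\<bar>inner (E (g n)) l\<bar> < r" if "n \<ge> n0" for n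
          proof -
            have "\<bar>inner (E (g n)) (s m - l)\<bar> \<le> norm (s m - l)"
              using Cauchy_Schwarz_ineq2[of "E (g n)" "s m - l"] by (simp add: nE)
            then show ?thesis using n0[OF that] m by (simp add: inner_diff_right)
          qed
          then show "\<exists>no. \<forall>n\<ge>no. norm (inner (E (g n)) l - 0) < r" by auto
        qed
        then show "l \<in> ?S" by simp
      qed
    qed
    then have "(\<lambda>n. inner (E (g n)) w) \<longlonglongrightarrow> 0" using w(1) by blast
    then have "(\<lambda>n. inner w (E \<one>)) \<longlonglongrightarrow> 0" using const[OF g(1)] by (simp add: inner_commute)
    then show False using nz by (simp add: LIMSEQ_const_iff)
  qed
qed


section \<open>Bounded cocycles are inner\<close>

lemma parallelogram_midpoint:
  fixes v w b :: "'h::real_inner"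
  shows "(dist ((1/2) *\<^sub>R (v + w)) b)\<^sup>2 = (dist v b)\<^sup>2 / 2 + (dist w b)\<^sup>2 / 2 - (dist v w)\<^sup>2 / 4"
proof -
  define p q where "p = v - b" and "q = w - b"
  have "(1/2) *\<^sub>R (v + w) - b = (1/2) *\<^sub>R ((v + w) - (b + b))"
    by (simp only: scaleR_diff_right scaleR_half_double)
  also have "\<dots> = (1/2) *\<^sub>R (p + q)" by (simp add: p_def q_def)
  finally have 1: "(1/2) *\<^sub>R (v + w) - b = (1/2) *\<^sub>R (p + q)" .
  have 2: "v - w = p - q" by (simp add: p_def q_def)
  show ?thesis
    unfolding dist_norm 1 2 p_def[symmetric] q_def[symmetric] power2_norm_eq_inner
    by (simp add: inner_add_left inner_add_right inner_diff_left inner_diff_right inner_commute[of q p]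
        add_divide_distrib diff_divide_distrib)
qed

text \<open>The point \<open>v\<close> below is the circumcenter of \<open>B\<close>.\<close>

lemma circumcenter_fixed:
  fixes B :: "'h::{real_inner, complete_space} set"
  assumes H: "subspace H" "closed H" and B: "B \<subseteq> H" "B \<noteq> {}" "bounded B"
  obtains v where "v \<in> H"
    "\<And>\<alpha>. (\<And>z. z \<in> H \<Longrightarrow> \<alpha> z \<in> H) \<Longrightarrow> (\<And>y z. y \<in> H \<Longrightarrow> z \<in> H \<Longrightarrow> dist (\<alpha> y) (\<alpha> z) = dist y z) \<Longrightarrow>
      \<alpha> ` B = B \<Longrightarrow> \<alpha> v = v"
proof -
  \<comment> \<open>The squared radius of the smallest ball around \<open>v\<close> containing
    \<open>B\<close>.\<close>
  define R where "R v = (SUP b\<in>B. (dist v b)\<^sup>2)" for v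
  have bdd: "bdd_above ((\<lambda>b. (dist v b)\<^sup>2) ` B)" for v
  proof -
    obtain C where "\<And>b. b \<in> B \<Longrightarrow> dist v b \<le> C" using B(3) bounded_any_center[of B v] by auto
    then have "(dist v b)\<^sup>2 \<le> C\<^sup>2" if "b \<in> B" for b using that by (intro power_mono) auto
    then show ?thesis by (intro bdd_aboveI2[where M = "C\<^sup>2"])
  qed
  have R_le: "R v \<le> r" if "\<And>b. b \<in> B \<Longrightarrow> (dist v b)\<^sup>2 \<le> r" for v r
    unfolding R_def by (rule cSUP_least[OF B(2) that])
  have le_R: "(dist v b)\<^sup>2 \<le> R v" if "b \<in> B" for v b
    unfolding R_def by (rule cSUP_upper[OF that bdd])
  obtain b0 where b0: "b0 \<in> B" using B(2) by blast
  have R0: "0 \<le> R v" for v using le_R[OF b0, of v] by (meson order_trans zero_le_power2)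
  define \<rho> where "\<rho> = (INF v\<in>H. R v)"
  have \<rho>_le: "\<rho> \<le> R v" if "v \<in> H" for v
    unfolding \<rho>_def by (rule cINF_lower[OF _ that]) (rule bdd_belowI2[where m = 0], rule R0)
  \<comment> \<open>Passing to the midpoint gains a quarter of the squared distance, while no radius
    is below \<open>\<rho>\<close>. Near minimisers are therefore close together, which gives both
    existence and uniqueness of the minimiser.\<close>
  have close: "(dist v w)\<^sup>2 \<le> 2 * (R v - \<rho>) + 2 * (R w - \<rho>)" if vw: "v \<in> H" "w \<in> H" for v w
  proof -
    have "\<rho> \<le> R ((1/2) *\<^sub>R (v + w))" using vw by (intro \<rho>_le subspace_scale subspace_add H)
    also have "\<dots> \<le> R v / 2 + R w / 2 - (dist v w)\<^sup>2 / 4"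
      by (rule R_le) (use le_R[of _ v] le_R[of _ w] in \<open>auto simp: parallelogram_midpoint intro!: add_mono divide_right_mono\<close>)
    finally show ?thesis by simp
  qed
  have "\<exists>v\<in>H. R v < \<rho> + 1 / real (Suc n)" for n
  proof -
    have "(INF v\<in>H. R v) < \<rho> + 1 / real (Suc n)" by (simp add: \<rho>_def)
    then show ?thesis
      using cINF_less_iff[of H R "\<rho> + 1 / real (Suc n)"] H(1) subspace_0 R0
      by (metis bdd_belowI2 empty_iff)
  qed
  then obtain s where s: "\<And>n. s n \<in> H" "\<And>n. R (s n) < \<rho> + 1 / real (Suc n)" by metis
  have "Cauchy s"
  proof (rule metric_CauchyI)
    fix e :: real assume e: "e > 0"
    then obtain n0 where n0: "1 / real (Suc n0) < e\<^sup>2 / 4"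
      using reals_Archimedean[of "e\<^sup>2 / 4"] by (auto simp: inverse_eq_divide)
    have small: "R (s n) - \<rho> < e\<^sup>2 / 4" if "n \<ge> n0" for n
    proof -
      have "1 / real (Suc n) \<le> 1 / real (Suc n0)" using that by (intro divide_left_mono) auto
      then show ?thesis using s(2)[of n] n0 by linarith
    qed
    have "dist (s m) (s n) < e" if "m \<ge> n0" "n \<ge> n0" for m n
    proof -
      have "(dist (s m) (s n))\<^sup>2 \<le> 2 * (R (s m) - \<rho>) + 2 * (R (s n) - \<rho>)"
        by (rule close[OF s(1) s(1)])
      also have "\<dots> < 2 * (e\<^sup>2 / 4) + 2 * (e\<^sup>2 / 4)"
        using small[OF that(1)] small[OF that(2)] by (intro add_strict_mono) auto
      finally have "(dist (s m) (s n))\<^sup>2 < e\<^sup>2" by simp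
      then show ?thesis using e by (meson less_imp_le power_less_imp_less_base)
    qed
    then show "\<exists>M. \<forall>m\<ge>M. \<forall>n\<ge>M. dist (s m) (s n) < e" by blast
  qed
  then obtain v where v: "s \<longlonglongrightarrow> v" by (auto simp: Cauchy_convergent_iff convergent_def)
  have vH: "v \<in> H" by (rule closed_sequentially[OF H(2) s(1) v])
  have Rv: "R v \<le> \<rho>"
  proof (rule R_le)
    fix b assume b: "b \<in> B"
    have "(\<lambda>n. (dist (s n) b)\<^sup>2) \<longlonglongrightarrow> (dist v b)\<^sup>2" by (intro tendsto_intros v)
    moreover have "(\<lambda>n. \<rho> + 1 / real (Suc n)) \<longlonglongrightarrow> \<rho> + 0"
      by (intro tendsto_add tendsto_const LIMSEQ_inverse_real_of_nat[unfolded inverse_eq_divide])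
    moreover have "(dist (s n) b)\<^sup>2 \<le> \<rho> + 1 / real (Suc n)" for n
      using le_R[OF b, of "s n"] s(2)[of n] by linarith
    ultimately show "(dist v b)\<^sup>2 \<le> \<rho>" by (metis (no_types, lifting) LIMSEQ_le add_0_right)
  qed
  show thesis
  proof (rule that[OF vH])
    fix \<alpha> assume \<alpha>: "\<And>z. z \<in> H \<Longrightarrow> \<alpha> z \<in> H"
      "\<And>y z. y \<in> H \<Longrightarrow> z \<in> H \<Longrightarrow> dist (\<alpha> y) (\<alpha> z) = dist y z" "\<alpha> ` B = B"
    \<comment> \<open>An isometry permuting \<open>B\<close> does not increase the radius, so it
      maps the minimiser to a minimiser.\<close>
    have "R (\<alpha> v) \<le> R v"
    proof (rule R_le)
      fix b assume "b \<in> B"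
      then obtain b' where b': "b' \<in> B" "b = \<alpha> b'" using \<alpha>(3) by blast
      then show "(dist (\<alpha> v) b)\<^sup>2 \<le> R v" using \<alpha>(2)[OF vH, of b'] le_R[of b' v] B(1) by auto
    qed
    then have "2 * (R (\<alpha> v) - \<rho>) + 2 * (R v - \<rho>) \<le> 0" using Rv by simp
    then have "(dist (\<alpha> v) v)\<^sup>2 \<le> 0" using close[OF \<alpha>(1)[OF vH] vH] by (rule order_trans[rotated])
    then show "\<alpha> v = v" by simp
  qed
qed

section \<open>Affine isometric actions on the regular representation\<close>

context generated_group
begin

lemma subspace_hmod: "subspace (hmod G I)"
  by (auto simp: subspace_def hmod_add hmod_scaleR)

lemma closed_hmod: "closed (hmod G I)"
  unfolding closed_sequential_limits using hmod_closed by blast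

text \<open>Support in \<open>carrier G\<close> matters because \<open>left_tr\<close> erases all
  values outside it.\<close>

lemma left_tr_isometric:
  fixes I :: "'i set"
  assumes g: "g \<in> carrier G" and v: "v \<in> hmod G I"
  shows "norm (left_tr G g v) = norm v"
proof -
  have adj: "adjoint_pair (left_tr G g) (left_tr G (inv g) :: ('a \<times> 'i) ell2 \<Rightarrow> _)"
    using gop_left_tr[OF g, where I = "UNIV :: 'i set"] by (simp add: gop_def)
  have "left_tr G (inv g) (left_tr G g v) = v"
  proof (rule ell2_eqI)
    fix p :: "'a \<times> 'i"
    obtain y i where p: "p = (y, i)" by (cases p)
    show "fn (left_tr G (inv g) (left_tr G g v)) p = fn v p"
      using v g by (cases "y \<in> carrier G") (auto simp: p fn_left_tr hmod_def m_assoc[symmetric])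
  qed
  then have "inner (left_tr G g v) (left_tr G g v) = inner v v"
    by (simp add: adjoint_pairD[OF adj])
  then show ?thesis by (simp add: norm_eq_sqrt_inner)
qed

text \<open>The orbit \<open>b ` carrier G\<close> of \<open>0\<close> under the affine action \<open>v \<mapsto> g v + b g\<close> has a circumcenter \<open>\<xi>\<close>.\<close>

lemma bounded_cocycle_inner:
  fixes b :: "'a \<Rightarrow> ('a \<times> unit) ell2"
  assumes b: "\<And>g y. g \<in> carrier G \<Longrightarrow>
      fn (b g) (y, ()) = (if y \<in> carrier G then f y - f (inv g \<otimes> y) else 0)"
    and bounded: "bounded (b ` carrier G)"
  shows "\<exists>\<xi>. \<forall>g\<in>carrier G. \<forall>y\<in>carrier G. fn (b g) (y, ()) = fn \<xi> (y, ()) - fn \<xi> (inv g \<otimes> y, ())"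
proof -
  let ?H = "hmod G UNIV :: ('a \<times> unit) ell2 set"
  have bH: "b g \<in> ?H" if "g \<in> carrier G" for g using b[OF that] by (auto simp: hmod_def split: if_splits)
  have b_mult: "b (g \<otimes> h) = left_tr G g (b h) + b g" if "g \<in> carrier G" "h \<in> carrier G" for g h
  proof (rule ell2_eqI)
    fix p :: "'a \<times> unit"
    obtain y where p: "p = (y, ())" by (cases p) auto
    show "fn (b (g \<otimes> h)) p = fn (left_tr G g (b h) + b g) p"
      using that by (auto simp: p b fn_left_tr inv_mult_group m_assoc)
  qed
  obtain \<xi> where \<xi>: "\<xi> \<in> ?H"
    "\<And>\<alpha>. (\<And>z. z \<in> ?H \<Longrightarrow> \<alpha> z \<in> ?H) \<Longrightarrow> (\<And>y z. y \<in> ?H \<Longrightarrow> z \<in> ?H \<Longrightarrow> dist (\<alpha> y) (\<alpha> z) = dist y z) \<Longrightarrow>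
      \<alpha> ` (b ` carrier G) = b ` carrier G \<Longrightarrow> \<alpha> \<xi> = \<xi>"
    by (rule circumcenter_fixed[OF subspace_hmod closed_hmod _ _ bounded, of UNIV]) (use bH in auto)
  have "left_tr G g \<xi> + b g = \<xi>" if g: "g \<in> carrier G" for g
  proof (rule \<xi>(2))
    have gm: "gmap G UNIV UNIV (left_tr G g :: ('a \<times> unit) ell2 \<Rightarrow> _)"
      using gop_left_tr[OF g, where I = "UNIV :: unit set"] by (simp add: gop_def)
    show "left_tr G g z + b g \<in> ?H" if "z \<in> ?H" for z
      using gmapD(3)[OF gm that] bH[OF g] by (rule hmod_add)
    show "dist (left_tr G g y + b g) (left_tr G g z + b g) = dist y z" if "y \<in> ?H" "z \<in> ?H" for y z
      using left_tr_isometric[OF g subspace_diff[OF subspace_hmod that]]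
        linear_diff[OF bounded_linear.linear[OF gmapD(1)[OF gm]], of y z]
      by (simp add: dist_norm)
    show "(\<lambda>z. left_tr G g z + b g) ` (b ` carrier G) = b ` carrier G"
    proof
      show "(\<lambda>z. left_tr G g z + b g) ` (b ` carrier G) \<subseteq> b ` carrier G"
        using g by (auto simp: b_mult[symmetric])
      show "b ` carrier G \<subseteq> (\<lambda>z. left_tr G g z + b g) ` (b ` carrier G)"
      proof
        fix z assume "z \<in> b ` carrier G"
        then obtain h where h: "h \<in> carrier G" "z = b h" by blast
        have "h = g \<otimes> (inv g \<otimes> h)" using g h by (simp add: m_assoc[symmetric])
        then have "z = left_tr G g (b (inv g \<otimes> h)) + b g" using b_mult[of g "inv g \<otimes> h"] g h by simp
        then show "z \<in> (\<lambda>z. left_tr G g z + b g) ` (b ` carrier G)" using g h by blast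
      qed
    qed
  qed
  then have "fn (b g) (y, ()) = fn \<xi> (y, ()) - fn \<xi> (inv g \<otimes> y, ())"
    if "g \<in> carrier G" "y \<in> carrier G" for g y
    using that by (metis (no_types, lifting) add_diff_cancel_left' fn_add fn_left_tr)
  then show ?thesis by blast
qed

text \<open>The hypothesis \<open>bounded\<close> isolates what finite groups and groups with
  property (T) share. A circumcenter replaces the potential of each column of \<open>P\<close> by a
  square summable one, and \<open>inner_cocycles_dimension\<close> applies.\<close>

theorem bounded_cocycles_dimension:
  assumes fin: "finite S" and pres: "presented_by G x S R"
    and P: "gop G S S P P" "kernel_proj \<Phi> P"
    and pot: "\<And>v. \<exists>f. \<forall>w\<in>carrier F. \<forall>y\<in>carrier G.
      word_cocycle G x (fn (P v)) w y = f y - f (inv (\<phi> w) \<otimes> y)"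
    and bounded: "\<And>b :: 'a \<Rightarrow> ('a \<times> unit) ell2.
      (\<And>h k l. \<lbrakk>h \<in> carrier G; k \<in> carrier G; l \<in> carrier G\<rbrakk>
        \<Longrightarrow> norm (b (h \<otimes> k) - b (h \<otimes> l)) = norm (b k - b l)) \<Longrightarrow> bounded (b ` carrier G)"
  shows "gtrace G S P \<le> 1"
proof (rule inner_cocycles_dimension[OF fin P])
  fix a assume a: "a \<in> S"
  let ?v = "delta (\<one>, a)"
  obtain f where f: "\<And>w y. w \<in> carrier F \<Longrightarrow> y \<in> carrier G \<Longrightarrow>
      word_cocycle G x (fn (P ?v)) w y = f y - f (inv (\<phi> w) \<otimes> y)"
    using pot by blast
  have "\<forall>y\<in>carrier G. \<exists>w. w \<in> carrier F \<and> \<phi> w = y"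
    using pres by (metis imageE presented_by_def)
  then obtain s where s: "\<And>y. y \<in> carrier G \<Longrightarrow> s y \<in> carrier F" "\<And>y. y \<in> carrier G \<Longrightarrow> \<phi> (s y) = y"
    by metis
  \<comment> \<open>Built from \<open>word_op\<close> and not from \<open>f\<close>, so that its
    values are square summable although \<open>f\<close> need not be.\<close>
  define b :: "'a \<Rightarrow> ('a \<times> unit) ell2" where "b g = word_op G x () (s g) (P ?v)" for g
  have fnb: "fn (b g) (y, ()) = (if y \<in> carrier G then f y - f (inv g \<otimes> y) else 0)"
    if g: "g \<in> carrier G" for g y
    using fn_word_op[OF F_letters[OF s(1)[OF g]], of "()" "P ?v" y "()"] f[OF s(1)[OF g], of y] s(2)[OF g]
    by (auto simp: b_def)
  have "bounded (b ` carrier G)"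
  proof (rule bounded)
    fix h k l assume hkl: "h \<in> carrier G" "k \<in> carrier G" "l \<in> carrier G"
    have "b (h \<otimes> k) - b (h \<otimes> l) = left_tr G h (b k - b l)"
    proof (rule ell2_eqI)
      fix p :: "'a \<times> unit"
      obtain y where p: "p = (y, ())" by (cases p) auto
      show "fn (b (h \<otimes> k) - b (h \<otimes> l)) p = fn (left_tr G h (b k - b l)) p"
        using hkl by (auto simp: p fnb fn_left_tr inv_mult_group m_assoc)
    qed
    moreover have "b k - b l \<in> hmod G UNIV"
      using hkl by (auto simp: hmod_def fnb split: if_splits)
    ultimately show "norm (b (h \<otimes> k) - b (h \<otimes> l)) = norm (b k - b l)"
      using left_tr_isometric[OF hkl(1)] by simp
  qed
  from bounded_cocycle_inner[OF fnb this]
  obtain \<xi> where \<xi>: "\<And>g y. g \<in> carrier G \<Longrightarrow> y \<in> carrier G \<Longrightarrow>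
      fn (b g) (y, ()) = fn \<xi> (y, ()) - fn \<xi> (inv g \<otimes> y, ())" by blast
  have "fn (P ?v) (y, i) = fn \<xi> (y, ()) - fn \<xi> (inv x i \<otimes> y, ())" if i: "i \<in> S" and y: "y \<in> carrier G" for i y
  proof -
    have xi: "x i \<in> carrier G" using i by (rule x_closed)
    have w: "[(i, True)] \<in> carrier F" using i by (simp add: free_group_def Defs.reduced_def)
    have "\<phi> [(i, True)] = x i" using xi by (rule free_lift_generator[OF is_group])
    then have "fn (P ?v) (y, i) = f y - f (inv x i \<otimes> y)" using f[OF w y] by simp
    also have "\<dots> = fn (b (x i)) (y, ())" using fnb[OF xi] y by simp
    also have "\<dots> = fn \<xi> (y, ()) - fn \<xi> (inv x i \<otimes> y, ())" by (rule \<xi>[OF xi y])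
    finally show ?thesis .
  qed
  then show "\<exists>\<xi> :: ('a \<times> unit) ell2. \<forall>i\<in>S. \<forall>y\<in>carrier G.
      fn (P ?v) (y, i) = fn \<xi> (y, ()) - fn \<xi> (inv x i \<otimes> y, ())" by blast
qed

end

theorem corollary2:
  fixes G :: "('a, 'b) monoid_scheme"
    and x :: "nat \<Rightarrow> 'a"
    and u :: "nat \<Rightarrow> (nat \<times> bool) list"
    and m :: "nat \<Rightarrow> nat"
    and d r :: nat
  assumes "group G"
    and "\<And>i. i \<in> {1..r} \<Longrightarrow> u i \<in> carrier (free_group {1..d})"
    and "\<And>i. i \<in> {1..r} \<Longrightarrow> m i > 0"
    and "presented_by G x {1..d} ((\<lambda>i. u i [^]\<^bsub>free_group {1..d}\<^esub> m i) ` {1..r})"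
    and "\<And>i. i \<in> {1..r} \<Longrightarrow> group.ord G (free_lift G x (u i)) = m i"
    and "real d > 1 + (\<Sum>i = 1..r. 1 / real (m i))"
  shows "infinite (carrier G) \<and>
         \<not> property_T G \<and>
         \<not> (\<exists>N. N \<lhd> G \<and> infinite N \<and> amenable_group (G\<lparr>carrier := N\<rparr>))"
proof -
  interpret group G by fact
  interpret generated_group G x "{1..d}"
    by unfold_locales (use assms(4) in \<open>simp add: presented_by_def\<close>)
  obtain \<Phi> :: "('a \<times> nat) ell2 \<Rightarrow> ('a \<times> nat) ell2" and P
    where P: "gop G {1..d} {1..d} P P" "kernel_proj \<Phi> P"
      and dim: "gtrace G {1..d} P \<ge> card {1..d} - (\<Sum>i\<in>{1..r}. 1 / m i)"
      and pot: "\<And>v. \<exists>f. \<forall>w\<in>carrier F. \<forall>y\<in>carrier G.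
        word_cocycle G x (fn (P v)) w y = f y - f (inv\<^bsub>G\<^esub> (\<phi> w) \<otimes>\<^bsub>G\<^esub> y)"
    by (rule cocycle_space_dimension[OF finite_atLeastAtMost finite_atLeastAtMost assms(2-5)]) blast+
  have big: "gtrace G {1..d} P > 1" using dim assms(6) by simp
  note inner = bounded_cocycles_dimension[OF finite_atLeastAtMost assms(4) P pot]
  have "infinite (carrier G)"
  proof
    assume "finite (carrier G)"
    then have "gtrace G {1..d} P \<le> 1" by (intro inner finite_imp_bounded finite_imageI)
    then show False using big by simp
  qed
  moreover have "\<not> property_T G"
  proof
    assume "property_T G"
    then have "gtrace G {1..d} P \<le> 1" by (intro inner property_T_bounded)
    then show False using big by simp
  qed
  moreover have False if N: "N \<lhd> G" "infinite N" "amenable_group (G\<lparr>carrier := N\<rparr>)" for N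
  proof -
    have "gtrace G {1..d} P \<le> 1"
      by (rule folner_normal_dimension[OF finite_atLeastAtMost assms(4) P pot N(1,2)])
        (rule amenable_subgroup_folner[OF normal_imp_subgroup[OF N(1)] N(3)])
    then show False using big by simp
  qed
  ultimately show ?thesis by blast
qed

end
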